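(* Let $d\in\mathbb{N}$ and let $\mathcal{B}_b(\mathbb{R}^d)$ denote the set of bounded Borel functions on $\mathbb{R}^d$. Then: 1. $\mathcal{K}(X)\subseteq\mathbb{K}(X)\subseteq(L^1_{loc})_{uni}(\mathbb{R}^d)$ for every Lévy process $X$ in $\mathbb{R}^d$; 2. $\mathcal{B}_b(\mathbb{R}^d)\subseteq\mathbb{K}(X)$ for every Lévy process $X$ in $\mathbb{R}^d$; 3. $\mathcal{B}_b(\mathbb{R}^d)\subseteq\mathcal{K}(X)$ for every Lévy process $X$ in $\mathbb{R}^d$ which is not a compound Poisson process; 4. $\mathcal{K}(X)=\{0\}$ and $\mathbb{K}(X)=\mathcal{B}_b(\mathbb{R}^d)$ for every compound Poisson process $X$ in $\mathbb{R}^d$.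
   Context: All functions $q:\mathbb{R}^d\to\mathbb{R}$ are Borel. $\mathbb{E}^x$ is the expectation for $X$ started at $x$; $B(x,r)$ is the open Euclidean ball. $\mathbb{K}(X)$ is the set of $q$ with $\lim_{t\to0^+}\sup_x\mathbb{E}^x\int_0^t|q(X_u)|du=0$. $\mathcal{K}(X)$ is the set of $q$ such that for some (equivalently every) $\lambda>0$, $\lim_{r\to0^+}\sup_x\mathbb{E}^x\int_0^\infty e^{-\lambda u}\mathbf 1_{B(x,r)}(X_u)|q(X_u)|du=0$. $(L^1_{loc})_{uni}(\mathbb{R}^d)$ is the set of $q$ with $\sup_{x\in\mathbb{R}^d}\int_{B(x,1)}|q(z)|dz<\infty$. A Lévy process is called compound Poisson if its Gaussian part is zero, its Lévy measure $\nu$ is finite, and its drift is zero (exponent $\psi(x)=-\int(e^{i\langle x,z\rangle}-1)\nu(dz)$ with $\nu$ finite). *)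

theory Defs
  imports "HOL-Probability.Probability"
begin

text \<open>Only times \<open>t \<ge> 0\<close> matter; the values \<open>X t\<close> for \<open>t < 0\<close> are unconstrained.\<close>

definition cadlag :: "(real \<Rightarrow> 'a::topological_space) \<Rightarrow> bool" where
  "cadlag f \<longleftrightarrow> (\<forall>t\<ge>0. (f \<longlongrightarrow> f t) (at_right t)) \<and>
                (\<forall>t>0. \<exists>l. (f \<longlongrightarrow> l) (at_left t))"

locale levy_process = prob_space M
  for M :: "'w measure" and X :: "real \<Rightarrow> 'w \<Rightarrow> 'a::euclidean_space" +
  assumes random_variable: "\<And>t. 0 \<le> t \<Longrightarrow> random_variable borel (X t)"
    and start_zero: "AE \<omega> in M. X 0 \<omega> = 0"
    and independent_increments:
      "\<And>(n::nat) (t::nat \<Rightarrow> real). 0 \<le> t 0 \<Longrightarrow> (\<And>k. k < n \<Longrightarrow> t k < t (Suc k)) \<Longrightarrow>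
        indep_vars (\<lambda>_. borel) (\<lambda>k \<omega>. X (t (Suc k)) \<omega> - X (t k) \<omega>) {..<n}"
    and stationary_increments:
      "\<And>s t. 0 \<le> s \<Longrightarrow> 0 \<le> t \<Longrightarrow>
        distr M borel (\<lambda>\<omega>. X (s + t) \<omega> - X s \<omega>) = distr M borel (X t)"
    and stochastically_continuous:
      "\<And>t \<epsilon>. 0 \<le> t \<Longrightarrow> 0 < \<epsilon> \<Longrightarrow>
        ((\<lambda>s. prob {\<omega> \<in> space M. dist (X s \<omega>) (X t \<omega>) > \<epsilon>}) \<longlongrightarrow> 0) (at t within {0..})"
    and cadlag_paths: "AE \<omega> in M. cadlag (\<lambda>t. X t \<omega>)"

text \<open>
  Convention: \<open>E exp(i \<langle>\<xi>, X\<^sub>t\<rangle>) = exp(- t \<psi>(\<xi>))\<close>.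
\<close>

definition has_levy_exponent ::
  "'w measure \<Rightarrow> (real \<Rightarrow> 'w \<Rightarrow> 'a::euclidean_space) \<Rightarrow> ('a \<Rightarrow> complex) \<Rightarrow> bool" where
  "has_levy_exponent M X \<psi> \<longleftrightarrow>
     (\<forall>t\<ge>0. \<forall>\<xi>. (CLINT \<omega>|M. iexp (\<xi> \<bullet> X t \<omega>)) = exp (- (of_real t * \<psi> \<xi>)))"

text \<open>
  Zero Gaussian part, finite Levy measure and zero drift, expressed through the exponent.
  The measure \<open>\<nu> = 0\<close> is allowed, so the process that stays at its starting point counts
  as compound Poisson.
\<close>

definition compound_poisson ::
  "'w measure \<Rightarrow> (real \<Rightarrow> 'w \<Rightarrow> 'a::euclidean_space) \<Rightarrow> bool" where
  "compound_poisson M X \<longleftrightarrow> levy_process M X \<and>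
     (\<exists>\<nu> :: 'a measure. finite_measure \<nu> \<and> sets \<nu> = sets borel \<and> emeasure \<nu> {0} = 0 \<and>
        has_levy_exponent M X (\<lambda>\<xi>. - (CLINT z|\<nu>. iexp (\<xi> \<bullet> z) - 1)))"

text \<open>
  The expectation \<open>E\<^sup>x F(X)\<close> of a nonnegative path functional \<open>F\<close>: a Levy process
  started at \<open>x\<close> is \<open>x + X\<close>.
\<close>

definition expectation_from ::
  "'w measure \<Rightarrow> (real \<Rightarrow> 'w \<Rightarrow> 'a::euclidean_space) \<Rightarrow> 'a \<Rightarrow> ((real \<Rightarrow> 'a) \<Rightarrow> ennreal) \<Rightarrow> ennreal"
  where "expectation_from M X x F = (\<integral>\<^sup>+\<omega>. F (\<lambda>u. x + X u \<omega>) \<partial>M)"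

text \<open>The class \<open>K(X)\<close> in blackboard bold, defined by small times.\<close>

definition kato_time ::
  "'w measure \<Rightarrow> (real \<Rightarrow> 'w \<Rightarrow> 'a::euclidean_space) \<Rightarrow> ('a \<Rightarrow> real) set" where
  "kato_time M X = {q \<in> borel_measurable borel.
     ((\<lambda>t. SUP x. expectation_from M X x
          (\<lambda>Y. \<integral>\<^sup>+u\<in>{0..t}. ennreal \<bar>q (Y u)\<bar> \<partial>lborel)) \<longlongrightarrow> 0) (at_right 0)}"

text \<open>The class \<open>K(X)\<close> in calligraphic type, defined by small balls. The condition does not
  depend on the choice of \<open>\<alpha> > 0\<close>.\<close>

definition kato_space ::
  "'w measure \<Rightarrow> (real \<Rightarrow> 'w \<Rightarrow> 'a::euclidean_space) \<Rightarrow> ('a \<Rightarrow> real) set" where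
  "kato_space M X = {q \<in> borel_measurable borel. \<exists>\<alpha>>0.
     ((\<lambda>r. SUP x. expectation_from M X x
          (\<lambda>Y. \<integral>\<^sup>+u\<in>{0..}. ennreal (exp (- \<alpha> * u) * indicator (ball x r) (Y u) * \<bar>q (Y u)\<bar>)
             \<partial>lborel)) \<longlongrightarrow> 0) (at_right 0)}"

definition L1_loc_uni :: "('a::euclidean_space \<Rightarrow> real) set" where
  "L1_loc_uni = {q \<in> borel_measurable borel.
     (SUP x. \<integral>\<^sup>+z\<in>ball x 1. ennreal \<bar>q z\<bar> \<partial>lborel) < \<infinity>}"

definition bounded_borel :: "('a::euclidean_space \<Rightarrow> real) set" where
  "bounded_borel = {q \<in> borel_measurable borel. bounded (range q)}"

end

(*
  Replacing X by a modification, all paths start at 0 and are right-continuous, so X is jointly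
  measurable and Tonelli applies.

  K(X, balls) in K(X, times): for bounded q let A_t = sup_x E^x int_0^t |q(X_u)| du.  Splitting at
  the first exit from a ball of radius rho < r and using the Markov property there gives
  A_t <= e^(alpha t) S_r + P(exit before t) A_t, where S_r is the supremum in the small-ball
  condition; if the exit probability is at most 1/2 then A_t <= 2 e^(alpha t) S_r.  The strong
  Markov property is avoided by observing the exit on finer and finer dyadic grids, and unbounded
  q are truncated.  Local integrability follows by integrating A_t over x in a ball of radius 2.

  Let p(u) = P(X_u = 0).  For bounded q everything reduces to int_0^infinity e^(-u) p(u) du = 0.
  If this fails, then int P(X_u = 0, X_(u+s) = 0) du = p(s) int p(u) du, and the left-hand side
  tends to int p(u) du as s -> 0 because translations are continuous in L^1; hence p(s) -> 1.
  Since P(U + V = 0) <= p^2 + (1-p)^2 for independent copies U, V of X_s, the numbers y = 2p - 1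
  satisfy y(2s) <= y(s)^2, so 1 - p(s) = O(s) along s = t/2^n.  Then the rescaled laws of X_s off 0
  decrease to a finite measure, which is the Levy measure, and the drift vanishes.

  Conversely, for a compound Poisson process Re phi_u is bounded below by a positive constant for
  small u, uniformly in the frequency.  Averaging over the multiples of a generic frequency gives
  the same lower bound for p(u), so E^x int_0^t |q(X_u)| du >= c t |q(x)|.
*)
theory Submission
  imports Defs
begin

subsection \<open>Regularisation of the paths\<close>

text \<open>Independence and stationarity are assumed at deterministic times only, so every Markov
  argument runs on finite grids, where a first exit takes finitely many values; right continuity
  recovers the limit over finer grids. The inequality for A_t can be absorbed only when A_t is
  finite. This is why bounded q come first, and the constant obtained must not depend on the bound.
  Compound Poisson is a condition on the exponent, so for a process that revisits its start the jump
  measure has to be built from the laws of X themselves. An estimate O(s) alone would only suggest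
  extracting a limit; monotonicity makes the rescaled laws converge on every Borel set, hence
  against every bounded function, and this fixes the exponent. In the opposite direction, averages
  of phi_u over the multiples of v converge to the probability that <v, X_u> lies in 2 pi Z. For a
  fixed nonzero vector the bad v fill countably many hyperplanes, so for almost every v this event
  is X_u = 0 up to a null set.\<close>

locale rc_levy_process = levy_process M X
  for M :: "'w measure" and X :: "real \<Rightarrow> 'w \<Rightarrow> 'a::euclidean_space" +
  assumes right_continuous: "\<And>\<omega> t. \<omega> \<in> space M \<Longrightarrow> ((\<lambda>u. X u \<omega>) \<longlongrightarrow> X t \<omega>) (at_right t)"
    and nonpos_time: "\<And>\<omega> t. \<omega> \<in> space M \<Longrightarrow> t \<le> 0 \<Longrightarrow> X t \<omega> = 0"

text \<open>Independence says that the joint law is the product of the marginal laws, and no law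
  changes when the variables are altered on a null set.\<close>

lemma (in prob_space) indep_vars_cong_AE:
  assumes indep: "indep_vars N X I"
    and rv: "\<And>i. i \<in> I \<Longrightarrow> random_variable (N i) (Y i)"
    and eq: "AE \<omega> in M. \<forall>i\<in>I. X i \<omega> = Y i \<omega>"
  shows "indep_vars N Y I"
proof (cases "I = {}")
  \<comment> \<open>The product characterisation excludes the empty index set, which does occur:
    \<open>independent_increments\<close> includes \<open>n = 0\<close>.\<close>
  case True
  then show ?thesis
    using indep by (simp add: indep_vars_def indep_sets_def)
next
  case False
  have rvX: "\<And>i. i \<in> I \<Longrightarrow> random_variable (N i) (X i)"
    using indep by (simp add: indep_vars_def)
  have "distr M (\<Pi>\<^sub>M i\<in>I. N i) (\<lambda>x. \<lambda>i\<in>I. Y i x) = distr M (\<Pi>\<^sub>M i\<in>I. N i) (\<lambda>x. \<lambda>i\<in>I. X i x)"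
    using rv rvX eq by (intro distr_cong_AE) (auto simp: fun_eq_iff intro!: measurable_restrict)
  also have "\<dots> = (\<Pi>\<^sub>M i\<in>I. distr M (N i) (X i))"
    using indep_vars_iff_distr_eq_PiM'[where I=I and M'=N and X=X, OF False rvX] indep by blast
  also have "\<dots> = (\<Pi>\<^sub>M i\<in>I. distr M (N i) (Y i))"
    using rv rvX eq by (intro PiM_cong refl distr_cong_AE) auto
  finally show ?thesis
    using indep_vars_iff_distr_eq_PiM'[where I=I and M'=N and X=Y, OF False rv] by blast
qed

text \<open>Setting the process to \<open>0\<close> for \<open>t < 0\<close> makes right continuity, and hence joint
  measurability, available on the whole line.\<close>

lemma (in levy_process) rc_modification:
  obtains Y where "rc_levy_process M Y" "AE \<omega> in M. \<forall>u\<ge>0. X u \<omega> = Y u \<omega>"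
proof -
  have "AE \<omega> in M. cadlag (\<lambda>t. X t \<omega>) \<and> X 0 \<omega> = 0"
    using cadlag_paths start_zero by eventually_elim simp
  then obtain N where N: "\<And>\<omega>. \<omega> \<in> space M - N \<Longrightarrow> cadlag (\<lambda>t. X t \<omega>) \<and> X 0 \<omega> = 0"
      and "N \<in> null_sets M"
    by (erule AE_E3)
  \<comment> \<open>Killing the path on the whole exceptional set makes right continuity and the
    value 0 at time 0 hold at every point of \<open>space M\<close>, as the pointwise limit
    arguments below require.\<close>
  define Y where "Y u \<omega> = (if \<omega> \<in> N \<or> u < 0 then 0 else X u \<omega>)" for u \<omega>
  have AE_N: "AE \<omega> in M. \<omega> \<notin> N"
    using \<open>N \<in> null_sets M\<close> by (rule AE_not_in)
  have eq: "AE \<omega> in M. \<forall>u\<ge>0. X u \<omega> = Y u \<omega>"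
    using AE_N by eventually_elim (auto simp: Y_def)
  have [measurable]: "N \<in> sets M"
    using \<open>N \<in> null_sets M\<close> by auto
  have rv: "random_variable borel (Y t)" for t
  proof (cases "t < 0")
    case False
    then have [measurable]: "random_variable borel (X t)"
      by (simp add: random_variable)
    show ?thesis
      unfolding Y_def using False by (simp, measurable)
  qed (simp add: Y_def[abs_def])
  have cad: "cadlag (\<lambda>t. Y t \<omega>)" if "\<omega> \<in> space M" for \<omega>
  proof (cases "\<omega> \<in> N")
    case True
    then show ?thesis by (auto simp: cadlag_def Y_def)
  next
    case False
    then have c: "cadlag (\<lambda>t. X t \<omega>)"
      using N that by blast
    have r: "((\<lambda>u. Y u \<omega>) \<longlongrightarrow> Y t \<omega>) (at_right t)" if "0 \<le> t" for t
    proof -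
      have "((\<lambda>u. X u \<omega>) \<longlongrightarrow> X t \<omega>) (at_right t)"
        using c that by (simp add: cadlag_def)
      moreover have "\<forall>\<^sub>F u in at_right t. X u \<omega> = Y u \<omega>"
        using False that by (auto simp: Y_def eventually_at_filter)
      ultimately have "((\<lambda>u. Y u \<omega>) \<longlongrightarrow> X t \<omega>) (at_right t)"
        by (rule Lim_transform_eventually)
      then show ?thesis
        using False that by (simp add: Y_def)
    qed
    have l: "\<exists>l. ((\<lambda>u. Y u \<omega>) \<longlongrightarrow> l) (at_left t)" if "0 < t" for t
    proof -
      have "\<exists>l. ((\<lambda>u. X u \<omega>) \<longlongrightarrow> l) (at_left t)"
        using c that by (simp add: cadlag_def)
      then obtain l where "((\<lambda>u. X u \<omega>) \<longlongrightarrow> l) (at_left t)" ..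
      moreover have "\<forall>\<^sub>F u in at_left t. X u \<omega> = Y u \<omega>"
        using eventually_at_left_real[OF that] by eventually_elim (use False in \<open>auto simp: Y_def\<close>)
      ultimately show ?thesis
        by (blast intro: Lim_transform_eventually)
    qed
    show ?thesis
      using r l by (simp add: cadlag_def)
  qed
  have zero: "Y t \<omega> = 0" if "\<omega> \<in> space M" "t \<le> 0" for \<omega> t
    using N that by (cases "t = 0") (auto simp: Y_def)
  have "levy_process M Y"
  proof unfold_locales
    show "random_variable borel (Y t)" for t by (rule rv)
    show "AE \<omega> in M. Y 0 \<omega> = 0"
      using zero by (intro AE_I2) auto
    show "AE \<omega> in M. cadlag (\<lambda>t. Y t \<omega>)"
      using cad by (intro AE_I2) auto
    show "indep_vars (\<lambda>_. borel) (\<lambda>k \<omega>. Y (t (Suc k)) \<omega> - Y (t k) \<omega>) {..<n}"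
      if t: "0 \<le> t 0" "\<And>k. k < n \<Longrightarrow> t k < t (Suc k)" for n :: nat and t :: "nat \<Rightarrow> real"
    proof (rule indep_vars_cong_AE[OF independent_increments[OF t]])
      \<comment> \<open>\<open>X\<close> and \<open>Y\<close> agree at nonnegative times only, so
        every grid time has to be checked to be one.\<close>
      have nn: "0 \<le> t k" if "k \<le> n" for k
        using that
      proof (induction k)
        case (Suc k)
        then show ?case using t(2)[of k] by force
      qed (use t in auto)
      show "AE \<omega> in M. \<forall>k\<in>{..<n}. X (t (Suc k)) \<omega> - X (t k) \<omega> = Y (t (Suc k)) \<omega> - Y (t k) \<omega>"
        using eq by eventually_elim (use nn in auto)
    qed (use rv in measurable)
    show "distr M borel (\<lambda>\<omega>. Y (s + t) \<omega> - Y s \<omega>) = distr M borel (Y t)"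
      if "0 \<le> s" "0 \<le> t" for s t
    proof -
      note [measurable] = rv random_variable[OF that(1)] random_variable[OF that(2)]
        random_variable[OF add_nonneg_nonneg[OF that]]
      have "distr M borel (\<lambda>\<omega>. Y (s + t) \<omega> - Y s \<omega>) = distr M borel (\<lambda>\<omega>. X (s + t) \<omega> - X s \<omega>)"
        by (intro distr_cong_AE refl; (measurable)?) (use eq that in \<open>auto elim!: eventually_mono\<close>)
      also have "\<dots> = distr M borel (X t)"
        by (rule stationary_increments[OF that])
      also have "\<dots> = distr M borel (Y t)"
        by (intro distr_cong_AE refl; (measurable)?) (use eq that in \<open>auto elim!: eventually_mono\<close>)
      finally show ?thesis .
    qed
    show "((\<lambda>s. prob {\<omega> \<in> space M. dist (Y s \<omega>) (Y t \<omega>) > \<epsilon>}) \<longlongrightarrow> 0) (at t within {0..})"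
      if t: "0 \<le> t" "0 < \<epsilon>" for t \<epsilon>
    proof -
      have "prob {\<omega> \<in> space M. dist (X s \<omega>) (X t \<omega>) > \<epsilon>} = prob {\<omega> \<in> space M. dist (Y s \<omega>) (Y t \<omega>) > \<epsilon>}"
        if "0 \<le> s" for s
      proof -
        note [measurable] = rv random_variable[OF that(1)] random_variable[OF t(1)]
        show ?thesis
          by (intro measure_eq_AE; (measurable)?) (use eq that t in \<open>auto elim!: eventually_mono\<close>)
      qed
      then have "\<forall>\<^sub>F s in at t within {0..}. prob {\<omega> \<in> space M. dist (X s \<omega>) (X t \<omega>) > \<epsilon>} =
          prob {\<omega> \<in> space M. dist (Y s \<omega>) (Y t \<omega>) > \<epsilon>}"
        by (auto simp: eventually_at_filter)
      from tendsto_cong[OF this] show ?thesis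
        using stochastically_continuous[OF t] by simp
    qed
  qed
  then interpret Y: levy_process M Y .
  have "rc_levy_process M Y"
  proof unfold_locales
    show "((\<lambda>u. Y u \<omega>) \<longlongrightarrow> Y t \<omega>) (at_right t)" if "\<omega> \<in> space M" for \<omega> t
    proof (cases "0 \<le> t")
      case True
      then show ?thesis using cad[OF that] by (simp add: cadlag_def)
    next
      case False
      then have "\<forall>\<^sub>F u in at_right t. 0 = Y u \<omega>"
        using eventually_at_right_real[of t 0] by (auto simp: Y_def elim!: eventually_mono)
      from tendsto_cong[OF this] show ?thesis
        using False by (auto simp: Y_def)
    qed
  qed (rule zero)
  then show thesis
    using that eq by blast
qed

lemma kato_time_cong:
  assumes "AE \<omega> in M. \<forall>u\<ge>0. X u \<omega> = Y u \<omega>"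
  shows "kato_time M X = kato_time M Y"
proof -
  have "expectation_from M X x (\<lambda>Y. \<integral>\<^sup>+u\<in>{0..t}. ennreal \<bar>q (Y u)\<bar> \<partial>lborel) =
        expectation_from M Y x (\<lambda>Y. \<integral>\<^sup>+u\<in>{0..t}. ennreal \<bar>q (Y u)\<bar> \<partial>lborel)" for x t and q :: "'b \<Rightarrow> real"
    unfolding expectation_from_def using assms
    by (intro nn_integral_cong_AE) (auto elim!: eventually_mono intro!: nn_integral_cong split: split_indicator)
  then show ?thesis
    by (simp add: kato_time_def)
qed

lemma kato_space_cong:
  assumes "AE \<omega> in M. \<forall>u\<ge>0. X u \<omega> = Y u \<omega>"
  shows "kato_space M X = kato_space M Y"
proof -
  have "expectation_from M X x (\<lambda>Y. \<integral>\<^sup>+u\<in>{0..}. ennreal (exp (- \<alpha> * u) * indicator (ball x r) (Y u) * \<bar>q (Y u)\<bar>) \<partial>lborel) =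
        expectation_from M Y x (\<lambda>Y. \<integral>\<^sup>+u\<in>{0..}. ennreal (exp (- \<alpha> * u) * indicator (ball x r) (Y u) * \<bar>q (Y u)\<bar>) \<partial>lborel)"
    for x r \<alpha> and q :: "'b \<Rightarrow> real"
    unfolding expectation_from_def using assms
    by (intro nn_integral_cong_AE) (auto elim!: eventually_mono intro!: nn_integral_cong simp: indicator_def)
  then show ?thesis
    by (simp add: kato_space_def)
qed

lemma compound_poisson_cong:
  assumes "levy_process M X" "levy_process M Y" "AE \<omega> in M. \<forall>u\<ge>0. X u \<omega> = Y u \<omega>"
  shows "compound_poisson M X = compound_poisson M Y"
proof -
  interpret X: levy_process M X by fact
  interpret Y: levy_process M Y by fact
  have "(CLINT \<omega>|M. iexp (\<xi> \<bullet> X t \<omega>)) = (CLINT \<omega>|M. iexp (\<xi> \<bullet> Y t \<omega>))" if "0 \<le> t" for t \<xi>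
  proof -
    note [measurable] = X.random_variable[OF that] Y.random_variable[OF that]
    show ?thesis
      by (rule integral_cong_AE; (measurable)?) (use assms(3) that in \<open>auto elim!: eventually_mono\<close>)
  qed
  then have "has_levy_exponent M X \<psi> = has_levy_exponent M Y \<psi>" for \<psi>
    by (simp add: has_levy_exponent_def)
  then show ?thesis
    using assms by (simp add: compound_poisson_def)
qed

subsection \<open>The Markov property\<close>

text \<open>The joint law is a product, so Tonelli integrates \<open>V\<close> out with
  \<open>U\<close> frozen. The independent copy is a second integration variable on the same
  \<open>M\<close>; no product space is built.\<close>

lemma (in prob_space) nn_integral_indep_var:
  assumes indep: "indep_var S U T V" and f [measurable]: "f \<in> borel_measurable (S \<Otimes>\<^sub>M T)"
  shows "(\<integral>\<^sup>+\<omega>. f (U \<omega>, V \<omega>) \<partial>M) = (\<integral>\<^sup>+\<omega>. (\<integral>\<^sup>+\<omega>'. f (U \<omega>, V \<omega>') \<partial>M) \<partial>M)"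
proof -
  have [measurable]: "random_variable S U" "random_variable T V"
    and eq: "distr M S U \<Otimes>\<^sub>M distr M T V = distr M (S \<Otimes>\<^sub>M T) (\<lambda>\<omega>. (U \<omega>, V \<omega>))"
    using indep unfolding indep_var_distribution_eq by auto
  interpret V: prob_space "distr M T V"
    by (rule prob_space_distr) measurable
  have "(\<integral>\<^sup>+\<omega>. f (U \<omega>, V \<omega>) \<partial>M) = (\<integral>\<^sup>+z. f z \<partial>(distr M S U \<Otimes>\<^sub>M distr M T V))"
    by (simp add: eq nn_integral_distr)
  also have "\<dots> = (\<integral>\<^sup>+\<omega>. (\<integral>\<^sup>+\<omega>'. f (U \<omega>, V \<omega>') \<partial>M) \<partial>M)"
  proof (subst V.nn_integral_fst[symmetric])
    have "(\<integral>\<^sup>+y. f (U \<omega>, y) \<partial>distr M T V) = (\<integral>\<^sup>+\<omega>'. f (U \<omega>, V \<omega>') \<partial>M)" if "\<omega> \<in> space M" for \<omega>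
      using measurable_space[OF \<open>random_variable S U\<close> that] by (intro nn_integral_distr) measurable
    then show "(\<integral>\<^sup>+x. \<integral>\<^sup>+y. f (x, y) \<partial>distr M T V \<partial>distr M S U) = (\<integral>\<^sup>+\<omega>. (\<integral>\<^sup>+\<omega>'. f (U \<omega>, V \<omega>') \<partial>M) \<partial>M)"
      by (subst nn_integral_distr) (auto intro!: nn_integral_cong)
  qed measurable
  finally show ?thesis .
qed

text \<open>Floor plus one, not the ceiling: the grid point must lie strictly to the right of
  \<open>u\<close> even when \<open>u\<close> is itself dyadic.\<close>

lemma filterlim_dyadic_at_right:
  "filterlim (\<lambda>n. real_of_int (\<lfloor>u * 2 ^ n\<rfloor> + 1) / 2 ^ n) (at_right u) sequentially"
proof -
  define s where "s n = real_of_int (\<lfloor>u * 2 ^ n\<rfloor> + 1) / 2 ^ n" for n :: nat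
  have gt: "u < s n" for n
    unfolding s_def by (simp add: field_simps) linarith
  have le: "s n \<le> u + (1/2) ^ n" for n
    unfolding s_def by (simp add: field_simps power_divide)
  have "(\<lambda>n. u + (1/2) ^ n) \<longlonglongrightarrow> u + 0"
    by (intro tendsto_intros LIMSEQ_realpow_zero) auto
  then have "s \<longlonglongrightarrow> u"
    by (intro tendsto_sandwich[of "\<lambda>_. u" s]) (use gt le in \<open>auto intro!: always_eventually less_imp_le\<close>)
  moreover have "s n \<noteq> u" for n
    using gt[of n] by simp
  ultimately have "filterlim s (at_right u) sequentially"
    using gt by (auto simp: filterlim_at intro!: always_eventually)
  then show ?thesis
    by (simp add: s_def[abs_def])
qed

context rc_levy_process
begin

lemma rv [measurable]: "random_variable borel (X t)"
proof (cases "0 \<le> t")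
  case False
  then have "random_variable borel (X t) \<longleftrightarrow> random_variable borel (\<lambda>_. 0 :: 'a)"
    by (intro measurable_cong) (simp add: nonpos_time)
  then show ?thesis by simp
qed (rule random_variable)

text \<open>Sampling at the next dyadic time uses countably many variables, so each approximant is
  jointly measurable; right continuity gives pointwise convergence.\<close>

lemma measurable_pair_process [measurable]:
  "(\<lambda>z. X (fst z) (snd z)) \<in> borel_measurable (borel \<Otimes>\<^sub>M M)"
proof (rule borel_measurable_LIMSEQ_metric)
  fix n :: nat
  show "(\<lambda>z. X (real_of_int (\<lfloor>fst z * (2::real) ^ n\<rfloor> + 1) / 2 ^ n) (snd z)) \<in> borel_measurable (borel \<Otimes>\<^sub>M M)"
    by (rule measurable_compose_countable[where g = "\<lambda>z. \<lfloor>fst z * (2::real) ^ n\<rfloor>"]) measurable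
next
  fix z assume "z \<in> space ((borel :: real measure) \<Otimes>\<^sub>M M)"
  then have z: "snd z \<in> space M" by (auto simp: space_pair_measure)
  show "(\<lambda>n. X (real_of_int (\<lfloor>fst z * 2 ^ n\<rfloor> + 1) / 2 ^ n) (snd z)) \<longlonglongrightarrow> X (fst z) (snd z)"
    by (rule filterlim_compose[OF right_continuous[OF z] filterlim_dyadic_at_right])
qed

lemma measurable_process [measurable (raw)]:
  assumes "f \<in> borel_measurable N" "g \<in> N \<rightarrow>\<^sub>M M"
  shows "(\<lambda>x. X (f x) (g x)) \<in> borel_measurable N"
  using measurable_compose[OF measurable_Pair[OF assms] measurable_pair_process] by simp

lemma nn_integral_increment:
  assumes "0 \<le> s" "0 \<le> u" and [measurable]: "f \<in> borel_measurable borel"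
  shows "(\<integral>\<^sup>+\<omega>. f (X (s + u) \<omega> - X s \<omega>) \<partial>M) = (\<integral>\<^sup>+\<omega>. f (X u \<omega>) \<partial>M)"
proof -
  have "(\<integral>\<^sup>+\<omega>. f (X (s + u) \<omega> - X s \<omega>) \<partial>M) = (\<integral>\<^sup>+z. f z \<partial>distr M borel (\<lambda>\<omega>. X (s + u) \<omega> - X s \<omega>))"
    by (simp add: nn_integral_distr)
  also have "\<dots> = (\<integral>\<^sup>+\<omega>. f (X u \<omega>) \<partial>M)"
    unfolding stationary_increments[OF assms(1,2)] by (simp add: nn_integral_distr)
  finally show ?thesis .
qed

text \<open>The Markov property at a grid time: since the process starts at 0, the past on the grid
  is a function of the first \<open>k\<close> increments, and these are independent of the next
  one.\<close>

lemma nn_integral_past_increment: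
  fixes t :: "nat \<Rightarrow> real"
  assumes t: "t 0 = 0" "\<And>j. j < k \<Longrightarrow> t j < t (Suc j)" and u: "0 \<le> u"
    and f [measurable]: "f \<in> borel_measurable (PiM {..k} (\<lambda>_. borel) \<Otimes>\<^sub>M borel)"
  shows "(\<integral>\<^sup>+\<omega>. f (\<lambda>j\<in>{..k}. X (t j) \<omega>, X (t k + u) \<omega> - X (t k) \<omega>) \<partial>M) =
    (\<integral>\<^sup>+\<omega>. (\<integral>\<^sup>+\<omega>'. f (\<lambda>j\<in>{..k}. X (t j) \<omega>, X u \<omega>') \<partial>M) \<partial>M)"
proof (cases "u = 0")
  case True
  have "(\<integral>\<^sup>+\<omega>'. f (\<lambda>j\<in>{..k}. X (t j) \<omega>, X 0 \<omega>') \<partial>M) = f (\<lambda>j\<in>{..k}. X (t j) \<omega>, 0)" for \<omega>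
    by (subst nn_integral_cong[of _ _ "\<lambda>_. f (\<lambda>j\<in>{..k}. X (t j) \<omega>, 0)"])
      (simp_all add: nonpos_time emeasure_space_1)
  then show ?thesis
    using True by simp
next
  case False
  \<comment> \<open>The grid extended by the time \<open>t k + u\<close>. The case
    \<open>u = 0\<close> is split off because \<open>independent_increments\<close> asks for
    strictly increasing times.\<close>
  define t' where "t' j = (if j \<le> k then t j else t k + u)" for j
  define D where "D j \<omega> = X (t' (Suc j)) \<omega> - X (t' j) \<omega>" for j \<omega>
  \<comment> \<open>Partial sums turn increments back into positions.\<close>
  define S where "S g = (\<lambda>j\<in>{..k}. \<Sum>i<j. g i)" for g :: "nat \<Rightarrow> 'a"
  have [measurable]: "random_variable borel (D j)" for j
    unfolding D_def by measurable
  have S [measurable]: "S \<in> PiM {..<k} (\<lambda>_. borel) \<rightarrow>\<^sub>M PiM {..k} (\<lambda>_. borel)"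
    unfolding S_def by (intro measurable_restrict borel_measurable_sum measurable_component_singleton) auto
  have [measurable]: "(\<lambda>f. f k) \<in> PiM {k} (\<lambda>_. borel) \<rightarrow>\<^sub>M (borel :: 'a measure)"
    by (intro measurable_component_singleton) auto
  have S_eq: "S (\<lambda>j\<in>{..<k}. D j \<omega>) = (\<lambda>j\<in>{..k}. X (t j) \<omega>)" if "\<omega> \<in> space M" for \<omega>
  proof
    fix j
    have "(\<Sum>i<j. X (t (Suc i)) \<omega> - X (t i) \<omega>) = X (t j) \<omega>"
      using that t(1) by (simp add: sum_lessThan_telescope[of "\<lambda>i. X (t i) \<omega>"] nonpos_time)
    then show "S (\<lambda>j\<in>{..<k}. D j \<omega>) j = (\<lambda>j\<in>{..k}. X (t j) \<omega>) j"
      by (auto simp: S_def D_def t'_def)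
  qed
  have D_k: "D k \<omega> = X (t k + u) \<omega> - X (t k) \<omega>" for \<omega>
    by (simp add: D_def t'_def)
  have "0 \<le> t j" if "j \<le> k" for j
    using that
  proof (induction j)
    case (Suc j)
    then show ?case using t(2)[of j] by simp
  qed (simp add: t)
  then have "0 \<le> t k" by simp
  have "indep_vars (\<lambda>_. borel) D {..<Suc k}"
    unfolding D_def by (rule independent_increments) (use t u False in \<open>auto simp: t'_def not_le less_Suc_eq\<close>)
  then have indep: "indep_var (PiM {..<k} (\<lambda>_. borel)) (\<lambda>\<omega>. \<lambda>j\<in>{..<k}. D j \<omega>)
      (PiM {k} (\<lambda>_. borel)) (\<lambda>\<omega>. \<lambda>j\<in>{k}. D j \<omega>)"
    by (rule indep_var_restrict) auto
  have "(\<integral>\<^sup>+\<omega>. f (\<lambda>j\<in>{..k}. X (t j) \<omega>, X (t k + u) \<omega> - X (t k) \<omega>) \<partial>M) =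
      (\<integral>\<^sup>+\<omega>. f (S (\<lambda>j\<in>{..<k}. D j \<omega>), D k \<omega>) \<partial>M)"
    by (intro nn_integral_cong) (simp add: S_eq D_k)
  also have "\<dots> = (\<integral>\<^sup>+\<omega>. (\<integral>\<^sup>+\<omega>'. f (S (\<lambda>j\<in>{..<k}. D j \<omega>), D k \<omega>') \<partial>M) \<partial>M)"
    using nn_integral_indep_var[OF indep, of "\<lambda>(x, y). f (S x, y k)"] by simp
  also have "\<dots> = (\<integral>\<^sup>+\<omega>. (\<integral>\<^sup>+\<omega>'. f (\<lambda>j\<in>{..k}. X (t j) \<omega>, D k \<omega>') \<partial>M) \<partial>M)"
    by (intro nn_integral_cong) (simp add: S_eq)
  also have "\<dots> = (\<integral>\<^sup>+\<omega>. (\<integral>\<^sup>+\<omega>'. f (\<lambda>j\<in>{..k}. X (t j) \<omega>, X u \<omega>') \<partial>M) \<partial>M)"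
  proof (rule nn_integral_cong)
    fix \<omega> assume "\<omega> \<in> space M"
    have "(\<lambda>j\<in>{..k}. X (t j) \<omega>) \<in> space (PiM {..k} (\<lambda>_. borel))"
      by (simp add: space_PiM)
    then have "(\<lambda>z. f (\<lambda>j\<in>{..k}. X (t j) \<omega>, z)) \<in> borel_measurable borel"
      by measurable
    from nn_integral_increment[OF \<open>0 \<le> t k\<close> u this]
    show "(\<integral>\<^sup>+\<omega>'. f (\<lambda>j\<in>{..k}. X (t j) \<omega>, D k \<omega>') \<partial>M) = (\<integral>\<^sup>+\<omega>'. f (\<lambda>j\<in>{..k}. X (t j) \<omega>, X u \<omega>') \<partial>M)"
      by (simp add: D_k)
  qed
  finally show ?thesis .
qed

lemma nn_integral_markov:
  assumes "0 \<le> s" "0 \<le> u" and [measurable]: "f \<in> borel_measurable (borel \<Otimes>\<^sub>M borel)"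
  shows "(\<integral>\<^sup>+\<omega>. f (X s \<omega>, X (s + u) \<omega> - X s \<omega>) \<partial>M) = (\<integral>\<^sup>+\<omega>. (\<integral>\<^sup>+\<omega>'. f (X s \<omega>, X u \<omega>') \<partial>M) \<partial>M)"
proof (cases "s = 0")
  case True
  have m: "(\<lambda>z. f (0, z)) \<in> borel_measurable borel" by measurable
  have "(\<integral>\<^sup>+\<omega>. f (X s \<omega>, X (s + u) \<omega> - X s \<omega>) \<partial>M) = (\<integral>\<^sup>+\<omega>'. f (0, X u \<omega>') \<partial>M)"
    using True by (intro nn_integral_cong) (simp add: nonpos_time)
  also have "\<dots> = (\<integral>\<^sup>+\<omega>. (\<integral>\<^sup>+\<omega>'. f (0, X u \<omega>') \<partial>M) \<partial>M)"
    by (simp add: emeasure_space_1)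
  also have "\<dots> = (\<integral>\<^sup>+\<omega>. (\<integral>\<^sup>+\<omega>'. f (X s \<omega>, X u \<omega>') \<partial>M) \<partial>M)"
    using True by (intro nn_integral_cong) (simp add: nonpos_time)
  finally show ?thesis .
next
  case False
  have [measurable]: "(\<lambda>g. g (Suc 0)) \<in> PiM {..Suc 0} (\<lambda>_. borel) \<rightarrow>\<^sub>M (borel :: 'a measure)"
    by (intro measurable_component_singleton) auto
  \<comment> \<open>The two-point grid \<open>0, s\<close>, which is strictly increasing only for
    positive \<open>s\<close>.\<close>
  show ?thesis
    using nn_integral_past_increment[of "\<lambda>j. real j * s" 1 u "\<lambda>(g, z). f (g (Suc 0), z)"] False assms
    by simp
qed

text \<open>On rectangles \<open>nn_integral_markov\<close> factorises. This form also covers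
  \<open>s = 0\<close> and \<open>u = 0\<close>, where the strict ordering of times in the locale
  fails, and it can be used with complex-valued integrands.\<close>

lemma indep_var_increment:
  assumes "0 \<le> s" "0 \<le> u"
  shows "indep_var borel (X s) borel (\<lambda>\<omega>. X (s + u) \<omega> - X s \<omega>)"
proof -
  interpret U: prob_space "distr M borel (X s)" by (rule prob_space_distr) measurable
  interpret V: prob_space "distr M borel (\<lambda>\<omega>. X (s + u) \<omega> - X s \<omega>)" by (rule prob_space_distr) measurable
  interpret pair_sigma_finite "distr M borel (X s)" "distr M borel (\<lambda>\<omega>. X (s + u) \<omega> - X s \<omega>)" ..
  have "distr M borel (X s) \<Otimes>\<^sub>M distr M borel (\<lambda>\<omega>. X (s + u) \<omega> - X s \<omega>) =
      distr M (borel \<Otimes>\<^sub>M borel) (\<lambda>\<omega>. (X s \<omega>, X (s + u) \<omega> - X s \<omega>))"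
  proof (rule pair_measure_eqI)
    fix A B :: "'a set"
    assume "A \<in> sets (distr M borel (X s))" "B \<in> sets (distr M borel (\<lambda>\<omega>. X (s + u) \<omega> - X s \<omega>))"
    then have [measurable]: "A \<in> sets borel" "B \<in> sets borel" by auto
    have "emeasure (distr M (borel \<Otimes>\<^sub>M borel) (\<lambda>\<omega>. (X s \<omega>, X (s + u) \<omega> - X s \<omega>))) (A \<times> B) =
       (\<integral>\<^sup>+\<omega>. indicator A (X s \<omega>) * indicator B (X (s + u) \<omega> - X s \<omega>) \<partial>M)"
      by (subst nn_integral_indicator[symmetric], measurable, subst nn_integral_distr)
        (auto simp: indicator_def intro!: nn_integral_cong)
    also have "\<dots> = (\<integral>\<^sup>+\<omega>. (\<integral>\<^sup>+\<omega>'. indicator A (X s \<omega>) * indicator B (X u \<omega>') \<partial>M) \<partial>M)"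
      using nn_integral_markov[OF assms, of "\<lambda>(x, y). indicator A x * indicator B y"] by simp
    also have "\<dots> = (\<integral>\<^sup>+\<omega>. indicator A (X s \<omega>) \<partial>M) * (\<integral>\<^sup>+\<omega>'. indicator B (X u \<omega>') \<partial>M)"
      by (simp add: nn_integral_cmult nn_integral_multc)
    also have "(\<integral>\<^sup>+\<omega>'. indicator B (X u \<omega>') \<partial>M) = (\<integral>\<^sup>+\<omega>. indicator B (X (s + u) \<omega> - X s \<omega>) \<partial>M)"
      using nn_integral_increment[OF assms, of "indicator B"] by simp
    also have "(\<integral>\<^sup>+\<omega>. indicator A (X s \<omega>) \<partial>M) = emeasure (distr M borel (X s)) A"
      by (simp flip: nn_integral_indicator add: nn_integral_distr)
    also have "(\<integral>\<^sup>+\<omega>. indicator B (X (s + u) \<omega> - X s \<omega>) \<partial>M) = emeasure (distr M borel (\<lambda>\<omega>. X (s + u) \<omega> - X s \<omega>)) B"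
      by (simp flip: nn_integral_indicator add: nn_integral_distr)
    finally show "emeasure (distr M borel (X s)) A * emeasure (distr M borel (\<lambda>\<omega>. X (s + u) \<omega> - X s \<omega>)) B =
      emeasure (distr M (borel \<Otimes>\<^sub>M borel) (\<lambda>\<omega>. (X s \<omega>, X (s + u) \<omega> - X s \<omega>))) (A \<times> B)" by simp
  qed (auto simp: U.sigma_finite_measure_axioms V.sigma_finite_measure_axioms cong: sets_pair_measure_cong)
  then show ?thesis
    by (simp add: indep_var_distribution_eq)
qed

section \<open>Potentials and the two Kato conditions after Tonelli\<close>

definition potential :: "('a \<Rightarrow> ennreal) \<Rightarrow> real \<Rightarrow> 'a \<Rightarrow> ennreal" where
  "potential q t x = (\<integral>\<^sup>+u\<in>{0..t}. (\<integral>\<^sup>+\<omega>. q (x + X u \<omega>) \<partial>M) \<partial>lborel)"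

text \<open>The resolvent seen only while the process is near its starting point:
  \<open>x + X u\<close> lies in \<open>ball x r\<close> exactly when \<open>X u\<close> lies in
  \<open>ball 0 r\<close>. Values in \<open>ennreal\<close> allow infinite potentials and
  truncation.\<close>

definition local_resolvent :: "real \<Rightarrow> ('a \<Rightarrow> ennreal) \<Rightarrow> real \<Rightarrow> 'a \<Rightarrow> ennreal" where
  "local_resolvent \<alpha> q r x = (\<integral>\<^sup>+u\<in>{0..}. ennreal (exp (- \<alpha> * u)) *
     (\<integral>\<^sup>+\<omega>. indicator (ball 0 r) (X u \<omega>) * q (x + X u \<omega>) \<partial>M) \<partial>lborel)"

lemma kato_time_eq:
  "kato_time M X = {q \<in> borel_measurable borel.
     ((\<lambda>t. SUP x. potential (\<lambda>z. ennreal \<bar>q z\<bar>) t x) \<longlongrightarrow> 0) (at_right 0)}"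
proof -
  interpret P: pair_sigma_finite lborel M ..
  have "expectation_from M X x (\<lambda>Y. \<integral>\<^sup>+u\<in>{0..t}. ennreal \<bar>q (Y u)\<bar> \<partial>lborel) = potential (\<lambda>z. ennreal \<bar>q z\<bar>) t x"
    if [measurable]: "q \<in> borel_measurable borel" for q t x
    unfolding expectation_from_def potential_def
    by (subst P.Fubini') (simp_all add: nn_integral_multc)
  then show ?thesis
    by (simp add: kato_time_def cong: conj_cong)
qed

lemma kato_space_eq:
  "kato_space M X = {q \<in> borel_measurable borel. \<exists>\<alpha>>0.
     ((\<lambda>r. SUP x. local_resolvent \<alpha> (\<lambda>z. ennreal \<bar>q z\<bar>) r x) \<longlongrightarrow> 0) (at_right 0)}"
proof -
  interpret P: pair_sigma_finite lborel M ..
  have "expectation_from M X x (\<lambda>Y. \<integral>\<^sup>+u\<in>{0..}. ennreal (exp (- \<alpha> * u) * indicator (ball x r) (Y u) * \<bar>q (Y u)\<bar>)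
             \<partial>lborel) = local_resolvent \<alpha> (\<lambda>z. ennreal \<bar>q z\<bar>) r x"
    if [measurable]: "q \<in> borel_measurable borel" for q \<alpha> r x
  proof -
    have [measurable]: "ball 0 r \<in> sets (borel :: 'a measure)" by simp
    have "expectation_from M X x (\<lambda>Y. \<integral>\<^sup>+u\<in>{0..}. ennreal (exp (- \<alpha> * u) * indicator (ball x r) (Y u) * \<bar>q (Y u)\<bar>)
             \<partial>lborel) = (\<integral>\<^sup>+\<omega>. (\<integral>\<^sup>+u. ennreal (exp (- \<alpha> * u)) * (indicator (ball 0 r) (X u \<omega>) * ennreal \<bar>q (x + X u \<omega>)\<bar>) * indicator {0..} u \<partial>lborel) \<partial>M)"
      unfolding expectation_from_def
      by (intro nn_integral_cong) (simp add: indicator_def dist_norm ennreal_mult flip: norm_minus_commute)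
    also have "\<dots> = local_resolvent \<alpha> (\<lambda>z. ennreal \<bar>q z\<bar>) r x"
      unfolding local_resolvent_def
      by (subst P.Fubini') (simp_all add: nn_integral_multc nn_integral_cmult)
    finally show ?thesis .
  qed
  then show ?thesis
    by (simp add: kato_space_def cong: conj_cong)
qed

subsection \<open>Bounded and locally integrable functions\<close>

lemma potential_le_const:
  assumes "\<And>z. q z \<le> ennreal c" "0 \<le> c" "0 \<le> t"
  shows "potential q t x \<le> ennreal (c * t)"
proof -
  have "(\<integral>\<^sup>+\<omega>. q (x + X u \<omega>) \<partial>M) \<le> (\<integral>\<^sup>+\<omega>. ennreal c \<partial>M)" for u
    by (intro nn_integral_mono assms)
  then have "(\<integral>\<^sup>+\<omega>. q (x + X u \<omega>) \<partial>M) \<le> ennreal c" for u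
    by (simp add: emeasure_space_1)
  then have "potential q t x \<le> (\<integral>\<^sup>+u\<in>{0..t}. ennreal c \<partial>lborel)"
    unfolding potential_def by (intro nn_integral_mono mult_right_mono) auto
  also have "\<dots> = ennreal (c * t)"
    using assms by (simp add: nn_integral_cmult_indicator ennreal_mult)
  finally show ?thesis .
qed

lemma bounded_borel_subset_kato_time: "bounded_borel \<subseteq> kato_time M X"
proof
  fix q :: "'a \<Rightarrow> real"
  assume "q \<in> bounded_borel"
  then have q: "q \<in> borel_measurable borel" and "bounded (range q)"
    by (auto simp: bounded_borel_def)
  then obtain c where c: "0 < c" "\<And>z. \<bar>q z\<bar> \<le> c"
    by (auto simp: bounded_pos)
  have "((\<lambda>t. SUP x. potential (\<lambda>z. ennreal \<bar>q z\<bar>) t x) \<longlongrightarrow> 0) (at_right 0)"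
  proof (rule tendsto_sandwich)
    show "\<forall>\<^sub>F t in at_right 0. (0::ennreal) \<le> (SUP x. potential (\<lambda>z. ennreal \<bar>q z\<bar>) t x)"
      by (rule always_eventually) (rule allI, rule zero_le)
    show "\<forall>\<^sub>F t in at_right 0. (SUP x. potential (\<lambda>z. ennreal \<bar>q z\<bar>) t x) \<le> ennreal (c * t)"
      using eventually_at_right_less[of "0::real"]
      by eventually_elim (use c in \<open>auto intro!: SUP_least potential_le_const ennreal_leI\<close>)
    have "((\<lambda>t. ennreal (c * t)) \<longlongrightarrow> ennreal (c * 0)) (at_right 0)"
      by (intro tendsto_intros)
    then show "((\<lambda>t. ennreal (c * t)) \<longlongrightarrow> 0) (at_right 0)"
      by (simp only: mult_zero_right ennreal_0)
  qed (rule tendsto_const)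
  with q show "q \<in> kato_time M X"
    by (simp add: kato_time_eq)
qed

lemma prob_near_zero: "((\<lambda>s. prob {\<omega> \<in> space M. \<epsilon> < norm (X s \<omega>)}) \<longlongrightarrow> 0) (at_right 0)" if "0 < \<epsilon>"
proof -
  have "((\<lambda>s. prob {\<omega> \<in> space M. dist (X s \<omega>) (X 0 \<omega>) > \<epsilon>}) \<longlongrightarrow> 0) (at_right 0)"
    by (rule tendsto_within_subset[OF stochastically_continuous]) (use that in auto)
  moreover have "{\<omega> \<in> space M. dist (X s \<omega>) (X 0 \<omega>) > \<epsilon>} = {\<omega> \<in> space M. \<epsilon> < norm (X s \<omega>)}" for s
    by (auto simp: nonpos_time)
  ultimately show ?thesis by simp
qed

text \<open>For small \<open>u\<close> the displacement has norm at most 1 with probability at least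
  1/2. Then the unit ball about \<open>y\<close>, shifted back by it, stays inside the ball of
  radius 2, so averaging the potential over that larger ball sees at least half of the local
  integral for a time \<open>t\<close>.\<close>

lemma kato_time_subset_L1_loc_uni: "kato_time M X \<subseteq> L1_loc_uni"
proof
  fix q :: "'a \<Rightarrow> real"
  assume "q \<in> kato_time M X"
  then have q [measurable]: "q \<in> borel_measurable borel"
    and lim: "((\<lambda>t. SUP x. potential (\<lambda>z. ennreal \<bar>q z\<bar>) t x) \<longlongrightarrow> 0) (at_right 0)"
    by (auto simp: kato_time_eq)
  have ev1: "\<forall>\<^sub>F t in at_right 0. (SUP x. potential (\<lambda>z. ennreal \<bar>q z\<bar>) t x) < 1"
    by (rule order_tendstoD(2)[OF lim]) simp
  have "\<forall>\<^sub>F s in at_right 0. prob {\<omega> \<in> space M. 1 < norm (X s \<omega>)} < 1/2"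
    by (rule order_tendstoD(2)[OF prob_near_zero]) simp_all
  then obtain b where b: "0 < b" "\<And>s. 0 < s \<Longrightarrow> s < b \<Longrightarrow> prob {\<omega> \<in> space M. 1 < norm (X s \<omega>)} < 1/2"
    by (auto simp: eventually_at_right_field)
  have "\<forall>\<^sub>F t in at_right 0. t \<in> {0<..<b}"
    by (rule eventually_at_right_real) (rule b)
  with ev1 have "\<forall>\<^sub>F t in at_right 0. (SUP x. potential (\<lambda>z. ennreal \<bar>q z\<bar>) t x) < 1 \<and> t \<in> {0<..<b}"
    by eventually_elim simp
  from eventually_happens'[OF trivial_limit_at_right_real this]
  obtain t where t: "0 < t" "t < b" and pot: "(SUP x. potential (\<lambda>z. ennreal \<bar>q z\<bar>) t x) < 1"
    by auto
  have half: "ennreal (1/2) \<le> (\<integral>\<^sup>+\<omega>. indicator (cball 0 1) (X u \<omega>) \<partial>M)" if "0 < u" "u < b" for u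
  proof -
    have "{\<omega> \<in> space M. X u \<omega> \<in> cball 0 1} = space M - {\<omega> \<in> space M. 1 < norm (X u \<omega>)}"
      by auto
    then have "1/2 \<le> prob {\<omega> \<in> space M. X u \<omega> \<in> cball 0 1}"
      using b(2)[OF that] by (simp add: prob_compl)
    then have "ennreal (1/2) \<le> ennreal (prob {\<omega> \<in> space M. X u \<omega> \<in> cball 0 1})"
      by (rule ennreal_leI)
    also have "\<dots> = (\<integral>\<^sup>+\<omega>. indicator {\<omega> \<in> space M. X u \<omega> \<in> cball 0 1} \<omega> \<partial>M)"
      by (simp add: emeasure_eq_measure)
    also have "\<dots> = (\<integral>\<^sup>+\<omega>. indicator (cball 0 1) (X u \<omega>) \<partial>M)"
      by (intro nn_integral_cong) (auto simp: indicator_def)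
    finally show ?thesis .
  qed
  have [measurable]: "ball y r \<in> sets borel" "cball y r \<in> sets borel" for y :: 'a and r
    by simp_all
  interpret MB: pair_sigma_finite "lborel :: 'a measure" M ..
  \<comment> \<open>The volume is the same for every centre; this is where uniformity in
    \<open>y\<close> comes from.\<close>
  define V where "V = emeasure lborel (ball (0::'a) 2)"
  have V: "V < \<infinity>"
    unfolding V_def by (rule emeasure_bounded_finite) simp
  have bound: "(\<integral>\<^sup>+z\<in>ball y 1. ennreal \<bar>q z\<bar> \<partial>lborel) * ennreal (t / 2) \<le> V" for y
  proof -
    define L where "L = (\<integral>\<^sup>+z\<in>ball y 1. ennreal \<bar>q z\<bar> \<partial>lborel)"
    \<comment> \<open>Translation invariance of Lebesgue measure: for \<open>w\<close> of norm at
      most 1, \<open>w + x\<close> in \<open>ball y 1\<close> forces \<open>x\<close> in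
      \<open>ball y 2\<close>.\<close>
    have shift: "L * indicator (cball 0 1) w \<le> (\<integral>\<^sup>+x\<in>ball y 2. ennreal \<bar>q (x + w)\<bar> \<partial>lborel)" for w
    proof (cases "w \<in> cball 0 1")
      case True
      have "L = (\<integral>\<^sup>+x. ennreal \<bar>q (w + x)\<bar> * indicator (ball y 1) (w + x) \<partial>lborel)"
        unfolding L_def by (subst lborel_distr_plus[of w, symmetric], subst nn_integral_distr) simp_all
      also have "\<dots> \<le> (\<integral>\<^sup>+x\<in>ball y 2. ennreal \<bar>q (x + w)\<bar> \<partial>lborel)"
      proof (intro nn_integral_mono)
        fix x
        have "dist y x < 2" if "dist y (w + x) < 1"
        proof -
          have "dist y x \<le> dist y (w + x) + dist (w + x) x" by (rule dist_triangle)
          moreover have "dist (w + x) x \<le> 1"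
            using True by (simp add: dist_norm)
          ultimately show ?thesis using that by linarith
        qed
        then show "ennreal \<bar>q (w + x)\<bar> * indicator (ball y 1) (w + x) \<le> ennreal \<bar>q (x + w)\<bar> * indicator (ball y 2) x"
          by (auto simp: indicator_def add.commute)
      qed
      finally show ?thesis by (simp add: indicator_def)
    qed simp
    have "L * ennreal (t / 2) = (\<integral>\<^sup>+u\<in>{0<..<t}. L * ennreal (1/2) \<partial>lborel)"
      using t ennreal_mult[of "1/2" t] by (subst nn_integral_cmult_indicator) (simp_all add: mult.assoc)
    also have "\<dots> \<le> (\<integral>\<^sup>+u. (\<integral>\<^sup>+\<omega>. L * indicator (cball 0 1) (X u \<omega>) \<partial>M) * indicator {0..t} u \<partial>lborel)"
    proof (rule nn_integral_mono)
      fix u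
      show "L * ennreal (1/2) * indicator {0<..<t} u \<le> (\<integral>\<^sup>+\<omega>. L * indicator (cball 0 1) (X u \<omega>) \<partial>M) * indicator {0..t} u"
      proof (cases "u \<in> {0<..<t}")
        case True
        then have "L * ennreal (1/2) \<le> L * (\<integral>\<^sup>+\<omega>. indicator (cball 0 1) (X u \<omega>) \<partial>M)"
          using t by (intro mult_left_mono half) auto
        also have "\<dots> = (\<integral>\<^sup>+\<omega>. L * indicator (cball 0 1) (X u \<omega>) \<partial>M)"
          by (rule nn_integral_cmult[symmetric]) measurable
        finally show ?thesis using True by simp
      qed simp
    qed
    also have "\<dots> \<le> (\<integral>\<^sup>+u. (\<integral>\<^sup>+\<omega>. (\<integral>\<^sup>+x\<in>ball y 2. ennreal \<bar>q (x + X u \<omega>)\<bar> \<partial>lborel) \<partial>M) * indicator {0..t} u \<partial>lborel)"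
      by (intro nn_integral_mono mult_right_mono shift) auto
    also have "\<dots> = (\<integral>\<^sup>+u. (\<integral>\<^sup>+x. (\<integral>\<^sup>+\<omega>. ennreal \<bar>q (x + X u \<omega>)\<bar> \<partial>M) * indicator (ball y 2) x * indicator {0..t} u \<partial>lborel) \<partial>lborel)"
    proof (rule nn_integral_cong)
      fix u
      have "(\<integral>\<^sup>+\<omega>. (\<integral>\<^sup>+x\<in>ball y 2. ennreal \<bar>q (x + X u \<omega>)\<bar> \<partial>lborel) \<partial>M) =
          (\<integral>\<^sup>+x. (\<integral>\<^sup>+\<omega>. ennreal \<bar>q (x + X u \<omega>)\<bar> * indicator (ball y 2) x \<partial>M) \<partial>lborel)"
        by (rule MB.Fubini') measurable
      also have "\<dots> = (\<integral>\<^sup>+x. (\<integral>\<^sup>+\<omega>. ennreal \<bar>q (x + X u \<omega>)\<bar> \<partial>M) * indicator (ball y 2) x \<partial>lborel)"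
        by (intro nn_integral_cong nn_integral_multc) measurable
      also have "\<dots> * indicator {0..t} u = (\<integral>\<^sup>+x. (\<integral>\<^sup>+\<omega>. ennreal \<bar>q (x + X u \<omega>)\<bar> \<partial>M) * indicator (ball y 2) x * indicator {0..t} u \<partial>lborel)"
        by (rule nn_integral_multc[symmetric]) measurable
      finally show "(\<integral>\<^sup>+\<omega>. (\<integral>\<^sup>+x\<in>ball y 2. ennreal \<bar>q (x + X u \<omega>)\<bar> \<partial>lborel) \<partial>M) * indicator {0..t} u =
          (\<integral>\<^sup>+x. (\<integral>\<^sup>+\<omega>. ennreal \<bar>q (x + X u \<omega>)\<bar> \<partial>M) * indicator (ball y 2) x * indicator {0..t} u \<partial>lborel)" .
    qed
    also have "\<dots> = (\<integral>\<^sup>+x. (\<integral>\<^sup>+u. (\<integral>\<^sup>+\<omega>. ennreal \<bar>q (x + X u \<omega>)\<bar> \<partial>M) * indicator (ball y 2) x * indicator {0..t} u \<partial>lborel) \<partial>lborel)"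
      by (rule lborel_pair.Fubini') measurable
    also have "\<dots> = (\<integral>\<^sup>+x. potential (\<lambda>z. ennreal \<bar>q z\<bar>) t x * indicator (ball y 2) x \<partial>lborel)"
    proof (rule nn_integral_cong)
      fix x
      have "(\<integral>\<^sup>+u. (\<integral>\<^sup>+\<omega>. ennreal \<bar>q (x + X u \<omega>)\<bar> \<partial>M) * indicator (ball y 2) x * indicator {0..t} u \<partial>lborel) =
          (\<integral>\<^sup>+u. (\<integral>\<^sup>+\<omega>. ennreal \<bar>q (x + X u \<omega>)\<bar> \<partial>M) * indicator {0..t} u * indicator (ball y 2) x \<partial>lborel)"
        by (simp only: ac_simps)
      also have "\<dots> = potential (\<lambda>z. ennreal \<bar>q z\<bar>) t x * indicator (ball y 2) x"
        unfolding potential_def by (rule nn_integral_multc) measurable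
      finally show "(\<integral>\<^sup>+u. (\<integral>\<^sup>+\<omega>. ennreal \<bar>q (x + X u \<omega>)\<bar> \<partial>M) * indicator (ball y 2) x * indicator {0..t} u \<partial>lborel) =
          potential (\<lambda>z. ennreal \<bar>q z\<bar>) t x * indicator (ball y 2) x" .
    qed
    also have "\<dots> \<le> (\<integral>\<^sup>+x. 1 * indicator (ball y 2) x \<partial>lborel)"
    proof (intro nn_integral_mono mult_right_mono)
      fix x
      have "potential (\<lambda>z. ennreal \<bar>q z\<bar>) t x \<le> (SUP x. potential (\<lambda>z. ennreal \<bar>q z\<bar>) t x)"
        by (rule SUP_upper) simp
      with pot show "potential (\<lambda>z. ennreal \<bar>q z\<bar>) t x \<le> 1" by simp
    qed simp
    also have "\<dots> = emeasure lborel (ball y 2)" by simp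
    also have "\<dots> = V"
      unfolding V_def by (simp add: emeasure_ball)
    finally show ?thesis unfolding L_def .
  qed
  \<comment> \<open>The division by \<open>t / 2\<close> is a multiplication by its inverse, since
    the local integral is not yet known to be finite.\<close>
  have le: "(\<integral>\<^sup>+z\<in>ball y 1. ennreal \<bar>q z\<bar> \<partial>lborel) \<le> V * ennreal (2 / t)" for y
  proof -
    have "ennreal (t / 2) * ennreal (2 / t) = 1"
      using t ennreal_mult[of "t / 2" "2 / t"] by simp
    then have "(\<integral>\<^sup>+z\<in>ball y 1. ennreal \<bar>q z\<bar> \<partial>lborel) =
        (\<integral>\<^sup>+z\<in>ball y 1. ennreal \<bar>q z\<bar> \<partial>lborel) * ennreal (t / 2) * ennreal (2 / t)"
      by (simp only: mult.assoc mult_1_right)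
    also have "\<dots> \<le> V * ennreal (2 / t)"
      by (intro mult_right_mono bound) auto
    finally show ?thesis .
  qed
  have "(SUP x. \<integral>\<^sup>+z\<in>ball x 1. ennreal \<bar>q z\<bar> \<partial>lborel) \<le> V * ennreal (2 / t)"
    by (intro SUP_least le)
  also have "\<dots> < \<infinity>"
    using V by (simp add: ennreal_mult_less_top)
  finally show "q \<in> L1_loc_uni"
    by (simp add: L1_loc_uni_def)
qed

subsection \<open>Exit from a ball along dyadic times\<close>

text \<open>All dyadic levels at once: a countable union, hence measurable, and one event that
  dominates the exits seen by every single grid.\<close>

definition exit_event :: "real \<Rightarrow> real \<Rightarrow> 'w set" where
  "exit_event t \<rho> = {\<omega> \<in> space M. \<exists>n::nat. \<exists>j::nat. j \<le> 2 ^ n \<and> \<rho> < norm (X (t * real j / 2 ^ n) \<omega>)}"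

lemma measurable_exit_event [measurable]: "exit_event t \<rho> \<in> sets M"
  unfolding exit_event_def by measurable

text \<open>Along \<open>t = (1/2) ^ m\<close> the events decrease, and their intersection is empty
  because every path is right-continuous at 0 with value 0.\<close>

lemma ex_small_exit_event:
  assumes "0 < \<rho>"
  obtains t where "0 < t" "t \<le> 1" "emeasure M (exit_event t \<rho>) \<le> ennreal (1/2)"
proof -
  define A where "A m = exit_event ((1/2) ^ m) \<rho>" for m :: nat
  have "decseq A"
  proof (rule decseq_SucI, rule subsetI)
    fix m \<omega> assume "\<omega> \<in> A (Suc m)"
    then obtain n j where *: "\<omega> \<in> space M" "j \<le> 2 ^ n" "\<rho> < norm (X ((1/2) ^ Suc m * real j / 2 ^ n) \<omega>)"
      by (auto simp: A_def exit_event_def)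
    \<comment> \<open>Halving the horizon is absorbed by going one dyadic level deeper.\<close>
    have "(1/2) ^ Suc m * real j / 2 ^ n = (1/2) ^ m * real j / 2 ^ Suc n" by simp
    moreover have "j \<le> 2 ^ Suc n" using *(2) by simp
    ultimately show "\<omega> \<in> A m"
      unfolding A_def exit_event_def using * by (metis (mono_tags, lifting) mem_Collect_eq)
  qed
  moreover have "(\<Inter>m. A m) = {}"
  proof (rule ccontr)
    assume "(\<Inter>m. A m) \<noteq> {}"
    then obtain \<omega> where \<omega>: "\<And>m. \<omega> \<in> A m" by auto
    then have sp: "\<omega> \<in> space M" by (auto simp: A_def exit_event_def)
    have "((\<lambda>u. norm (X u \<omega>)) \<longlongrightarrow> norm (X 0 \<omega>)) (at_right 0)"
      by (intro tendsto_norm right_continuous sp)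
    then have "\<forall>\<^sub>F u in at_right 0. norm (X u \<omega>) < \<rho>"
      by (rule order_tendstoD) (use sp assms in \<open>simp add: nonpos_time\<close>)
    then obtain b where b: "0 < b" "\<And>u. 0 < u \<Longrightarrow> u < b \<Longrightarrow> norm (X u \<omega>) < \<rho>"
      by (auto simp: eventually_at_right_field)
    obtain m where m: "(1/2) ^ m < b"
      using real_arch_pow_inv[OF b(1), of "1/2"] by auto
    obtain n j where j: "j \<le> 2 ^ n" "\<rho> < norm (X ((1/2) ^ m * real j / 2 ^ n) \<omega>)"
      using \<omega>[of m] by (auto simp: A_def exit_event_def)
    define u where "u = (1/2) ^ m * real j / 2 ^ n"
    have "real j \<le> 2 ^ n"
      using j(1) by (metis of_nat_le_iff of_nat_numeral of_nat_power)
    then have "(1/2) ^ m * (real j / 2 ^ n) \<le> (1/2) ^ m * 1"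
      by (intro mult_left_mono) auto
    then have "u < b" using m by (simp add: u_def)
    moreover have "0 \<le> u" by (simp add: u_def)
    ultimately have "norm (X u \<omega>) < \<rho>"
      using b(2)[of u] sp assms by (cases "u = 0") (auto simp: nonpos_time)
    then show False using j(2) by (simp add: u_def)
  qed
  ultimately have "(\<lambda>m. emeasure M (A m)) \<longlonglongrightarrow> 0"
    using Lim_emeasure_decseq[of A M] by (auto simp: A_def image_subset_iff)
  then have "\<forall>\<^sub>F m in sequentially. emeasure M (A m) < ennreal (1/2)"
    by (rule order_tendstoD) (rule ennreal_less_zero_iff[THEN iffD2], simp)
  then obtain m where "emeasure M (A m) < ennreal (1/2)"
    by (meson eventually_happens' sequentially_bot)
  then show thesis
    by (intro that[of "(1/2) ^ m"]) (auto simp: A_def power_le_one)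
qed

lemma tendsto_right_grid:
  assumes \<omega>: "\<omega> \<in> space M" and t: "0 < t"
  shows "(\<lambda>n. X (t * (real_of_int (\<lfloor>u / t * 2 ^ n\<rfloor> + 1) / 2 ^ n)) \<omega>) \<longlonglongrightarrow> X u \<omega>"
proof (rule filterlim_compose[OF right_continuous[OF \<omega>]])
  define s where "s n = real_of_int (\<lfloor>u / t * 2 ^ n\<rfloor> + 1) / 2 ^ n" for n :: nat
  have lim: "filterlim s (at_right (u / t)) sequentially"
    unfolding s_def by (rule filterlim_dyadic_at_right)
  then have "s \<longlonglongrightarrow> u / t" and ev: "\<forall>\<^sub>F n in sequentially. u / t < s n"
    by (auto simp: filterlim_at elim: eventually_mono)
  then have "(\<lambda>n. t * s n) \<longlonglongrightarrow> t * (u / t)"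
    by (intro tendsto_intros)
  moreover have "\<forall>\<^sub>F n in sequentially. u < t * s n"
    using ev by eventually_elim (use t in \<open>simp add: field_simps\<close>)
  ultimately show "filterlim (\<lambda>n. t * (real_of_int (\<lfloor>u / t * 2 ^ n\<rfloor> + 1) / 2 ^ n)) (at_right u) sequentially"
    using t unfolding s_def by (auto simp: filterlim_at elim!: eventually_mono)
qed

text \<open>At time \<open>s k\<close> the process restarts from \<open>x + X (s k)\<close>,
  independently of an event read off the grid so far, and what remains of the time window is no
  longer than \<open>t\<close>.\<close>

lemma nn_integral_past_event_le:
  fixes s :: "nat \<Rightarrow> real"
  assumes s: "s 0 = 0" "\<And>j. j < k \<Longrightarrow> s j < s (Suc j)" "0 \<le> s k"
    and q [measurable]: "q \<in> borel_measurable borel" and B [measurable]: "B \<in> sets (PiM {..k} (\<lambda>_. borel))"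
  shows "(\<integral>\<^sup>+u\<in>{s k..t}. (\<integral>\<^sup>+\<omega>. indicator B (\<lambda>j\<in>{..k}. X (s j) \<omega>) * q (x + X u \<omega>) \<partial>M) \<partial>lborel) \<le>
    (\<integral>\<^sup>+\<omega>. indicator B (\<lambda>j\<in>{..k}. X (s j) \<omega>) \<partial>M) * (SUP y. potential q t y)"
proof -
  interpret P: pair_sigma_finite lborel M ..
  define S where "S = (SUP y. potential q t y)"
  define I :: "'w \<Rightarrow> ennreal" where "I \<omega> = indicator B (\<lambda>j\<in>{..k}. X (s j) \<omega>)" for \<omega>
  have path [measurable]: "(\<lambda>\<omega>. \<lambda>j\<in>{..k}. X (s j) \<omega>) \<in> M \<rightarrow>\<^sub>M PiM {..k} (\<lambda>_. borel)"
    by (intro measurable_restrict) measurable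
  have [measurable]: "I \<in> borel_measurable M"
    unfolding I_def by measurable
  have comp [measurable]: "(\<lambda>g. g k) \<in> PiM {..k} (\<lambda>_. borel) \<rightarrow>\<^sub>M (borel :: 'a measure)"
    by (intro measurable_component_singleton) auto
  have markov: "(\<integral>\<^sup>+\<omega>. I \<omega> * q (x + X u \<omega>) \<partial>M) = (\<integral>\<^sup>+\<omega>. I \<omega> * (\<integral>\<^sup>+\<omega>'. q (x + X (s k) \<omega> + X (u - s k) \<omega>') \<partial>M) \<partial>M)"
    if "s k \<le> u" for u
  proof -
    have "(\<integral>\<^sup>+\<omega>. I \<omega> * q (x + X u \<omega>) \<partial>M) =
        (\<integral>\<^sup>+\<omega>. (\<lambda>(g, z). indicator B g * q (x + g k + z)) (\<lambda>j\<in>{..k}. X (s j) \<omega>, X (s k + (u - s k)) \<omega> - X (s k) \<omega>) \<partial>M)"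
      by (intro nn_integral_cong) (simp add: I_def)
    also have "\<dots> = (\<integral>\<^sup>+\<omega>. (\<integral>\<^sup>+\<omega>'. (\<lambda>(g, z). indicator B g * q (x + g k + z)) (\<lambda>j\<in>{..k}. X (s j) \<omega>, X (u - s k) \<omega>') \<partial>M) \<partial>M)"
      by (rule nn_integral_past_increment) (use s that in auto)
    also have "\<dots> = (\<integral>\<^sup>+\<omega>. I \<omega> * (\<integral>\<^sup>+\<omega>'. q (x + X (s k) \<omega> + X (u - s k) \<omega>') \<partial>M) \<partial>M)"
      by (intro nn_integral_cong) (simp add: I_def nn_integral_cmult)
    finally show ?thesis .
  qed
  \<comment> \<open>Moving the time origin to \<open>s k\<close> turns the window into
    \<open>{0..t - s k}\<close>, which lies in \<open>{0..t}\<close> because \<open>s k\<close> is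
    nonnegative.\<close>
  have shift: "(\<integral>\<^sup>+u\<in>{s k..t}. (\<integral>\<^sup>+\<omega>'. q (y + X (u - s k) \<omega>') \<partial>M) \<partial>lborel) \<le> S" for y
  proof -
    have "(\<integral>\<^sup>+u\<in>{s k..t}. (\<integral>\<^sup>+\<omega>'. q (y + X (u - s k) \<omega>') \<partial>M) \<partial>lborel) =
       (\<integral>\<^sup>+u. (\<integral>\<^sup>+\<omega>'. q (y + X u \<omega>') \<partial>M) * indicator {s k..t} (s k + u) \<partial>lborel)"
      by (subst lborel_distr_plus[of "s k", symmetric], subst nn_integral_distr) simp_all
    also have "\<dots> \<le> potential q t y"
      unfolding potential_def using s(3) by (intro nn_integral_mono mult_left_mono) (auto simp: indicator_def)
    also have "\<dots> \<le> S"
      unfolding S_def by (rule SUP_upper) simp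
    finally show ?thesis .
  qed
  have "(\<integral>\<^sup>+u\<in>{s k..t}. (\<integral>\<^sup>+\<omega>. I \<omega> * q (x + X u \<omega>) \<partial>M) \<partial>lborel) =
      (\<integral>\<^sup>+u. (\<integral>\<^sup>+\<omega>. I \<omega> * (\<integral>\<^sup>+\<omega>'. q (x + X (s k) \<omega> + X (u - s k) \<omega>') \<partial>M) \<partial>M) * indicator {s k..t} u \<partial>lborel)"
    by (intro nn_integral_cong) (auto simp: indicator_def markov)
  also have "\<dots> = (\<integral>\<^sup>+u. (\<integral>\<^sup>+\<omega>. I \<omega> * (\<integral>\<^sup>+\<omega>'. q (x + X (s k) \<omega> + X (u - s k) \<omega>') \<partial>M) * indicator {s k..t} u \<partial>M) \<partial>lborel)"
    by (intro nn_integral_cong nn_integral_multc[symmetric]) measurable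
  also have "\<dots> = (\<integral>\<^sup>+\<omega>. (\<integral>\<^sup>+u. I \<omega> * (\<integral>\<^sup>+\<omega>'. q (x + X (s k) \<omega> + X (u - s k) \<omega>') \<partial>M) * indicator {s k..t} u \<partial>lborel) \<partial>M)"
    by (rule P.Fubini'[symmetric]) measurable
  also have "\<dots> = (\<integral>\<^sup>+\<omega>. I \<omega> * (\<integral>\<^sup>+u\<in>{s k..t}. (\<integral>\<^sup>+\<omega>'. q (x + X (s k) \<omega> + X (u - s k) \<omega>') \<partial>M) \<partial>lborel) \<partial>M)"
    unfolding mult.assoc by (intro nn_integral_cong nn_integral_cmult) measurable
  also have "\<dots> \<le> (\<integral>\<^sup>+\<omega>. I \<omega> * S \<partial>M)"
    by (intro nn_integral_mono mult_left_mono shift) auto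
  also have "\<dots> = (\<integral>\<^sup>+\<omega>. I \<omega> \<partial>M) * S"
    by (rule nn_integral_multc) measurable
  finally show ?thesis
    unfolding I_def S_def .
qed

text \<open>One grid level only, in contrast to \<open>exit_event\<close>. The set is not cut down
  to \<open>space M\<close>; only its indicator is used, and its measurability is stated in that
  form.\<close>

definition before_exit :: "real \<Rightarrow> real \<Rightarrow> nat \<Rightarrow> real \<Rightarrow> 'w set" where
  "before_exit t \<rho> n u = {\<omega>. \<forall>j::nat. t * real j / 2 ^ n \<le> u \<longrightarrow> norm (X (t * real j / 2 ^ n) \<omega>) \<le> \<rho>}"

definition first_exit :: "real \<Rightarrow> real \<Rightarrow> nat \<Rightarrow> nat \<Rightarrow> 'w set" where
  "first_exit t \<rho> n k = {\<omega>. \<rho> < norm (X (t * real k / 2 ^ n) \<omega>) \<and> (\<forall>j<k. norm (X (t * real j / 2 ^ n) \<omega>) \<le> \<rho>)}"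

lemma measurable_before_exit [measurable (raw)]:
  assumes [measurable]: "f \<in> borel_measurable N" "g \<in> N \<rightarrow>\<^sub>M M"
  shows "(\<lambda>z. indicator (before_exit t \<rho> n (f z)) (g z) :: ennreal) \<in> borel_measurable N"
  unfolding before_exit_def indicator_def mem_Collect_eq by measurable

lemma measurable_first_exit [measurable]: "(indicator (first_exit t \<rho> n k) :: 'w \<Rightarrow> ennreal) \<in> borel_measurable M"
  unfolding first_exit_def indicator_def mem_Collect_eq by measurable

text \<open>A path that stays in the ball at all dyadic times up to \<open>v\<close> stays there on \<open>[0, v)\<close> by right
  continuity, so the two indicators can differ at a single time only.\<close>

lemma nn_integral_before_exit_le:
  assumes t: "0 < t" and \<omega>: "\<omega> \<in> space M" 
  shows "(\<integral>\<^sup>+u\<in>{0..t}. indicator {u. \<forall>n j::nat. t * real j / 2 ^ n \<le> u \<longrightarrow> norm (X (t * real j / 2 ^ n) \<omega>) \<le> \<rho>} u * f u \<partial>lborel)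
    \<le> (\<integral>\<^sup>+u\<in>{0..t}. indicator (cball 0 \<rho>) (X u \<omega>) * f u \<partial>lborel)"
proof -
  define stay where "stay u \<longleftrightarrow> (\<forall>n j::nat. t * real j / 2 ^ n \<le> u \<longrightarrow> norm (X (t * real j / 2 ^ n) \<omega>) \<le> \<rho>)" for u
  have in_ball: "norm (X u \<omega>) \<le> \<rho>" if "0 \<le> u" "u < v" "stay v" for u v
  proof -
    \<comment> \<open>Index of the first level-\<open>n\<close> grid point strictly after
      \<open>u\<close>. These points tend to \<open>u\<close>, so they eventually lie before
      \<open>v\<close>, where the bound on the path is known.\<close>
    define i where "i n = \<lfloor>u / t * 2 ^ n\<rfloor> + 1" for n :: nat
    have i: "t * (real_of_int (i n) / 2 ^ n) = t * real (nat (i n)) / 2 ^ n" for n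
      using that t by (simp add: i_def add_nonneg_nonneg)
    have "filterlim (\<lambda>n. real_of_int (i n) / 2 ^ n) (at_right (u / t)) sequentially"
      unfolding i_def by (rule filterlim_dyadic_at_right)
    then have "(\<lambda>n. real_of_int (i n) / 2 ^ n) \<longlonglongrightarrow> u / t"
      by (simp add: filterlim_at)
    then have "\<forall>\<^sub>F n in sequentially. real_of_int (i n) / 2 ^ n < v / t"
      by (rule order_tendstoD) (use that t in \<open>simp add: divide_strict_right_mono\<close>)
    then have "\<forall>\<^sub>F n in sequentially. norm (X (t * (real_of_int (i n) / 2 ^ n)) \<omega>) \<le> \<rho>"
    proof eventually_elim
      case (elim n)
      then have "t * (real_of_int (i n) / 2 ^ n) \<le> v"
        using t by (simp add: pos_less_divide_eq mult.commute)
      then show ?case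
        using that(3) unfolding stay_def i by blast
    qed
    moreover have "(\<lambda>n. norm (X (t * (real_of_int (i n) / 2 ^ n)) \<omega>)) \<longlonglongrightarrow> norm (X u \<omega>)"
      unfolding i_def by (intro tendsto_norm tendsto_right_grid \<omega> t)
    ultimately show ?thesis
      by (intro tendsto_upperbound[where F = sequentially]) auto
  qed
  define Bad where "Bad = {u. 0 \<le> u \<and> stay u \<and> \<rho> < norm (X u \<omega>)}"
  have "AE u in lborel. u \<notin> Bad"
  proof (cases "Bad = {}")
    case False
    then obtain b where "b \<in> Bad" by auto
    have "u = b" if "u \<in> Bad" for u
    proof (rule ccontr)
      assume "u \<noteq> b"
      then consider "u < b" | "b < u" by linarith
      then show False
        using in_ball[of u b] in_ball[of b u] that \<open>b \<in> Bad\<close> by cases (auto simp: Bad_def)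
    qed
    then show ?thesis
      using AE_lborel_singleton[of b] by (auto elim!: eventually_mono)
  qed simp
  then show ?thesis
  proof (intro nn_integral_mono_AE, eventually_elim)
    case (elim u)
    then show ?case
      by (auto simp: Bad_def stay_def indicator_def mult_right_mono not_less)
  qed
qed

text \<open>Up to time \<open>u\<close> either no level-\<open>n\<close> grid point shows an exit,
  or there is a first one; its index is at most \<open>2 ^ n\<close> because its time is at most
  \<open>u\<close>, hence at most \<open>t\<close>. So 1 is dominated by the sum of the
  indicators.\<close>

lemma nn_integral_up_to_exit_le:
  assumes t: "0 < t" and q [measurable]: "q \<in> borel_measurable borel"
  shows "(\<integral>\<^sup>+\<omega>. q (x + X u \<omega>) \<partial>M) * indicator {0..t} u \<le>
    (\<integral>\<^sup>+\<omega>. indicator (before_exit t \<rho> n u) \<omega> * q (x + X u \<omega>) \<partial>M) * indicator {0..t} u +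
    (\<Sum>k\<in>{..2 ^ n}. (\<integral>\<^sup>+\<omega>. indicator (first_exit t \<rho> n k) \<omega> * q (x + X u \<omega>) \<partial>M) * indicator {t * real k / 2 ^ n..t} u)"
  (is "_ \<le> (\<integral>\<^sup>+\<omega>. ?stay \<omega> * _ \<partial>M) * _ + (\<Sum>k\<in>_. (\<integral>\<^sup>+\<omega>. ?first k \<omega> * _ \<partial>M) * ?ind k)")
proof (cases "u \<in> {0..t}")
  case True
  have le: "1 \<le> ?stay \<omega> + (\<Sum>k\<in>{..2 ^ n}. ?first k \<omega> * ?ind k)" for \<omega>
  proof (cases "\<omega> \<in> before_exit t \<rho> n u")
    case False
    define exits where "exits j \<longleftrightarrow> t * real j / 2 ^ n \<le> u \<and> \<rho> < norm (X (t * real j / 2 ^ n) \<omega>)" for j :: nat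
    define k where "k = (LEAST j. exits j)"
    have "\<exists>j. exits j" using False by (auto simp: exits_def before_exit_def not_le)
    then have k: "exits k" unfolding k_def by (rule LeastI_ex)
    have before: "norm (X (t * real j / 2 ^ n) \<omega>) \<le> \<rho>" if "j < k" for j
    proof -
      have "\<not> exits j" using that unfolding k_def by (rule not_less_Least)
      moreover have "t * real j / 2 ^ n \<le> t * real k / 2 ^ n"
        using that t by (intro divide_right_mono mult_left_mono) auto
      then have "t * real j / 2 ^ n \<le> u"
        using k unfolding exits_def by linarith
      ultimately show ?thesis by (auto simp: exits_def)
    qed
    have "t * real k / 2 ^ n \<le> t"
      using k True by (simp add: exits_def)
    then have "real k \<le> 2 ^ n"
      using t by (simp add: field_simps)
    then have "k \<le> 2 ^ n"
      by (metis of_nat_le_iff of_nat_numeral of_nat_power)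
    have "1 = ?first k \<omega> * ?ind k"
      using k before True by (simp add: exits_def first_exit_def)
    also have "\<dots> \<le> (\<Sum>k\<in>{..2 ^ n}. ?first k \<omega> * ?ind k)"
      by (rule member_le_sum) (use \<open>k \<le> 2 ^ n\<close> in auto)
    finally show ?thesis by (rule order_trans) simp
  qed simp
  have "(\<integral>\<^sup>+\<omega>. q (x + X u \<omega>) \<partial>M) \<le> (\<integral>\<^sup>+\<omega>. (?stay \<omega> + (\<Sum>k\<in>{..2 ^ n}. ?first k \<omega> * ?ind k)) * q (x + X u \<omega>) \<partial>M)"
  proof (rule nn_integral_mono)
    fix \<omega>
    show "q (x + X u \<omega>) \<le> (?stay \<omega> + (\<Sum>k\<in>{..2 ^ n}. ?first k \<omega> * ?ind k)) * q (x + X u \<omega>)"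
      using mult_right_mono[OF le[of \<omega>], of "q (x + X u \<omega>)"] by simp
  qed
  also have "\<dots> = (\<integral>\<^sup>+\<omega>. ?stay \<omega> * q (x + X u \<omega>) + (\<Sum>k\<in>{..2 ^ n}. (?first k \<omega> * q (x + X u \<omega>)) * ?ind k) \<partial>M)"
    by (intro nn_integral_cong) (simp only: distrib_right sum_distrib_right, simp only: ac_simps)
  also have "\<dots> = (\<integral>\<^sup>+\<omega>. ?stay \<omega> * q (x + X u \<omega>) \<partial>M) + (\<Sum>k\<in>{..2 ^ n}. (\<integral>\<^sup>+\<omega>. ?first k \<omega> * q (x + X u \<omega>) \<partial>M) * ?ind k)"
  proof (subst nn_integral_add)
    have "(\<integral>\<^sup>+\<omega>. (\<Sum>k\<in>{..2 ^ n}. (?first k \<omega> * q (x + X u \<omega>)) * ?ind k) \<partial>M) =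
        (\<Sum>k\<in>{..2 ^ n}. (\<integral>\<^sup>+\<omega>. (?first k \<omega> * q (x + X u \<omega>)) * ?ind k \<partial>M))"
      by (rule nn_integral_sum) measurable
    also have "\<dots> = (\<Sum>k\<in>{..2 ^ n}. (\<integral>\<^sup>+\<omega>. ?first k \<omega> * q (x + X u \<omega>) \<partial>M) * ?ind k)"
      by (intro sum.cong refl nn_integral_multc) measurable
    finally show "(\<integral>\<^sup>+\<omega>. ?stay \<omega> * q (x + X u \<omega>) \<partial>M) + (\<integral>\<^sup>+\<omega>. (\<Sum>k\<in>{..2 ^ n}. (?first k \<omega> * q (x + X u \<omega>)) * ?ind k) \<partial>M) =
        (\<integral>\<^sup>+\<omega>. ?stay \<omega> * q (x + X u \<omega>) \<partial>M) + (\<Sum>k\<in>{..2 ^ n}. (\<integral>\<^sup>+\<omega>. ?first k \<omega> * q (x + X u \<omega>) \<partial>M) * ?ind k)"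
      by (rule arg_cong)
  qed measurable
  finally show ?thesis
    using True by simp
qed simp


text \<open>First exits with different indices exclude each other, and each of those with index up
  to \<open>2 ^ n\<close> is an exit in the sense of \<open>exit_event\<close>.\<close>

lemma sum_first_exit_le:
  assumes "\<omega> \<in> space M"
  shows "(\<Sum>k\<in>{..2 ^ n}. indicator (first_exit t \<rho> n k) \<omega>)
    \<le> (indicator (exit_event t \<rho>) \<omega> :: ennreal)" (is "(\<Sum>k\<in>_. indicator (?first k) \<omega>) \<le> _")
proof (cases "\<exists>k\<le>2 ^ n. \<omega> \<in> ?first k")
  case True
  then obtain k where k: "k \<le> 2 ^ n" "\<omega> \<in> ?first k" by blast
  have first: "indicator (?first i) \<omega> = (if i = k then 1 else (0::ennreal))" for i
  proof -
    have "\<omega> \<notin> ?first i" if "i \<noteq> k"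
      using that k(2) by (cases i k rule: linorder_cases) (auto simp: first_exit_def not_less[symmetric])
    then show ?thesis using k(2) by simp
  qed
  have "(\<Sum>i\<in>{..2 ^ n}. indicator (?first i) \<omega>) = (\<Sum>i\<in>{..2 ^ n}. if i = k then 1 else (0::ennreal))"
    by (simp only: first)
  also have "\<dots> = 1" using k(1) by simp
  finally have sum: "(\<Sum>i\<in>{..2 ^ n}. indicator (?first i) \<omega>) = (1::ennreal)" .
  have "\<omega> \<in> exit_event t \<rho>"
    using k assms unfolding exit_event_def first_exit_def by blast
  then show ?thesis
    by (simp add: sum)
next
  case False
  then have "(\<Sum>i\<in>{..2 ^ n}. indicator (?first i) \<omega>) = (0::ennreal)"
    by (intro sum.neutral ballI) simp
  then show ?thesis by simp
qed

text \<open>Restarting at each possible first exit costs at most the supremum of the potential,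
  weighted with the probability of that exit; the weights add up to at most the probability of
  \<open>exit_event\<close>, whatever the level \<open>n\<close>.\<close>

lemma potential_le_before_exit:
  assumes t: "0 < t" and q [measurable]: "q \<in> borel_measurable borel"
  shows "potential q t x \<le> (\<integral>\<^sup>+u\<in>{0..t}. (\<integral>\<^sup>+\<omega>. indicator (before_exit t \<rho> n u) \<omega> * q (x + X u \<omega>) \<partial>M) \<partial>lborel)
    + emeasure M (exit_event t \<rho>) * (SUP y. potential q t y)"
proof -
  define s where "s k = t * real k / 2 ^ n" for k :: nat
  define stay where "stay = before_exit t \<rho> n"
  define first where "first = first_exit t \<rho> n"
  note [measurable (raw)] = measurable_before_exit[of _ _ _ t \<rho> n, folded stay_def]
  note [measurable] = measurable_first_exit[of t \<rho> n, folded first_def]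
  have "potential q t x \<le> (\<integral>\<^sup>+u. (\<integral>\<^sup>+\<omega>. indicator (stay u) \<omega> * q (x + X u \<omega>) \<partial>M) * indicator {0..t} u +
      (\<Sum>k\<in>{..2 ^ n}. (\<integral>\<^sup>+\<omega>. indicator (first k) \<omega> * q (x + X u \<omega>) \<partial>M) * indicator {s k..t} u) \<partial>lborel)"
    unfolding potential_def stay_def first_def s_def
    by (intro nn_integral_mono nn_integral_up_to_exit_le t q)
  also have "\<dots> = (\<integral>\<^sup>+u\<in>{0..t}. (\<integral>\<^sup>+\<omega>. indicator (stay u) \<omega> * q (x + X u \<omega>) \<partial>M) \<partial>lborel) +
      (\<Sum>k\<in>{..2 ^ n}. (\<integral>\<^sup>+u\<in>{s k..t}. (\<integral>\<^sup>+\<omega>. indicator (first k) \<omega> * q (x + X u \<omega>) \<partial>M) \<partial>lborel))"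
  proof (subst nn_integral_add)
    show "(\<lambda>u. (\<integral>\<^sup>+\<omega>. indicator (stay u) \<omega> * q (x + X u \<omega>) \<partial>M) * indicator {0..t} u) \<in> borel_measurable lborel"
      by measurable
    show "(\<lambda>u. \<Sum>k\<in>{..2 ^ n}. (\<integral>\<^sup>+\<omega>. indicator (first k) \<omega> * q (x + X u \<omega>) \<partial>M) * indicator {s k..t} u) \<in> borel_measurable lborel"
      by measurable
    have "(\<integral>\<^sup>+u. (\<Sum>k\<in>{..2 ^ n}. (\<integral>\<^sup>+\<omega>. indicator (first k) \<omega> * q (x + X u \<omega>) \<partial>M) * indicator {s k..t} u) \<partial>lborel) =
        (\<Sum>k\<in>{..2 ^ n}. (\<integral>\<^sup>+u\<in>{s k..t}. (\<integral>\<^sup>+\<omega>. indicator (first k) \<omega> * q (x + X u \<omega>) \<partial>M) \<partial>lborel))"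
      by (rule nn_integral_sum) measurable
    then show "(\<integral>\<^sup>+u\<in>{0..t}. (\<integral>\<^sup>+\<omega>. indicator (stay u) \<omega> * q (x + X u \<omega>) \<partial>M) \<partial>lborel) +
        (\<integral>\<^sup>+u. (\<Sum>k\<in>{..2 ^ n}. (\<integral>\<^sup>+\<omega>. indicator (first k) \<omega> * q (x + X u \<omega>) \<partial>M) * indicator {s k..t} u) \<partial>lborel) =
        (\<integral>\<^sup>+u\<in>{0..t}. (\<integral>\<^sup>+\<omega>. indicator (stay u) \<omega> * q (x + X u \<omega>) \<partial>M) \<partial>lborel) +
        (\<Sum>k\<in>{..2 ^ n}. (\<integral>\<^sup>+u\<in>{s k..t}. (\<integral>\<^sup>+\<omega>. indicator (first k) \<omega> * q (x + X u \<omega>) \<partial>M) \<partial>lborel))"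
      by (rule arg_cong)
  qed
  also have "(\<Sum>k\<in>{..2 ^ n}. (\<integral>\<^sup>+u\<in>{s k..t}. (\<integral>\<^sup>+\<omega>. indicator (first k) \<omega> * q (x + X u \<omega>) \<partial>M) \<partial>lborel)) \<le>
      (\<Sum>k\<in>{..2 ^ n}. (\<integral>\<^sup>+\<omega>. indicator (first k) \<omega> \<partial>M) * (SUP y. potential q t y))"
  proof (rule sum_mono)
    fix k :: nat
    \<comment> \<open>The first-exit event rewritten as a condition on the grid values up to index
      \<open>k\<close>, the form in which the past enters
      \<open>nn_integral_past_event_le\<close>.\<close>
    define B where "B = {g \<in> space (PiM {..k} (\<lambda>_. borel :: 'a measure)). \<rho> < norm (g k) \<and> (\<forall>j\<in>{..<k}. norm (g j) \<le> \<rho>)}"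
    have comp: "{g \<in> space (PiM {..k} (\<lambda>_. borel)). \<rho> < norm (g j :: 'a)} \<in> sets (PiM {..k} (\<lambda>_. borel))"
      "{g \<in> space (PiM {..k} (\<lambda>_. borel)). norm (g j :: 'a) \<le> \<rho>} \<in> sets (PiM {..k} (\<lambda>_. borel))" if "j \<le> k" for j
    proof -
      have [measurable]: "(\<lambda>g. g j) \<in> PiM {..k} (\<lambda>_. borel) \<rightarrow>\<^sub>M (borel :: 'a measure)"
        using that by (intro measurable_component_singleton) simp
      show "{g \<in> space (PiM {..k} (\<lambda>_. borel)). \<rho> < norm (g j :: 'a)} \<in> sets (PiM {..k} (\<lambda>_. borel))"
        "{g \<in> space (PiM {..k} (\<lambda>_. borel)). norm (g j :: 'a) \<le> \<rho>} \<in> sets (PiM {..k} (\<lambda>_. borel))"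
        by measurable
    qed
    have B: "B \<in> sets (PiM {..k} (\<lambda>_. borel))"
      unfolding B_def by (intro sets.sets_Collect_conj sets.sets_Collect_finite_All comp) auto
    have eq: "indicator B (\<lambda>j\<in>{..k}. X (s j) \<omega>) = (indicator (first k) \<omega> :: ennreal)" for \<omega>
    proof -
      have "(\<lambda>j\<in>{..k}. X (s j) \<omega>) \<in> space (PiM {..k} (\<lambda>_. borel))"
        by (simp add: space_PiM)
      moreover have "(\<forall>j\<in>{..<k}. norm ((\<lambda>j\<in>{..k}. X (s j) \<omega>) j) \<le> \<rho>) \<longleftrightarrow> (\<forall>j<k. norm (X (s j) \<omega>) \<le> \<rho>)"
        by auto
      ultimately have "(\<lambda>j\<in>{..k}. X (s j) \<omega>) \<in> B \<longleftrightarrow> \<omega> \<in> first k"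
        by (simp add: B_def first_def first_exit_def s_def)
      then show ?thesis by (simp add: indicator_def)
    qed
    show "(\<integral>\<^sup>+u\<in>{s k..t}. (\<integral>\<^sup>+\<omega>. indicator (first k) \<omega> * q (x + X u \<omega>) \<partial>M) \<partial>lborel) \<le>
      (\<integral>\<^sup>+\<omega>. indicator (first k) \<omega> \<partial>M) * (SUP y. potential q t y)"
      using nn_integral_past_event_le[where s = s and k = k and q = q and B = B and t = t and x = x] B t unfolding eq by (simp add: s_def divide_strict_right_mono)
  qed
  also have "\<dots> = (\<integral>\<^sup>+\<omega>. (\<Sum>k\<in>{..2 ^ n}. indicator (first k) \<omega>) \<partial>M) * (SUP y. potential q t y)"
    by (subst nn_integral_sum) (simp_all add: sum_distrib_right)
  also have "\<dots> \<le> (\<integral>\<^sup>+\<omega>. indicator (exit_event t \<rho>) \<omega> \<partial>M) * (SUP y. potential q t y)"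
    unfolding first_def s_def by (intro mult_right_mono nn_integral_mono sum_first_exit_le) auto
  also have "(\<integral>\<^sup>+\<omega>. indicator (exit_event t \<rho>) \<omega> \<partial>M) = emeasure M (exit_event t \<rho>)"
    by simp
  finally show ?thesis
    unfolding stay_def s_def by (simp add: add_left_mono)
qed

text \<open>Refining the grid only adds constraints: index \<open>j\<close> at level
  \<open>n\<close> is index \<open>2 * j\<close> at level \<open>Suc n\<close>.\<close>

lemma tendsto_indicator_before_exit:
  "(\<lambda>n. indicator (before_exit t \<rho> n u) \<omega> :: ennreal) \<longlonglongrightarrow> indicator (\<Inter>n. before_exit t \<rho> n u) \<omega>"
proof -
  have "decseq (\<lambda>n. before_exit t \<rho> n u)"
  proof (rule decseq_SucI, rule subsetI)
    fix n \<omega> assume *: "\<omega> \<in> before_exit t \<rho> (Suc n) u"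
    show "\<omega> \<in> before_exit t \<rho> n u"
      unfolding before_exit_def
    proof safe
      fix j :: nat assume "t * real j / 2 ^ n \<le> u"
      moreover have eq: "t * real (2 * j) / 2 ^ Suc n = t * real j / 2 ^ n" by simp
      ultimately show "norm (X (t * real j / 2 ^ n) \<omega>) \<le> \<rho>"
        using * unfolding before_exit_def mem_Collect_eq by metis
    qed
  qed
  then show ?thesis
    by (rule LIMSEQ_indicator_decseq)
qed

text \<open>The limit of \<open>potential_le_before_exit\<close> over finer grids. The events
  shrink, so convergence is dominated rather than monotone from below; the bound \<open>c\<close>
  supplies the dominating function.\<close>

lemma potential_le_local:
  assumes t: "0 < t" and q [measurable]: "q \<in> borel_measurable borel"
    and c: "\<And>z. q z \<le> ennreal c" "0 \<le> c"
  shows "potential q t x \<le> (\<integral>\<^sup>+u\<in>{0..t}. (\<integral>\<^sup>+\<omega>. indicator (cball 0 \<rho>) (X u \<omega>) * q (x + X u \<omega>) \<partial>M) \<partial>lborel)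
    + emeasure M (exit_event t \<rho>) * (SUP y. potential q t y)"
proof -
  interpret P: pair_sigma_finite lborel M ..
  have [measurable]: "cball (0::'a) \<rho> \<in> sets borel" by simp
  define R where "R = emeasure M (exit_event t \<rho>) * (SUP y. potential q t y)"
  define f where "f n u \<omega> = q (x + X u \<omega>) * indicator {0..t} u * indicator (before_exit t \<rho> n u) \<omega>" for n u \<omega>
  define g where "g u \<omega> = q (x + X u \<omega>) * indicator {0..t} u * indicator (\<Inter>n. before_exit t \<rho> n u) \<omega>" for u \<omega>
  have lim: "(\<lambda>n. f n u \<omega>) \<longlonglongrightarrow> g u \<omega>" for u \<omega>
  proof -
    have "q (x + X u \<omega>) * indicator {0..t} u < \<top>"
      using le_less_trans[OF c(1) ennreal_less_top] by (auto simp: indicator_def)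
    then show ?thesis
      unfolding f_def g_def by (intro ennreal_tendsto_cmult tendsto_indicator_before_exit)
  qed
  have f_le: "f n u \<omega> \<le> ennreal c * indicator {0..t} u" for n u \<omega>
    using c(1) by (auto simp: f_def indicator_def)
  have f_pair [measurable]: "(\<lambda>z. f n (fst z) (snd z)) \<in> borel_measurable (lborel \<Otimes>\<^sub>M M)" for n
    unfolding f_def by measurable
  have f_u [measurable]: "(\<lambda>u. f n u \<omega>) \<in> borel_measurable lborel" if [measurable]: "\<omega> \<in> space M" for n \<omega>
    unfolding f_def by measurable
  have g_u: "(\<lambda>u. g u \<omega>) \<in> borel_measurable lborel" if "\<omega> \<in> space M" for \<omega>
    by (rule borel_measurable_LIMSEQ_order[OF lim f_u[OF that]])
  have int_u: "(\<lambda>\<omega>. \<integral>\<^sup>+u. f n u \<omega> \<partial>lborel) \<in> borel_measurable M" for n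
    unfolding f_def by measurable
  have const: "(\<integral>\<^sup>+u. ennreal c * indicator {0..t} u \<partial>lborel) = ennreal (c * t)"
    using t c(2) by (simp add: nn_integral_cmult_indicator ennreal_mult)
  have lim_u: "(\<lambda>n. \<integral>\<^sup>+u. f n u \<omega> \<partial>lborel) \<longlonglongrightarrow> (\<integral>\<^sup>+u. g u \<omega> \<partial>lborel)" if "\<omega> \<in> space M" for \<omega>
  proof (rule nn_integral_dominated_convergence)
    show "(\<integral>\<^sup>+u. ennreal c * indicator {0..t} u \<partial>lborel) < \<infinity>"
      unfolding const by simp
  qed (use f_u[OF that] g_u[OF that] f_le lim in auto)
  \<comment> \<open>Measurability of the limit in \<open>\<omega>\<close> is inherited from the
    approximants.\<close>
  have int_g: "(\<lambda>\<omega>. \<integral>\<^sup>+u. g u \<omega> \<partial>lborel) \<in> borel_measurable M"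
    by (rule borel_measurable_LIMSEQ_order[OF lim_u int_u])
  have lim_\<omega>: "(\<lambda>n. \<integral>\<^sup>+\<omega>. (\<integral>\<^sup>+u. f n u \<omega> \<partial>lborel) \<partial>M) \<longlonglongrightarrow> (\<integral>\<^sup>+\<omega>. (\<integral>\<^sup>+u. g u \<omega> \<partial>lborel) \<partial>M)"
  proof (rule nn_integral_dominated_convergence)
    show "AE \<omega> in M. (\<integral>\<^sup>+u. f n u \<omega> \<partial>lborel) \<le> ennreal (c * t)" for n
      unfolding const[symmetric] by (intro AE_I2 nn_integral_mono f_le)
    show "(\<integral>\<^sup>+\<omega>. ennreal (c * t) \<partial>M) < \<infinity>"
      by (simp add: emeasure_space_1)
    show "AE \<omega> in M. (\<lambda>n. \<integral>\<^sup>+u. f n u \<omega> \<partial>lborel) \<longlonglongrightarrow> (\<integral>\<^sup>+u. g u \<omega> \<partial>lborel)"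
      by (intro AE_I2 lim_u)
  qed (use int_u int_g in auto)
  have le: "potential q t x \<le> (\<integral>\<^sup>+\<omega>. (\<integral>\<^sup>+u. f n u \<omega> \<partial>lborel) \<partial>M) + R" for n
  proof -
    have "potential q t x \<le> (\<integral>\<^sup>+u\<in>{0..t}. (\<integral>\<^sup>+\<omega>. indicator (before_exit t \<rho> n u) \<omega> * q (x + X u \<omega>) \<partial>M) \<partial>lborel) + R"
      unfolding R_def by (rule potential_le_before_exit[OF t q])
    also have "(\<integral>\<^sup>+u\<in>{0..t}. (\<integral>\<^sup>+\<omega>. indicator (before_exit t \<rho> n u) \<omega> * q (x + X u \<omega>) \<partial>M) \<partial>lborel) =
        (\<integral>\<^sup>+u. (\<integral>\<^sup>+\<omega>. indicator (before_exit t \<rho> n u) \<omega> * q (x + X u \<omega>) * indicator {0..t} u \<partial>M) \<partial>lborel)"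
      by (intro nn_integral_cong nn_integral_multc[symmetric]) measurable
    also have "\<dots> = (\<integral>\<^sup>+u. (\<integral>\<^sup>+\<omega>. f n u \<omega> \<partial>M) \<partial>lborel)"
      unfolding f_def by (simp only: ac_simps)
    also have "\<dots> = (\<integral>\<^sup>+\<omega>. (\<integral>\<^sup>+u. f n u \<omega> \<partial>lborel) \<partial>M)"
      using f_pair[of n] by (intro P.Fubini'[symmetric]) (simp add: case_prod_beta')
    finally show ?thesis .
  qed
  have "potential q t x \<le> (\<integral>\<^sup>+\<omega>. (\<integral>\<^sup>+u. g u \<omega> \<partial>lborel) \<partial>M) + R"
    by (rule LIMSEQ_le_const[OF tendsto_add[OF lim_\<omega> tendsto_const]]) (use le in auto)
  also have "(\<integral>\<^sup>+\<omega>. (\<integral>\<^sup>+u. g u \<omega> \<partial>lborel) \<partial>M) \<le>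
      (\<integral>\<^sup>+\<omega>. (\<integral>\<^sup>+u\<in>{0..t}. indicator (cball 0 \<rho>) (X u \<omega>) * q (x + X u \<omega>) \<partial>lborel) \<partial>M)"
  proof (rule nn_integral_mono)
    fix \<omega> assume \<omega>: "\<omega> \<in> space M"
    have "(\<integral>\<^sup>+u. g u \<omega> \<partial>lborel) = (\<integral>\<^sup>+u\<in>{0..t}. indicator {u. \<forall>n j::nat. t * real j / 2 ^ n \<le> u \<longrightarrow>
        norm (X (t * real j / 2 ^ n) \<omega>) \<le> \<rho>} u * q (x + X u \<omega>) \<partial>lborel)"
      by (intro nn_integral_cong) (simp add: g_def before_exit_def indicator_def)
    then show "(\<integral>\<^sup>+u. g u \<omega> \<partial>lborel) \<le> (\<integral>\<^sup>+u\<in>{0..t}. indicator (cball 0 \<rho>) (X u \<omega>) * q (x + X u \<omega>) \<partial>lborel)"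
      using nn_integral_before_exit_le[OF t \<omega>, of \<rho> "\<lambda>u. q (x + X u \<omega>)"] by simp
  qed
  also have "\<dots> = (\<integral>\<^sup>+u. (\<integral>\<^sup>+\<omega>. indicator (cball 0 \<rho>) (X u \<omega>) * q (x + X u \<omega>) * indicator {0..t} u \<partial>M) \<partial>lborel)"
    by (rule P.Fubini') measurable
  also have "\<dots> = (\<integral>\<^sup>+u\<in>{0..t}. (\<integral>\<^sup>+\<omega>. indicator (cball 0 \<rho>) (X u \<omega>) * q (x + X u \<omega>) \<partial>M) \<partial>lborel)"
    by (intro nn_integral_cong nn_integral_multc) measurable
  finally show ?thesis
    unfolding R_def by (simp add: add_right_mono)
qed

text \<open>Finiteness is essential: an infinite \<open>A\<close> satisfies the first inequality for
  every \<open>B\<close>.\<close>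

lemma ennreal_absorb_half:
  fixes A B :: ennreal
  assumes "A \<le> B + ennreal (1/2) * A" "A < \<infinity>"
  shows "A \<le> ennreal 2 * B"
proof (cases B)
  case (real b)
  obtain a where a: "A = ennreal a" "0 \<le> a"
    using assms(2) by (cases A) auto
  have "ennreal a \<le> ennreal (b + 1/2 * a)"
    using assms(1) real a by (simp only: ennreal_plus ennreal_mult divide_nonneg_nonneg mult_nonneg_nonneg zero_le_one zero_le_numeral)
  then have "a \<le> b + 1/2 * a"
    using real a by (subst (asm) ennreal_le_iff) auto
  then have "ennreal a \<le> ennreal (2 * b)"
    by (intro ennreal_leI) simp
  then show ?thesis
    using real a by (simp add: ennreal_mult)
qed (simp add: ennreal_mult_top)

text \<open>The factor \<open>exp \<alpha>\<close> pays for the discount, which is at least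
  \<open>exp (- \<alpha>)\<close> on \<open>{0..t}\<close> since \<open>t \<le> 1\<close>. The
  factor 2 comes from absorbing half of the supremum, legitimate because a bounded \<open>q\<close>
  has a finite one.\<close>

lemma potential_le_local_resolvent_bounded:
  assumes t: "0 < t" "t \<le> 1" and q [measurable]: "q \<in> borel_measurable borel"
    and c: "\<And>z. q z \<le> ennreal c" "0 \<le> c"
    and \<rho>: "\<rho> < r" "emeasure M (exit_event t \<rho>) \<le> ennreal (1/2)" and \<alpha>: "0 < \<alpha>"
  shows "(SUP x. potential q t x) \<le> ennreal (2 * exp \<alpha>) * (SUP x. local_resolvent \<alpha> q r x)"
proof -
  define A where "A = (SUP x. potential q t x)"
  define S where "S = (SUP x. local_resolvent \<alpha> q r x)"
  have [measurable]: "ball (0::'a) r \<in> sets borel" by simp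
  have "A \<le> ennreal (c * t)"
    unfolding A_def by (intro SUP_least potential_le_const[OF c]) (use t in simp)
  then have "A < \<infinity>"
    by (rule le_less_trans) simp
  moreover have "A \<le> ennreal (exp \<alpha>) * S + ennreal (1/2) * A"
    unfolding A_def
  proof (rule SUP_least, fold A_def)
    fix x
    have "potential q t x \<le> (\<integral>\<^sup>+u\<in>{0..t}. (\<integral>\<^sup>+\<omega>. indicator (cball 0 \<rho>) (X u \<omega>) * q (x + X u \<omega>) \<partial>M) \<partial>lborel)
        + emeasure M (exit_event t \<rho>) * A"
      unfolding A_def by (rule potential_le_local[OF t(1) q c])
    also have "\<dots> \<le> ennreal (exp \<alpha>) * S + ennreal (1/2) * A"
    proof (intro add_mono mult_right_mono \<rho>)
      have "(\<integral>\<^sup>+u\<in>{0..t}. (\<integral>\<^sup>+\<omega>. indicator (cball 0 \<rho>) (X u \<omega>) * q (x + X u \<omega>) \<partial>M) \<partial>lborel) \<le>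
          (\<integral>\<^sup>+u. ennreal (exp \<alpha>) * (ennreal (exp (- \<alpha> * u)) *
            (\<integral>\<^sup>+\<omega>. indicator (ball 0 r) (X u \<omega>) * q (x + X u \<omega>) \<partial>M) * indicator {0..} u) \<partial>lborel)"
      proof (rule nn_integral_mono)
        fix u
        define K where "K = (\<integral>\<^sup>+\<omega>. indicator (ball 0 r) (X u \<omega>) * q (x + X u \<omega>) \<partial>M)"
        have "(\<integral>\<^sup>+\<omega>. indicator (cball 0 \<rho>) (X u \<omega>) * q (x + X u \<omega>) \<partial>M) \<le> K"
          unfolding K_def using \<rho>(1) by (intro nn_integral_mono mult_right_mono) (auto simp: indicator_def)
        also have "K \<le> ennreal (exp \<alpha>) * (ennreal (exp (- \<alpha> * u)) * K)" if "u \<in> {0..t}"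
        proof -
          have "\<alpha> * u \<le> \<alpha> * 1"
            using that t \<alpha> by (intro mult_left_mono) auto
          then have "1 \<le> exp \<alpha> * exp (- \<alpha> * u)"
            by (simp flip: exp_add)
          then have "ennreal 1 \<le> ennreal (exp \<alpha> * exp (- \<alpha> * u))"
            by (rule ennreal_leI)
          then have "1 * K \<le> ennreal (exp \<alpha>) * ennreal (exp (- \<alpha> * u)) * K"
            by (intro mult_right_mono) (simp_all add: ennreal_mult)
          then show ?thesis by (simp add: mult.assoc)
        qed
        finally show "(\<integral>\<^sup>+\<omega>. indicator (cball 0 \<rho>) (X u \<omega>) * q (x + X u \<omega>) \<partial>M) * indicator {0..t} u \<le>
            ennreal (exp \<alpha>) * (ennreal (exp (- \<alpha> * u)) *
            (\<integral>\<^sup>+\<omega>. indicator (ball 0 r) (X u \<omega>) * q (x + X u \<omega>) \<partial>M) * indicator {0..} u)"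
          by (cases "u \<in> {0..t}") (simp_all add: K_def)
      qed
      also have "\<dots> = ennreal (exp \<alpha>) * local_resolvent \<alpha> q r x"
        unfolding local_resolvent_def by (rule nn_integral_cmult) measurable
      also have "\<dots> \<le> ennreal (exp \<alpha>) * S"
        unfolding S_def by (intro mult_left_mono SUP_upper) auto
      finally show "(\<integral>\<^sup>+u\<in>{0..t}. (\<integral>\<^sup>+\<omega>. indicator (cball 0 \<rho>) (X u \<omega>) * q (x + X u \<omega>) \<partial>M) \<partial>lborel) \<le> ennreal (exp \<alpha>) * S" .
    qed auto
    finally show "potential q t x \<le> ennreal (exp \<alpha>) * S + ennreal (1/2) * A" .
  qed
  ultimately have "A \<le> ennreal 2 * (ennreal (exp \<alpha>) * S)"
    by (intro ennreal_absorb_half)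
  then show ?thesis
    unfolding A_def S_def by (simp add: ennreal_mult mult.assoc)
qed

text \<open>The constant above is free of the bound on \<open>q\<close>, so it survives truncation
  at level \<open>n\<close> and monotone convergence.\<close>

lemma potential_le_local_resolvent:
  assumes t: "0 < t" "t \<le> 1" and q [measurable]: "q \<in> borel_measurable borel"
    and \<rho>: "\<rho> < r" "emeasure M (exit_event t \<rho>) \<le> ennreal (1/2)" and \<alpha>: "0 < \<alpha>"
  shows "(SUP x. potential q t x) \<le> ennreal (2 * exp \<alpha>) * (SUP x. local_resolvent \<alpha> q r x)"
proof (rule SUP_least)
  fix x
  define q' where "q' n z = min (q z) (ennreal (real n))" for n :: nat and z
  have [measurable]: "q' n \<in> borel_measurable borel" for n
    unfolding q'_def by measurable
  have inc: "incseq q'"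
    unfolding q'_def by (intro monoI le_funI min.mono order_refl ennreal_leI) simp
  have sup: "(SUP n. q' n z) = q z" for z
  proof (rule antisym)
    show "(SUP n. q' n z) \<le> q z"
      by (intro SUP_least) (simp add: q'_def)
    show "q z \<le> (SUP n. q' n z)"
    proof (cases "q z")
      case (real a)
      obtain n where "a \<le> real n" using real_arch_simple by blast
      then have "q z = q' n z"
        using real by (simp add: q'_def min_def ennreal_leI)
      then show ?thesis by (metis SUP_upper UNIV_I)
    next
      case top
      then have "q' n z = ennreal (real n)" for n
        by (simp add: q'_def min_absorb2)
      then show ?thesis
        by (simp add: ennreal_SUP_of_nat_eq_top flip: ennreal_of_nat_eq_real_of_nat)
    qed
  qed
  have inner: "(SUP n. \<integral>\<^sup>+\<omega>. q' n (x + X u \<omega>) \<partial>M) = (\<integral>\<^sup>+\<omega>. q (x + X u \<omega>) \<partial>M)" for u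
  proof -
    have "(\<integral>\<^sup>+\<omega>. (SUP n. q' n (x + X u \<omega>)) \<partial>M) = (SUP n. \<integral>\<^sup>+\<omega>. q' n (x + X u \<omega>) \<partial>M)"
      by (rule nn_integral_monotone_convergence_SUP) (use inc in \<open>auto simp: mono_def le_fun_def\<close>)
    then show ?thesis by (simp add: sup)
  qed
  have "potential q t x = (\<integral>\<^sup>+u. (SUP n. (\<integral>\<^sup>+\<omega>. q' n (x + X u \<omega>) \<partial>M) * indicator {0..t} u) \<partial>lborel)"
    unfolding potential_def inner[symmetric] by (intro nn_integral_cong) (simp add: SUP_mult_right_ennreal)
  also have "\<dots> = (SUP n. potential (q' n) t x)"
    unfolding potential_def
    by (rule nn_integral_monotone_convergence_SUP)
      (use inc in \<open>auto simp: mono_def le_fun_def intro!: mult_right_mono nn_integral_mono\<close>)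
  also have "\<dots> \<le> ennreal (2 * exp \<alpha>) * (SUP x. local_resolvent \<alpha> q r x)"
  proof (rule SUP_least)
    fix n
    have "potential (q' n) t x \<le> (SUP x. potential (q' n) t x)"
      by (rule SUP_upper) simp
    also have "\<dots> \<le> ennreal (2 * exp \<alpha>) * (SUP x. local_resolvent \<alpha> (q' n) r x)"
      by (rule potential_le_local_resolvent_bounded[OF t _ _ _ \<rho> \<alpha>, of _ "real n"]) (auto simp: q'_def)
    also have "\<dots> \<le> ennreal (2 * exp \<alpha>) * (SUP x. local_resolvent \<alpha> q r x)"
      unfolding local_resolvent_def
      by (intro mult_left_mono SUP_mono' nn_integral_mono mult_right_mono) (auto simp: q'_def)
    finally show "potential (q' n) t x \<le> ennreal (2 * exp \<alpha>) * (SUP x. local_resolvent \<alpha> q r x)" .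
  qed
  finally show "potential q t x \<le> ennreal (2 * exp \<alpha>) * (SUP x. local_resolvent \<alpha> q r x)" .
qed

lemma potential_mono_time: "s \<le> t \<Longrightarrow> potential q s x \<le> potential q t x"
  unfolding potential_def by (intro nn_integral_mono mult_left_mono) (auto simp: indicator_def)

text \<open>The radius is fixed first, by the small-ball condition; then \<open>t\<close> is chosen
  so that leaving the ball of radius \<open>r / 2\<close> before \<open>t\<close> has probability at
  most 1/2. Monotonicity in time covers all smaller horizons.\<close>

lemma kato_space_subset_kato_time: "kato_space M X \<subseteq> kato_time M X"
proof
  fix q :: "'a \<Rightarrow> real"
  assume "q \<in> kato_space M X"
  then obtain \<alpha> where q [measurable]: "q \<in> borel_measurable borel" and \<alpha>: "0 < \<alpha>"
    and lim: "((\<lambda>r. SUP x. local_resolvent \<alpha> (\<lambda>z. ennreal \<bar>q z\<bar>) r x) \<longlongrightarrow> 0) (at_right 0)"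
    by (auto simp: kato_space_eq)
  define Q where "Q = (\<lambda>z. ennreal \<bar>q z\<bar>)"
  have [measurable]: "Q \<in> borel_measurable borel"
    unfolding Q_def by measurable
  have "((\<lambda>t. SUP x. potential Q t x) \<longlongrightarrow> 0) (at_right 0)"
  proof (rule order_tendstoI)
    fix a :: ennreal assume "0 < a"
    have "((\<lambda>r. ennreal (2 * exp \<alpha>) * (SUP x. local_resolvent \<alpha> Q r x)) \<longlongrightarrow> ennreal (2 * exp \<alpha>) * 0) (at_right 0)"
      unfolding Q_def by (rule ennreal_tendsto_cmult[OF _ lim]) simp
    then have "\<forall>\<^sub>F r in at_right 0. ennreal (2 * exp \<alpha>) * (SUP x. local_resolvent \<alpha> Q r x) < a"
      by (rule order_tendstoD(2)) (use \<open>0 < a\<close> in simp)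
    then obtain b where b: "0 < b" "\<And>r. 0 < r \<Longrightarrow> r < b \<Longrightarrow> ennreal (2 * exp \<alpha>) * (SUP x. local_resolvent \<alpha> Q r x) < a"
      unfolding eventually_at_right_field by blast
    define r where "r = b / 2"
    have r: "0 < r" "ennreal (2 * exp \<alpha>) * (SUP x. local_resolvent \<alpha> Q r x) < a"
      using b by (auto simp: r_def)
    obtain t where t: "0 < t" "t \<le> 1" "emeasure M (exit_event t (r / 2)) \<le> ennreal (1/2)"
      using ex_small_exit_event[of "r / 2"] r(1) by auto
    have small: "(SUP x. potential Q t x) < a"
      using potential_le_local_resolvent[OF t(1,2) _ _ t(3) \<alpha>, of Q r] r by simp
    have "\<forall>\<^sub>F s in at_right 0. s \<in> {0<..<t}"
      by (rule eventually_at_right_real) (rule t)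
    then show "\<forall>\<^sub>F s in at_right 0. (SUP x. potential Q s x) < a"
    proof eventually_elim
      case (elim s)
      then have "(SUP x. potential Q s x) \<le> (SUP x. potential Q t x)"
        by (intro SUP_mono' potential_mono_time) simp
      then show ?case using small by (rule le_less_trans)
    qed
  qed simp
  with q show "q \<in> kato_time M X"
    by (simp add: kato_time_eq Q_def)
qed

end

subsection \<open>Times spent at the starting point\<close>

text \<open>Continuity of translations by regularity: a compact \<open>K\<close> inside
  \<open>A\<close> and an open \<open>U\<close> around \<open>K\<close> each lose at most
  \<open>e / 2\<close>. A small shift of \<open>K\<close> stays in \<open>U\<close>, and two copies
  of \<open>K\<close> inside \<open>U\<close> must overlap in measure at least
  \<open>2 |K| - |U|\<close>.\<close>

lemma measure_translation_overlap:
  fixes A :: "'a::euclidean_space set"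
  assumes A: "A \<in> sets borel" "bounded A" and "0 < e"
  obtains \<delta> where "0 < \<delta>"
    "\<And>s. norm s < \<delta> \<Longrightarrow> measure lebesgue A - e \<le> measure lebesgue (A \<inter> (+) s ` A)"
proof -
  have A': "A \<in> lmeasurable"
    using A by (intro bounded_set_imp_lmeasurable) auto
  have half: "0 < e / 2" using \<open>0 < e\<close> by simp
  from sets_lebesgue_inner_closed[OF fmeasurableD[OF A'] half]
  obtain K where K: "closed K" "K \<subseteq> A" "A - K \<in> lmeasurable" "emeasure lebesgue (A - K) < ennreal (e/2)"
    by blast
  have "compact K"
    using K A(2) bounded_subset compact_eq_bounded_closed by blast
  then have K': "K \<in> lmeasurable"
    by (rule lmeasurable_compact)
  from sets_lebesgue_outer_open[OF fmeasurableD[OF K'] half]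
  obtain U where U: "open U" "K \<subseteq> U" "U - K \<in> lmeasurable" "emeasure lebesgue (U - K) < ennreal (e/2)"
    by blast
  have "measure lebesgue (A - K) < e/2"
    using K(3,4) \<open>0 < e\<close> by (simp add: emeasure_eq_measure2 ennreal_less_iff)
  moreover have "measure lebesgue (A - K) = measure lebesgue A - measure lebesgue K"
    using A' K' K(2) by (simp add: measurable_measure_Diff fmeasurableD)
  ultimately have mA: "measure lebesgue A \<le> measure lebesgue K + e/2" by simp
  have U': "U \<in> lmeasurable"
    using fmeasurable.Un[OF K' U(3)] U(2) by (simp add: Un_absorb1)
  have "measure lebesgue (U - K) < e/2"
    using U(3,4) \<open>0 < e\<close> by (simp add: emeasure_eq_measure2 ennreal_less_iff)
  moreover have "measure lebesgue (U - K) = measure lebesgue U - measure lebesgue K"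
    using U' K' U(2) by (simp add: measurable_measure_Diff fmeasurableD)
  ultimately have mU: "measure lebesgue U \<le> measure lebesgue K + e/2" by simp
  obtain \<delta> where \<delta>: "0 < \<delta>" "(\<Union>x\<in>K. ball x \<delta>) \<subseteq> U"
    using compact_subset_open_imp_ball_epsilon_subset[OF \<open>compact K\<close> U(1,2)] by blast
  show thesis
  proof (rule that[OF \<delta>(1)])
    fix s :: 'a assume s: "norm s < \<delta>"
    have sub: "(+) s ` K \<subseteq> U"
    proof (rule image_subsetI)
      fix x assume "x \<in> K"
      moreover have "s + x \<in> ball x \<delta>" using s by (simp add: dist_norm)
      ultimately show "s + x \<in> U" using \<delta>(2) by blast
    qed
    have sK: "(+) s ` K \<in> lmeasurable" and sA: "(+) s ` A \<in> lmeasurable"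
      using K' A' by (simp_all add: measurable_translation)
    have "measure lebesgue (K \<union> (+) s ` K) \<le> measure lebesgue U"
      using sub U(2) U' fmeasurable.Un[OF K' sK] by (intro measure_mono_fmeasurable) (auto simp: fmeasurableD)
    moreover have "measure lebesgue (K \<union> (+) s ` K) = 2 * measure lebesgue K - measure lebesgue (K \<inter> (+) s ` K)"
      using measure_Un3[OF K' sK] by (simp add: measure_translation)
    moreover have "measure lebesgue (K \<inter> (+) s ` K) \<le> measure lebesgue (A \<inter> (+) s ` A)"
      using K(2) fmeasurable.Int[OF A' sA] fmeasurable.Int[OF K' sK]
      by (intro measure_mono_fmeasurable) (auto simp: fmeasurableD)
    ultimately show "measure lebesgue A - e \<le> measure lebesgue (A \<inter> (+) s ` A)"
      using mA mU by linarith
  qed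
qed

text \<open>Both \<open>u\<close> and \<open>u + (1/2) ^ n\<close> lie in \<open>A\<close> exactly
  when \<open>u\<close> lies in \<open>A\<close> and in \<open>A\<close> shifted by minus
  \<open>(1/2) ^ n\<close>.\<close>

lemma emeasure_overlap_tendsto:
  fixes A :: "real set"
  assumes A: "A \<in> sets borel" "bounded A"
  shows "(\<lambda>n. emeasure lborel {u \<in> A. u + (1/2) ^ n \<in> A}) \<longlonglongrightarrow> emeasure lborel A"
proof -
  have A': "A \<in> lmeasurable"
    using A by (intro bounded_set_imp_lmeasurable) auto
  define B where "B n = {u \<in> A. u + (1/2) ^ n \<in> A}" for n :: nat
  have B_eq: "B n = A \<inter> (+) (- ((1/2) ^ n)) ` A" for n
  proof (intro set_eqI iffI)
    fix u assume "u \<in> B n"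
    moreover have "u = - ((1/2) ^ n) + (u + (1/2) ^ n)" by simp
    ultimately show "u \<in> A \<inter> (+) (- ((1/2) ^ n)) ` A"
      unfolding B_def by blast
  qed (auto simp: B_def)
  have [measurable]: "A \<in> sets borel" by fact
  have B: "B n \<in> sets borel" for n
  proof -
    have "{u \<in> space borel. u \<in> A \<and> u + (1/2) ^ n \<in> A} \<in> sets borel"
      by measurable
    then show ?thesis by (simp add: B_def)
  qed
  have B': "B n \<in> lmeasurable" for n
    unfolding B_eq by (intro fmeasurable.Int measurable_translation A')
  have "(\<lambda>n. measure lebesgue (B n)) \<longlonglongrightarrow> measure lebesgue A"
  proof (rule LIMSEQ_I)
    fix e :: real assume "0 < e"
    then have "0 < e / 2" by simp
    from measure_translation_overlap[OF A this] obtain \<delta> where \<delta>: "0 < \<delta>"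
      "\<And>s. norm s < \<delta> \<Longrightarrow> measure lebesgue A - e / 2 \<le> measure lebesgue (A \<inter> (+) s ` A)" by blast
    have "(\<lambda>n. (1/2::real) ^ n) \<longlonglongrightarrow> 0"
      by (intro LIMSEQ_realpow_zero) auto
    then have "\<forall>\<^sub>F n in sequentially. (1/2::real) ^ n < \<delta>"
      by (rule order_tendstoD) (rule \<delta>)
    then obtain N where N: "\<And>n. N \<le> n \<Longrightarrow> (1/2::real) ^ n < \<delta>"
      by (auto simp: eventually_sequentially)
    have "norm (measure lebesgue (B n) - measure lebesgue A) < e" if "N \<le> n" for n
    proof -
      have "measure lebesgue A - e / 2 \<le> measure lebesgue (B n)"
        unfolding B_eq using N[OF that] by (intro \<delta>(2)) simp
      moreover have "measure lebesgue (B n) \<le> measure lebesgue A"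
        using A' B' by (intro measure_mono_fmeasurable) (auto simp: B_def fmeasurableD)
      ultimately show ?thesis using \<open>0 < e\<close> by simp
    qed
    then show "\<exists>no. \<forall>n\<ge>no. norm (measure lebesgue (B n) - measure lebesgue A) < e" by blast
  qed
  then have "(\<lambda>n. ennreal (measure lebesgue (B n))) \<longlonglongrightarrow> ennreal (measure lebesgue A)"
    by (rule tendsto_ennrealI)
  moreover have "ennreal (measure lebesgue S) = emeasure lborel S" if "S \<in> sets borel" "S \<subseteq> A" for S
  proof -
    have "emeasure lborel S \<noteq> \<infinity>"
      using emeasure_bounded_finite[OF bounded_subset[OF A(2) that(2)]] by simp
    then show ?thesis
      using that(1) by (simp add: emeasure_eq_ennreal_measure)
  qed
  moreover have "B n \<subseteq> A" for n
    by (auto simp: B_def)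
  ultimately show ?thesis
    using A(1) B by (simp only: order_refl flip: B_def)
qed

section \<open>The atom at zero of the law of the process\<close>

context rc_levy_process
begin

definition hit_zero :: "real \<Rightarrow> real" where
  "hit_zero t = prob {\<omega> \<in> space M. X t \<omega> = 0}"

lemma nn_integral_hit_zero: "(\<integral>\<^sup>+\<omega>. indicator {0} (X t \<omega>) \<partial>M) = ennreal (hit_zero t)"
proof -
  have "(\<integral>\<^sup>+\<omega>. indicator {0} (X t \<omega>) \<partial>M) = (\<integral>\<^sup>+\<omega>. indicator {\<omega> \<in> space M. X t \<omega> = 0} \<omega> \<partial>M)"
    by (intro nn_integral_cong) (auto simp: indicator_def)
  then show ?thesis
    by (simp add: hit_zero_def emeasure_eq_measure)
qed

lemma measurable_hit_zero [measurable]: "hit_zero \<in> borel_measurable borel"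
proof -
  have "hit_zero t = enn2real (\<integral>\<^sup>+\<omega>. indicator {0} (X t \<omega>) \<partial>M)" for t
    unfolding nn_integral_hit_zero by (simp add: hit_zero_def)
  then show ?thesis
    by (subst measurable_cong) (assumption, measurable)
qed

lemma hit_zero_nonneg: "0 \<le> hit_zero t" and hit_zero_le_1: "hit_zero t \<le> 1"
  by (simp_all add: hit_zero_def)

text \<open>A finite window \<open>{0..T}\<close> replaces the discount, so that the zero set
  \<open>Z \<omega>\<close> of each path is bounded and its overlap with a small translate tends to
  its full length. In expectation the overlap is at most \<open>hit_zero (s n)\<close> times the
  mean length \<open>c\<close>, which is positive and finite.\<close>

lemma hit_zero_tendsto_1:
  assumes pos: "0 < (\<integral>\<^sup>+u\<in>{0..T}. ennreal (hit_zero u) \<partial>lborel)" and "0 < T"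
  shows "(\<lambda>n. hit_zero ((1/2) ^ n)) \<longlonglongrightarrow> 1"
proof -
  interpret P: pair_sigma_finite lborel M ..
  define C where "C = (\<integral>\<^sup>+u\<in>{0..T}. ennreal (hit_zero u) \<partial>lborel)"
  have "C \<le> (\<integral>\<^sup>+u\<in>{0..T}. 1 \<partial>lborel)"
    unfolding C_def by (intro nn_integral_mono mult_right_mono) (simp_all add: hit_zero_le_1)
  also have "\<dots> < \<infinity>" using \<open>0 < T\<close> by simp
  finally obtain c where c: "C = ennreal c" "0 < c"
    using pos by (cases C) (auto simp flip: C_def)
  define Z where "Z \<omega> = {u \<in> {0..T}. X u \<omega> = 0}" for \<omega>
  have Z_sets: "Z \<omega> \<in> sets borel" if [measurable]: "\<omega> \<in> space M" for \<omega>
  proof -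
    have "{u \<in> space borel. u \<in> {0..T} \<and> X u \<omega> = 0} \<in> sets borel"
      by measurable
    then show ?thesis by (simp add: Z_def)
  qed
  have Z_bounded: "bounded (Z \<omega>)" for \<omega>
    by (rule bounded_subset[OF bounded_closed_interval[of 0 T]]) (auto simp: Z_def)
  define s where "s n = (1/2::real) ^ n" for n :: nat
  define f :: "nat \<Rightarrow> real \<Rightarrow> 'w \<Rightarrow> ennreal" where "f n u \<omega> = indicator {0..T} u * indicator {0..T} (u + s n) * (indicator {0} (X u \<omega>) * indicator {0} (X (u + s n) \<omega>))" for n u \<omega>
  have f: "(\<integral>\<^sup>+u. f n u \<omega> \<partial>lborel) = emeasure lborel {u \<in> Z \<omega>. u + (1/2) ^ n \<in> Z \<omega>}" if [measurable]: "\<omega> \<in> space M" for n \<omega>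
  proof -
    have [measurable]: "Z \<omega> \<in> sets borel" by (rule Z_sets) fact
    have "{u \<in> space borel. u \<in> Z \<omega> \<and> u + (1/2) ^ n \<in> Z \<omega>} \<in> sets borel"
      by measurable
    then have "{u \<in> Z \<omega>. u + (1/2) ^ n \<in> Z \<omega>} \<in> sets lborel" by simp
    then have "emeasure lborel {u \<in> Z \<omega>. u + (1/2) ^ n \<in> Z \<omega>} = (\<integral>\<^sup>+u. indicator {u \<in> Z \<omega>. u + (1/2) ^ n \<in> Z \<omega>} u \<partial>lborel)"
      by (rule nn_integral_indicator[symmetric])
    also have "\<dots> = (\<integral>\<^sup>+u. f n u \<omega> \<partial>lborel)"
      by (intro nn_integral_cong) (auto simp: f_def Z_def s_def indicator_def)
    finally show ?thesis by simp
  qed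
  have [measurable]: "(\<lambda>\<omega>. \<integral>\<^sup>+u. f n u \<omega> \<partial>lborel) \<in> borel_measurable M" for n
    unfolding f_def by measurable
  have Z: "emeasure lborel (Z \<omega>) = (\<integral>\<^sup>+u\<in>{0..T}. indicator {0} (X u \<omega>) \<partial>lborel)" if "\<omega> \<in> space M" for \<omega>
  proof -
    have "emeasure lborel (Z \<omega>) = (\<integral>\<^sup>+u. indicator (Z \<omega>) u \<partial>lborel)"
      using Z_sets[OF that] by (intro nn_integral_indicator[symmetric]) simp
    also have "\<dots> = (\<integral>\<^sup>+u\<in>{0..T}. indicator {0} (X u \<omega>) \<partial>lborel)"
      by (intro nn_integral_cong) (auto simp: Z_def indicator_def)
    finally show ?thesis .
  qed
  have lim: "(\<lambda>n. \<integral>\<^sup>+\<omega>. (\<integral>\<^sup>+u. f n u \<omega> \<partial>lborel) \<partial>M) \<longlonglongrightarrow> (\<integral>\<^sup>+\<omega>. (\<integral>\<^sup>+u\<in>{0..T}. indicator {0} (X u \<omega>) \<partial>lborel) \<partial>M)"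
  proof (rule nn_integral_dominated_convergence)
    show "AE \<omega> in M. (\<integral>\<^sup>+u. f n u \<omega> \<partial>lborel) \<le> emeasure lborel {0..T}" for n
      by (intro AE_I2, subst f) (auto intro!: emeasure_mono simp: Z_def)
    show "(\<integral>\<^sup>+\<omega>. emeasure lborel {0..T} \<partial>M) < \<infinity>"
      using \<open>0 < T\<close> by (simp add: emeasure_space_1)
    show "AE \<omega> in M. (\<lambda>n. \<integral>\<^sup>+u. f n u \<omega> \<partial>lborel) \<longlonglongrightarrow> (\<integral>\<^sup>+u\<in>{0..T}. indicator {0} (X u \<omega>) \<partial>lborel)"
    proof (rule AE_I2)
      fix \<omega> assume "\<omega> \<in> space M"
      then show "(\<lambda>n. \<integral>\<^sup>+u. f n u \<omega> \<partial>lborel) \<longlonglongrightarrow> (\<integral>\<^sup>+u\<in>{0..T}. indicator {0} (X u \<omega>) \<partial>lborel)"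
        using emeasure_overlap_tendsto[OF Z_sets Z_bounded] by (simp only: f Z)
    qed
  qed measurable
  have "(\<integral>\<^sup>+\<omega>. (\<integral>\<^sup>+u\<in>{0..T}. indicator {0} (X u \<omega>) \<partial>lborel) \<partial>M) =
      (\<integral>\<^sup>+u. (\<integral>\<^sup>+\<omega>. indicator {0} (X u \<omega>) * indicator {0..T} u \<partial>M) \<partial>lborel)"
    by (rule P.Fubini') measurable
  also have "\<dots> = C"
    unfolding C_def by (intro nn_integral_cong) (simp add: nn_integral_multc nn_integral_hit_zero)
  finally have lim_C: "(\<integral>\<^sup>+\<omega>. (\<integral>\<^sup>+u\<in>{0..T}. indicator {0} (X u \<omega>) \<partial>lborel) \<partial>M) = C" .
  have le: "(\<integral>\<^sup>+\<omega>. (\<integral>\<^sup>+u. f n u \<omega> \<partial>lborel) \<partial>M) \<le> ennreal (hit_zero (s n) * c)" for n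
  proof -
    have "(\<integral>\<^sup>+\<omega>. (\<integral>\<^sup>+u. f n u \<omega> \<partial>lborel) \<partial>M) = (\<integral>\<^sup>+u. (\<integral>\<^sup>+\<omega>. f n u \<omega> \<partial>M) \<partial>lborel)"
      by (rule P.Fubini') (simp add: f_def)
    also have "\<dots> \<le> (\<integral>\<^sup>+u. ennreal (hit_zero (s n)) * (ennreal (hit_zero u) * indicator {0..T} u) \<partial>lborel)"
    proof (rule nn_integral_mono)
      fix u
      show "(\<integral>\<^sup>+\<omega>. f n u \<omega> \<partial>M) \<le> ennreal (hit_zero (s n)) * (ennreal (hit_zero u) * indicator {0..T} u)"
      proof (cases "u \<in> {0..T}")
        case True
        \<comment> \<open>The constraint that \<open>u + s n\<close> stays in the window is dropped;
          starting from 0, a zero at time \<open>u + s n\<close> means a zero increment.\<close>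
        then have "(\<integral>\<^sup>+\<omega>. f n u \<omega> \<partial>M) \<le> (\<integral>\<^sup>+\<omega>. (\<lambda>(x, y). indicator {0} x * indicator {0} y) (X u \<omega>, X (u + s n) \<omega> - X u \<omega>) \<partial>M)"
          by (intro nn_integral_mono) (auto simp: f_def indicator_def)
        also have "\<dots> = (\<integral>\<^sup>+\<omega>. (\<integral>\<^sup>+\<omega>'. (\<lambda>(x, y). indicator {0} x * indicator {0} y) (X u \<omega>, X (s n) \<omega>') \<partial>M) \<partial>M)"
          by (rule nn_integral_markov) (use True in \<open>auto simp: s_def\<close>)
        also have "\<dots> = ennreal (hit_zero u) * ennreal (hit_zero (s n))"
          by (simp add: nn_integral_cmult nn_integral_multc nn_integral_hit_zero)
        finally show ?thesis
          using True by (simp add: mult.commute)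
      qed (simp add: f_def)
    qed
    also have "\<dots> = ennreal (hit_zero (s n)) * C"
      unfolding C_def by (rule nn_integral_cmult) measurable
    finally show ?thesis
      using c by (simp add: ennreal_mult hit_zero_nonneg)
  qed
  have "(\<lambda>n. ennreal (hit_zero (s n) * c)) \<longlonglongrightarrow> ennreal c"
  proof (rule tendsto_sandwich)
    show "(\<lambda>n. \<integral>\<^sup>+\<omega>. (\<integral>\<^sup>+u. f n u \<omega> \<partial>lborel) \<partial>M) \<longlonglongrightarrow> ennreal c"
      using lim unfolding lim_C c(1) .
    show "\<forall>\<^sub>F n in sequentially. (\<integral>\<^sup>+\<omega>. (\<integral>\<^sup>+u. f n u \<omega> \<partial>lborel) \<partial>M) \<le> ennreal (hit_zero (s n) * c)"
      by (intro always_eventually allI le)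
    show "\<forall>\<^sub>F n in sequentially. ennreal (hit_zero (s n) * c) \<le> ennreal c"
      using c hit_zero_le_1 by (intro always_eventually allI ennreal_leI) (simp add: mult_le_cancel_right2)
  qed (rule tendsto_const)
  then have "(\<lambda>n. hit_zero (s n) * c) \<longlonglongrightarrow> c"
    using c by (subst (asm) tendsto_ennreal_iff) (auto simp: hit_zero_nonneg)
  then have "(\<lambda>n. hit_zero (s n) * c / c) \<longlonglongrightarrow> c / c"
    by (rule tendsto_divide[OF _ tendsto_const]) (use c in simp)
  then show ?thesis
    using c by (simp add: s_def)
qed

text \<open>If two independent increments over time \<open>s\<close> sum to 0, then both vanish or
  neither does; the second case is overestimated by ignoring the cancellation.\<close>

lemma hit_zero_double: "0 \<le> s \<Longrightarrow> hit_zero (2 * s) \<le> (hit_zero s)\<^sup>2 + (1 - hit_zero s)\<^sup>2"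
proof -
  assume s: "0 \<le> s"
  have compl: "(\<integral>\<^sup>+\<omega>. indicator (- {0}) (X s \<omega>) \<partial>M) = ennreal (1 - hit_zero s)"
  proof -
    have "(\<integral>\<^sup>+\<omega>. indicator (- {0}) (X s \<omega>) \<partial>M) = (\<integral>\<^sup>+\<omega>. indicator (space M - {\<omega> \<in> space M. X s \<omega> = 0}) \<omega> \<partial>M)"
      by (intro nn_integral_cong) (auto simp: indicator_def)
    also have "\<dots> = ennreal (1 - hit_zero s)"
      by (subst nn_integral_indicator) (simp_all add: emeasure_eq_measure prob_compl hit_zero_def)
    finally show ?thesis .
  qed
  have "ennreal (hit_zero (2 * s)) = (\<integral>\<^sup>+\<omega>. indicator {0} (X (2 * s) \<omega>) \<partial>M)"
    by (rule nn_integral_hit_zero[symmetric])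
  also have "\<dots> \<le> (\<integral>\<^sup>+\<omega>. (\<lambda>(x, y). indicator {0} x * indicator {0} y + indicator (- {0}) x * indicator (- {0}) y) (X s \<omega>, X (s + s) \<omega> - X s \<omega>) \<partial>M)"
    by (intro nn_integral_mono) (auto simp: indicator_def)
  also have "\<dots> = (\<integral>\<^sup>+\<omega>. (\<integral>\<^sup>+\<omega>'. (\<lambda>(x, y). indicator {0} x * indicator {0} y + indicator (- {0}) x * indicator (- {0}) y) (X s \<omega>, X s \<omega>') \<partial>M) \<partial>M)"
    by (rule nn_integral_markov[OF s s]) measurable
  also have "\<dots> = ennreal (hit_zero s) * ennreal (hit_zero s) + ennreal (1 - hit_zero s) * ennreal (1 - hit_zero s)"
    by (simp add: nn_integral_add nn_integral_cmult nn_integral_multc nn_integral_hit_zero compl)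
  also have "\<dots> = ennreal ((hit_zero s)\<^sup>2 + (1 - hit_zero s)\<^sup>2)"
    by (simp add: ennreal_mult[symmetric] ennreal_plus[symmetric] power2_eq_square hit_zero_nonneg hit_zero_le_1 del: ennreal_plus)
  finally show ?thesis
    by (subst (asm) ennreal_le_iff) simp_all
qed

text \<open>One way to reach \<open>B\<close> at time \<open>2 * s\<close> is to jump into
  \<open>B\<close> in one half and show zero increment in the other. The two orders exclude each
  other since 0 is not in \<open>B\<close>, hence the factor 2. This makes the rescaled laws below
  decrease.\<close>

lemma double_hit_zero_le:
  assumes s: "0 \<le> s" and B [measurable]: "B \<in> sets borel" and "0 \<notin> B"
  shows "2 * ennreal (hit_zero s) * emeasure (distr M borel (X s)) B \<le> emeasure (distr M borel (X (2 * s))) B"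
proof -
  have e: "emeasure (distr M borel (X t)) B = (\<integral>\<^sup>+\<omega>. indicator B (X t \<omega>) \<partial>M)" for t
    by (simp flip: nn_integral_indicator add: nn_integral_distr)
  have "2 * ennreal (hit_zero s) * emeasure (distr M borel (X s)) B =
      (\<integral>\<^sup>+\<omega>. (\<integral>\<^sup>+\<omega>'. (\<lambda>(x, y). indicator {0} x * indicator B y + indicator B x * indicator {0} y) (X s \<omega>, X s \<omega>') \<partial>M) \<partial>M)"
    unfolding e by (simp add: nn_integral_add nn_integral_cmult nn_integral_multc nn_integral_hit_zero) (simp add: mult_2 distrib_left distrib_right mult.commute)
  also have "\<dots> = (\<integral>\<^sup>+\<omega>. (\<lambda>(x, y). indicator {0} x * indicator B y + indicator B x * indicator {0} y) (X s \<omega>, X (s + s) \<omega> - X s \<omega>) \<partial>M)"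
    by (rule nn_integral_markov[OF s s, symmetric]) measurable
  also have "\<dots> \<le> (\<integral>\<^sup>+\<omega>. indicator B (X (2 * s) \<omega>) \<partial>M)"
    using \<open>0 \<notin> B\<close> by (intro nn_integral_mono) (auto simp: indicator_def)
  finally show ?thesis by (simp add: e)
qed

end

subsection \<open>Construction of the jump measure\<close>

text \<open>The setwise infimum is the setwise limit. Countable additivity is monotone convergence
  from above, which needs the finite mass of the first measure.\<close>

lemma decseq_measure_limit:
  fixes \<kappa> :: "nat \<Rightarrow> 'a measure"
  assumes sets_\<kappa>: "\<And>n. sets (\<kappa> n) = sets N" and fin: "\<And>n. finite_measure (\<kappa> n)"
    and dec: "\<And>n A. A \<in> sets N \<Longrightarrow> emeasure (\<kappa> (Suc n)) A \<le> emeasure (\<kappa> n) A"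
  obtains \<nu> where "sets \<nu> = sets N" "finite_measure \<nu>"
    "\<And>A. A \<in> sets N \<Longrightarrow> emeasure \<nu> A = (INF n. emeasure (\<kappa> n) A)"
proof -
  define \<mu> where "\<mu> A = (INF n. emeasure (\<kappa> n) A)" for A
  define \<nu> where "\<nu> = measure_of (space N) (sets N) \<mu>"
  have fin': "emeasure (\<kappa> n) A < \<infinity>" for n A
  proof -
    interpret finite_measure "\<kappa> n" by (rule fin)
    show ?thesis by (simp add: emeasure_eq_measure)
  qed
  have emeasure_\<nu>: "emeasure \<nu> A = \<mu> A" if "A \<in> sets N" for A
  proof (rule emeasure_measure_of[OF \<nu>_def])
    show "sets N \<subseteq> Pow (space N)" by (rule sets.space_closed)
    show "A \<in> sets \<nu>" using that by (simp add: \<nu>_def)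
    show "positive (sets \<nu>) \<mu>"
      by (simp add: positive_def \<mu>_def)
    show "countably_additive (sets \<nu>) \<mu>"
    proof (rule countably_additiveI)
      fix B :: "nat \<Rightarrow> 'a set"
      assume B: "range B \<subseteq> sets \<nu>" "disjoint_family B"
      then have B_sets: "B i \<in> sets N" for i by (auto simp: \<nu>_def)
      have sum: "(\<Sum>i. emeasure (\<kappa> n) (B i)) = emeasure (\<kappa> n) (\<Union>i. B i)" for n
        using B B_sets by (intro suminf_emeasure) (auto simp: sets_\<kappa>)
      \<comment> \<open>Reading the series as an integral over the counting measure reduces the
        exchange of sum and infimum to a convergence theorem for integrals.\<close>
      have "(\<Sum>i. \<mu> (B i)) = (\<integral>\<^sup>+i. (INF n. emeasure (\<kappa> n) (B i)) \<partial>count_space UNIV)"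
        unfolding \<mu>_def by (rule nn_integral_count_space_nat[symmetric])
      also have "\<dots> = (INF n. \<integral>\<^sup>+i. emeasure (\<kappa> n) (B i) \<partial>count_space UNIV)"
      proof (rule nn_integral_monotone_convergence_INF_decseq)
        show "decseq (\<lambda>n i. emeasure (\<kappa> n) (B i))"
          by (rule decseq_SucI) (simp add: le_fun_def dec B_sets)
        show "(\<integral>\<^sup>+i. emeasure (\<kappa> 0) (B i) \<partial>count_space UNIV) < \<infinity>"
          unfolding nn_integral_count_space_nat sum by (rule fin')
      qed simp
      also have "\<dots> = \<mu> (\<Union>i. B i)"
        unfolding nn_integral_count_space_nat sum \<mu>_def ..
      finally show "(\<Sum>i. \<mu> (B i)) = \<mu> (\<Union>i. B i)" .
    qed
  qed
  have sets_\<nu>: "sets \<nu> = sets N"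
    by (simp add: \<nu>_def)
  have "finite_measure \<nu>"
  proof
    have "\<mu> (space N) \<le> emeasure (\<kappa> 0) (space N)"
      unfolding \<mu>_def by (rule INF_lower) simp
    also have "\<dots> < \<infinity>" by (rule fin')
    finally show "emeasure \<nu> (space \<nu>) \<noteq> \<infinity>"
      using sets_eq_imp_space_eq[OF sets_\<nu>] by (simp add: emeasure_\<nu>)
  qed
  with sets_\<nu> emeasure_\<nu> show thesis
    by (intro that) (auto simp: \<mu>_def)
qed

text \<open>The limit lies below every \<open>\<kappa> n\<close>, so for \<open>f\<close> between 0
  and 1 the integrals of \<open>f\<close> and of \<open>1 - f\<close> both decrease in passing to
  the limit. The gap for \<open>f\<close> is therefore at most the gap in total mass, which tends to
  0.\<close>

lemma integral_tendsto_decseq_measure: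
  fixes \<kappa> :: "nat \<Rightarrow> 'a measure" and h :: "'a \<Rightarrow> real"
  assumes sets_\<kappa>: "\<And>n. sets (\<kappa> n) = sets N" and fin: "\<And>n. finite_measure (\<kappa> n)"
    and dec: "\<And>n A. A \<in> sets N \<Longrightarrow> emeasure (\<kappa> (Suc n)) A \<le> emeasure (\<kappa> n) A"
    and sets_\<nu>: "sets \<nu> = sets N" and fin_\<nu>: "finite_measure \<nu>"
    and \<nu>: "\<And>A. A \<in> sets N \<Longrightarrow> emeasure \<nu> A = (INF n. emeasure (\<kappa> n) A)"
    and h: "h \<in> borel_measurable N" "\<And>x. \<bar>h x\<bar> \<le> 1"
  shows "(\<lambda>n. LINT x|\<kappa> n. h x) \<longlonglongrightarrow> (LINT x|\<nu>. h x)"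
proof -
  interpret \<kappa>: finite_measure "\<kappa> n" for n by (rule fin)
  interpret \<nu>: finite_measure \<nu> by (rule fin_\<nu>)
  have meas: "f \<in> borel_measurable (\<kappa> n)" "f \<in> borel_measurable \<nu>" if "f \<in> borel_measurable N" for f :: "'a \<Rightarrow> real" and n
    using that measurable_cong_sets[OF sets_\<kappa> refl] measurable_cong_sets[OF sets_\<nu> refl] by blast+
  have int: "integrable (\<kappa> n) f" "integrable \<nu> f" if "f \<in> borel_measurable N" "\<And>x. \<bar>f x\<bar> \<le> 1" for f :: "'a \<Rightarrow> real" and n
    by (rule \<kappa>.integrable_const_bound[where B = 1]; simp add: that meas)
       (rule \<nu>.integrable_const_bound[where B = 1]; simp add: that meas)
  have "\<nu> \<le> \<kappa> n" for n
    using sets_\<nu> sets_\<kappa>[of n] by (subst le_measure) (auto simp: \<nu> intro!: INF_lower)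
  then have mono: "(LINT x|\<nu>. f x) \<le> (LINT x|\<kappa> n. f x)"
    if f: "f \<in> borel_measurable N" "\<And>x. 0 \<le> f x" "\<And>x. f x \<le> 1" for f :: "'a \<Rightarrow> real" and n
  proof -
    have "ennreal (LINT x|\<nu>. f x) = (\<integral>\<^sup>+x. ennreal (f x) \<partial>\<nu>)"
      using f by (intro nn_integral_eq_integral[symmetric] int) auto
    also have "\<dots> \<le> (\<integral>\<^sup>+x. ennreal (f x) \<partial>\<kappa> n)"
      using \<open>\<nu> \<le> \<kappa> n\<close> by (intro nn_integral_mono_measure) (simp_all add: sets_\<nu> sets_\<kappa>)
    also have "\<dots> = ennreal (LINT x|\<kappa> n. f x)"
      using f by (intro nn_integral_eq_integral int) auto
    finally show ?thesis
      using f by (subst (asm) ennreal_le_iff) (auto intro!: integral_nonneg)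
  qed
  \<comment> \<open>An affine change of range from \<open>[-1, 1]\<close> to \<open>[0, 1]\<close>,
    undone at the end with the help of \<open>mass\<close>.\<close>
  define f where "f x = (1 + h x) / 2" for x
  have "f \<in> borel_measurable N"
    unfolding f_def[abs_def] using h(1) by measurable
  moreover have "0 \<le> f x" "f x \<le> 1" for x
    using h(2)[of x] by (auto simp: f_def abs_le_iff)
  ultimately have f: "f \<in> borel_measurable N" "0 \<le> f x" "f x \<le> 1" for x
    by blast+
  have spaces: "space (\<kappa> n) = space N" "space \<nu> = space N" for n
    using sets_eq_imp_space_eq sets_\<kappa> sets_\<nu> by blast+
  have mass: "(\<lambda>n. measure (\<kappa> n) (space N)) \<longlonglongrightarrow> measure \<nu> (space N)"
  proof -
    have "(\<lambda>n. emeasure (\<kappa> n) (space N)) \<longlonglongrightarrow> emeasure \<nu> (space N)"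
      unfolding \<nu>[OF sets.top] by (intro LIMSEQ_INF decseq_SucI dec) simp
    then show ?thesis
      unfolding \<nu>.emeasure_eq_measure \<kappa>.emeasure_eq_measure by (subst (asm) tendsto_ennreal_iff) auto
  qed
  have "(\<lambda>n. LINT x|\<kappa> n. f x) \<longlonglongrightarrow> (LINT x|\<nu>. f x)"
  proof (rule tendsto_sandwich)
    show "\<forall>\<^sub>F n in sequentially. (LINT x|\<nu>. f x) \<le> (LINT x|\<kappa> n. f x)"
      by (intro always_eventually allI mono f)
    show "\<forall>\<^sub>F n in sequentially. (LINT x|\<kappa> n. f x) \<le> measure (\<kappa> n) (space N) - measure \<nu> (space N) + (LINT x|\<nu>. f x)"
    proof (intro always_eventually allI)
      fix n
      have "(LINT x|\<nu>. 1 - f x) \<le> (LINT x|\<kappa> n. 1 - f x)"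
        using f by (intro mono) auto
      moreover have "integrable (\<kappa> n) f" "integrable \<nu> f"
        using f by (auto intro!: int simp: abs_le_iff intro: order_trans[of _ 0])
      ultimately show "(LINT x|\<kappa> n. f x) \<le> measure (\<kappa> n) (space N) - measure \<nu> (space N) + (LINT x|\<nu>. f x)"
        by (simp add: spaces)
    qed
    have "(\<lambda>n. measure (\<kappa> n) (space N) - measure \<nu> (space N) + (LINT x|\<nu>. f x)) \<longlonglongrightarrow>
        measure \<nu> (space N) - measure \<nu> (space N) + (LINT x|\<nu>. f x)"
      by (intro tendsto_intros mass)
    then show "(\<lambda>n. measure (\<kappa> n) (space N) - measure \<nu> (space N) + (LINT x|\<nu>. f x)) \<longlonglongrightarrow> (LINT x|\<nu>. f x)"
      by simp
  qed (rule tendsto_const)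
  then have "(\<lambda>n. 2 * (LINT x|\<kappa> n. f x) - measure (\<kappa> n) (space N)) \<longlonglongrightarrow> 2 * (LINT x|\<nu>. f x) - measure \<nu> (space N)"
    by (intro tendsto_intros mass)
  moreover have "2 * (LINT x|\<kappa> n. f x) - measure (\<kappa> n) (space N) = (LINT x|\<kappa> n. h x)" for n
    using int(1)[OF h] by (simp add: f_def[abs_def] spaces add_divide_distrib)
  moreover have "2 * (LINT x|\<nu>. f x) - measure \<nu> (space N) = (LINT x|\<nu>. h x)"
    using int(2)[OF h] by (simp add: f_def[abs_def] spaces add_divide_distrib)
  ultimately show ?thesis by simp
qed

section \<open>Characteristic functions and recovery of the exponent\<close>

context rc_levy_process
begin

definition char_fn :: "'a \<Rightarrow> real \<Rightarrow> complex" where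
  "char_fn \<xi> t = (CLINT \<omega>|M. iexp (\<xi> \<bullet> X t \<omega>))"

lemma integrable_iexp_process [simp]: "complex_integrable M (\<lambda>\<omega>. iexp (\<xi> \<bullet> X t \<omega>))"
  by (rule integrable_const_bound[where B = 1]) (auto intro: AE_I2)

lemma norm_char_fn: "norm (char_fn \<xi> t) \<le> 1"
proof -
  have "norm (char_fn \<xi> t) \<le> (LINT \<omega>|M. norm (iexp (\<xi> \<bullet> X t \<omega>)))"
    unfolding char_fn_def by (rule integral_norm_bound)
  then show ?thesis by (simp add: prob_space)
qed

lemma char_fn_0: "char_fn \<xi> 0 = 1"
proof -
  have "char_fn \<xi> 0 = (CLINT \<omega>|M. 1)"
    unfolding char_fn_def by (rule Bochner_Integration.integral_cong) (simp_all add: nonpos_time)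
  then show ?thesis by (simp add: prob_space)
qed

lemma char_fn_add:
  assumes "0 \<le> s" "0 \<le> u"
  shows "char_fn \<xi> (s + u) = char_fn \<xi> s * char_fn \<xi> u"
proof -
  define e where "e = (\<lambda>x::'a. iexp (\<xi> \<bullet> x))"
  have [measurable]: "e \<in> borel_measurable borel"
    unfolding e_def by measurable
  have int: "integrable M (\<lambda>\<omega>. e (Y \<omega>))" if [measurable]: "random_variable borel Y" for Y
    by (rule integrable_const_bound[where B = 1]) (auto intro: AE_I2 simp: e_def)
  have "indep_var borel (e \<circ> X s) borel (e \<circ> (\<lambda>\<omega>. X (s + u) \<omega> - X s \<omega>))"
    by (rule indep_var_compose[OF indep_var_increment[OF assms]]) measurable
  then have "(CLINT \<omega>|M. e (X s \<omega>) * e (X (s + u) \<omega> - X s \<omega>)) = (CLINT \<omega>|M. e (X s \<omega>)) * (CLINT \<omega>|M. e (X (s + u) \<omega> - X s \<omega>))"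
    unfolding comp_def by (rule indep_var_lebesgue_integral) (auto intro!: int)
  moreover have "e (X s \<omega>) * e (X (s + u) \<omega> - X s \<omega>) = e (X (s + u) \<omega>)" for \<omega>
    by (simp add: e_def inner_diff_right exp_add[symmetric] algebra_simps)
  moreover have "(CLINT \<omega>|M. e (X (s + u) \<omega> - X s \<omega>)) = (CLINT x|distr M borel (\<lambda>\<omega>. X (s + u) \<omega> - X s \<omega>). e x)"
    by (simp add: integral_distr)
  moreover have "\<dots> = (CLINT \<omega>|M. e (X u \<omega>))"
    unfolding stationary_increments[OF assms] by (simp add: integral_distr)
  ultimately show ?thesis
    by (simp add: char_fn_def e_def)
qed

lemma char_fn_power: "0 \<le> s \<Longrightarrow> char_fn \<xi> (real k * s) = char_fn \<xi> s ^ k"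
proof (induction k)
  case (Suc k)
  then have "char_fn \<xi> (s + real k * s) = char_fn \<xi> s * char_fn \<xi> (real k * s)"
    by (intro char_fn_add) auto
  then show ?case
    using Suc by (simp add: algebra_simps)
qed (simp add: char_fn_0)

text \<open>This is the derivative of \<open>exp (z * \<eta>)\<close> at \<open>z = 0\<close>, taken
  along the points \<open>t / 2 ^ n\<close>.\<close>

lemma exp_quotient_tendsto:
  fixes \<eta> :: complex
  assumes "t \<noteq> 0"
  shows "(\<lambda>n. of_real (2 ^ n / t) * (exp (of_real (t / 2 ^ n) * \<eta>) - 1)) \<longlonglongrightarrow> \<eta>"
proof -
  have "((\<lambda>z. exp (z * \<eta>)) has_field_derivative \<eta>) (at 0)"
    by (auto intro!: derivative_eq_intros)
  then have "((\<lambda>z. (exp (z * \<eta>) - 1) / z) \<longlongrightarrow> \<eta>) (at 0)"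
    by (simp add: DERIV_def)
  moreover have "filterlim (\<lambda>n. complex_of_real (t / 2 ^ n)) (at 0) sequentially"
  proof -
    have "(\<lambda>n. t * (1/2) ^ n) \<longlonglongrightarrow> t * 0"
      by (intro tendsto_intros LIMSEQ_realpow_zero) auto
    then have "(\<lambda>n. complex_of_real (t / 2 ^ n)) \<longlonglongrightarrow> of_real 0"
      by (intro tendsto_of_real) (simp add: power_one_over)
    then show ?thesis
      using assms by (simp add: filterlim_at)
  qed
  ultimately have "(\<lambda>n. (exp (complex_of_real (t / 2 ^ n) * \<eta>) - 1) / complex_of_real (t / 2 ^ n)) \<longlonglongrightarrow> \<eta>"
    by (rule filterlim_compose)
  then show ?thesis
    by (simp add: field_simps)
qed

text \<open>Difference quotients along a single dyadic sequence determine the whole semigroup: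
  \<open>k\<close>-th powers of numbers in the unit disc differ by at most \<open>k\<close> times
  the difference of the bases, the bases differ by \<open>o(s n)\<close>, and
  \<open>k n * s n\<close> tends to \<open>u\<close>.\<close>

lemma char_fn_eq_exp:
  assumes t: "0 < t" and u: "0 \<le> u"
    and lim: "(\<lambda>n. of_real (2 ^ n / t) * (char_fn \<xi> (t / 2 ^ n) - 1)) \<longlonglongrightarrow> \<eta>"
  shows "char_fn \<xi> u = exp (of_real u * \<eta>)"
proof -
  \<comment> \<open>Rounded so that \<open>k n * s n\<close> approaches \<open>u\<close> strictly
    from the right, the side on which the paths are continuous.\<close>
  define k where "k n = nat (\<lfloor>u / t * 2 ^ n\<rfloor> + 1)" for n :: nat
  define s where "s n = t / 2 ^ n" for n :: nat
  have s: "0 < s n" for n using t by (simp add: s_def)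
  have ks: "real (k n) * s n = t * (real_of_int (\<lfloor>u / t * 2 ^ n\<rfloor> + 1) / 2 ^ n)" for n
    using t u by (simp add: k_def s_def add_nonneg_nonneg)
  \<comment> \<open>This keeps \<open>exp (s n * \<eta>)\<close> in the closed unit disc, as the
    comparison of powers requires.\<close>
  have Re: "Re \<eta> \<le> 0"
  proof (rule tendsto_upperbound)
    show "(\<lambda>n. Re (of_real (2 ^ n / t) * (char_fn \<xi> (t / 2 ^ n) - 1))) \<longlonglongrightarrow> Re \<eta>"
      by (intro tendsto_Re lim)
    have "Re (char_fn \<xi> (t / 2 ^ n)) \<le> 1" for n
      using complex_Re_le_cmod[of "char_fn \<xi> (t / 2 ^ n)"] norm_char_fn[of \<xi> "t / 2 ^ n"] by linarith
    then show "\<forall>\<^sub>F n in sequentially. Re (of_real (2 ^ n / t) * (char_fn \<xi> (t / 2 ^ n) - 1)) \<le> 0"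
      using t by (intro always_eventually allI) (simp add: mult_le_0_iff divide_le_0_iff)
  qed simp
  have lim1: "(\<lambda>n. char_fn \<xi> (real (k n) * s n)) \<longlonglongrightarrow> char_fn \<xi> u"
    unfolding char_fn_def ks
  proof (rule integral_dominated_convergence[where w = "\<lambda>_. 1"])
    show "AE \<omega> in M. (\<lambda>n. iexp (\<xi> \<bullet> X (t * (real_of_int (\<lfloor>u / t * 2 ^ n\<rfloor> + 1) / 2 ^ n)) \<omega>)) \<longlonglongrightarrow> iexp (\<xi> \<bullet> X u \<omega>)"
      by (intro AE_I2 tendsto_intros tendsto_right_grid t)
  qed auto
  have lim_ks: "(\<lambda>n. real (k n) * s n) \<longlonglongrightarrow> u"
  proof -
    have "(\<lambda>n. t * (real_of_int (\<lfloor>u / t * 2 ^ n\<rfloor> + 1) / 2 ^ n)) \<longlonglongrightarrow> t * (u / t)"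
      using filterlim_dyadic_at_right[of "u / t"] by (intro tendsto_mult_left) (simp only: filterlim_at)
    then show ?thesis using t by (simp add: ks)
  qed
  have lim2: "(\<lambda>n. exp (of_real (real (k n) * s n) * \<eta>)) \<longlonglongrightarrow> exp (of_real u * \<eta>)"
    by (intro tendsto_intros lim_ks)
  \<comment> \<open>The difference of the two quotients, both of which tend to
    \<open>\<eta>\<close>; up to the factor \<open>s n\<close> it is the distance between the two
    bases.\<close>
  define d where "d n = norm (of_real (2 ^ n / t) * (char_fn \<xi> (s n) - 1) - of_real (2 ^ n / t) * (exp (of_real (s n) * \<eta>) - 1))" for n
  have "(\<lambda>n. of_real (2 ^ n / t) * (char_fn \<xi> (s n) - 1) - of_real (2 ^ n / t) * (exp (of_real (s n) * \<eta>) - 1)) \<longlonglongrightarrow> \<eta> - \<eta>"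
    using t unfolding s_def by (intro tendsto_diff lim exp_quotient_tendsto) simp
  then have "d \<longlonglongrightarrow> 0"
    unfolding d_def by (auto dest: tendsto_norm)
  then have lim_d: "(\<lambda>n. real (k n) * s n * d n) \<longlonglongrightarrow> u * 0"
    by (intro tendsto_mult lim_ks)
  have bound: "norm (char_fn \<xi> (real (k n) * s n) - exp (of_real (real (k n) * s n) * \<eta>)) \<le> real (k n) * s n * d n" for n
  proof -
    have "norm (exp (of_real (s n) * \<eta>)) \<le> 1"
      using Re s[of n] by (simp add: mult_le_0_iff)
    then have "norm (char_fn \<xi> (s n) ^ k n - exp (of_real (s n) * \<eta>) ^ k n) \<le> real (k n) * norm (char_fn \<xi> (s n) - exp (of_real (s n) * \<eta>))"
      by (intro norm_power_diff norm_char_fn)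
    also have "norm (char_fn \<xi> (s n) - exp (of_real (s n) * \<eta>)) = s n * d n"
    proof -
      have "d n = norm (of_real (2 ^ n / t) * (char_fn \<xi> (s n) - exp (of_real (s n) * \<eta>)))"
        unfolding d_def by (rule arg_cong[where f = norm]) (simp add: right_diff_distrib)
      also have "\<dots> = 2 ^ n / t * norm (char_fn \<xi> (s n) - exp (of_real (s n) * \<eta>))"
        using t by (simp add: norm_mult norm_divide norm_power)
      finally show ?thesis using t by (simp add: s_def)
    qed
    finally show ?thesis
      using s[of n] by (simp add: char_fn_power less_imp_le exp_of_nat_mult[symmetric] mult.assoc)
  qed
  have "(\<lambda>n. char_fn \<xi> (real (k n) * s n) - exp (of_real (real (k n) * s n) * \<eta>)) \<longlonglongrightarrow> 0"
    using lim_d by (intro Lim_null_comparison[OF always_eventually[OF allI[OF bound]]]) simp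
  moreover have "(\<lambda>n. char_fn \<xi> (real (k n) * s n) - exp (of_real (real (k n) * s n) * \<eta>)) \<longlonglongrightarrow> char_fn \<xi> u - exp (of_real u * \<eta>)"
    by (intro tendsto_diff lim1 lim2)
  ultimately show ?thesis
    using LIMSEQ_unique by fastforce
qed

end

text \<open>Taking \<open>n\<close> square roots of \<open>y 0\<close>. In exponential form this
  shows that \<open>1 - y n\<close> is of order \<open>1 / 2 ^ n\<close>.\<close>

lemma root_bound_of_le_square:
  fixes y :: "nat \<Rightarrow> real"
  assumes "\<And>n. y n \<le> (y (Suc n))\<^sup>2" "\<And>n. 0 \<le> y n" "exp (- c) \<le> y 0"
  shows "exp (- c / 2 ^ n) \<le> y n"
proof (induction n)
  case (Suc n)
  have "(exp (- c / 2 ^ Suc n))\<^sup>2 = exp (- c / 2 ^ n)"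
    by (simp add: power2_eq_square exp_add[symmetric])
  also have "\<dots> \<le> (y (Suc n))\<^sup>2"
    using Suc assms(1) by (rule order_trans)
  finally show ?case
    by (rule power2_le_imp_le) (rule assms)
qed (use assms in simp)

section \<open>The compound Poisson dichotomy through the atom at zero\<close>

context rc_levy_process
begin

text \<open>The rescaled laws off 0 have bounded mass and a setwise limit \<open>\<nu>\<close>. As
  \<open>iexp - 1\<close> is bounded it can be integrated against \<open>\<nu>\<close> without
  compensation, so the limit of \<open>2 ^ n / t * (char_fn - 1)\<close> is exactly this integral
  and leaves neither drift nor Gaussian term.\<close>

lemma compound_poisson_if_hit_zero:
  assumes lim: "(\<lambda>n. hit_zero ((1/2) ^ n)) \<longlonglongrightarrow> 1"
  shows "compound_poisson M X"
proof -
  \<comment> \<open>With \<open>3/4\<close> the numbers \<open>2 * hit_zero - 1\<close> exceed 1/2;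
    positivity is what the logarithm and the square roots below require.\<close>
  have "\<forall>\<^sub>F n in sequentially. 3/4 < hit_zero ((1/2) ^ n)"
    by (rule order_tendstoD[OF lim]) simp
  then obtain n0 where n0: "\<And>n. n0 \<le> n \<Longrightarrow> 3/4 < hit_zero ((1/2) ^ n)"
    by (auto simp: eventually_sequentially)
  define t where "t = (1/2::real) ^ n0"
  have t: "0 < t" by (simp add: t_def)
  define s where "s n = t / 2 ^ n" for n :: nat
  have s: "0 < s n" "2 * s (Suc n) = s n" for n
    using t by (simp_all add: s_def)
  have "s n = (1/2) ^ (n0 + n)" for n
    by (simp add: s_def t_def power_add power_one_over)
  then have p: "3/4 < hit_zero (s n)" for n
    using n0[of "n0 + n"] by simp
  \<comment> \<open>Chosen so that \<open>2 * hit_zero (s 0) - 1\<close> equals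
    \<open>exp (- c)\<close>, the start of the square-root iteration.\<close>
  define c where "c = - ln (2 * hit_zero (s 0) - 1)"
  have exp_c: "exp (- c) = 2 * hit_zero (s 0) - 1"
    using p[of 0] by (simp add: c_def)
  have "exp (- c / 2 ^ n) \<le> 2 * hit_zero (s n) - 1" for n
  proof (rule root_bound_of_le_square)
    fix n
    have "2 * hit_zero (s n) - 1 \<le> 2 * ((hit_zero (s (Suc n)))\<^sup>2 + (1 - hit_zero (s (Suc n)))\<^sup>2) - 1"
      using hit_zero_double[of "s (Suc n)"] s(1)[of "Suc n"] by (simp only: s(2)) simp
    also have "\<dots> = (2 * hit_zero (s (Suc n)) - 1)\<^sup>2"
      by (simp add: power2_eq_square algebra_simps)
    finally show "2 * hit_zero (s n) - 1 \<le> (2 * hit_zero (s (Suc n)) - 1)\<^sup>2" .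
    show "0 \<le> 2 * hit_zero (s n) - 1"
      using p[of n] by simp
  qed (simp add: exp_c)
  then have exp_le: "exp (- c / 2 ^ n) \<le> hit_zero (s n)" for n
    using hit_zero_le_1[of "s n"] by (smt (verit))
  \<comment> \<open>The factor \<open>exp (c / 2\<^sup>n) \<rightarrow> 1\<close> turns the convergent sequence of measures into a decreasing one.\<close>
  define w where "w n = 2 ^ n / t * exp (c / 2 ^ n)" for n :: nat
  have w: "0 < w n" for n using t by (simp add: w_def)
  \<comment> \<open>The atom at 0 is removed, since it is the part that blows up under rescaling.
    The integrand \<open>iexp - 1\<close> vanishes there, so no integral below changes.\<close>
  define \<kappa> where "\<kappa> n = density (distr M borel (X (s n))) (\<lambda>z. ennreal (w n * indicator (- {0}) z))" for n
  have sets_\<kappa>: "sets (\<kappa> n) = sets borel" for n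
    by (simp add: \<kappa>_def)
  have \<kappa>: "emeasure (\<kappa> n) A = ennreal (w n) * emeasure (distr M borel (X (s n))) (A - {0})" if [measurable]: "A \<in> sets borel" for n A
  proof -
    have "emeasure (\<kappa> n) A = (\<integral>\<^sup>+z. ennreal (w n * indicator (- {0}) z) * indicator A z \<partial>distr M borel (X (s n)))"
      unfolding \<kappa>_def by (rule emeasure_density) simp_all
    also have "\<dots> = (\<integral>\<^sup>+z. ennreal (w n) * indicator (A - {0}) z \<partial>distr M borel (X (s n)))"
      by (intro nn_integral_cong) (auto simp: indicator_def)
    also have "\<dots> = ennreal (w n) * emeasure (distr M borel (X (s n))) (A - {0})"
      by (rule nn_integral_cmult_indicator) simp
    finally show ?thesis .
  qed
  have fin: "finite_measure (\<kappa> n)" for n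
  proof
    interpret D: prob_space "distr M borel (X (s n))" by (rule prob_space_distr) measurable
    show "emeasure (\<kappa> n) (space (\<kappa> n)) \<noteq> \<infinity>"
      using D.emeasure_eq_measure by (simp add: sets_eq_imp_space_eq[OF sets_\<kappa>] \<kappa> ennreal_mult_eq_top_iff)
  qed
  have dec: "emeasure (\<kappa> (Suc n)) A \<le> emeasure (\<kappa> n) A" if A [measurable]: "A \<in> sets borel" for n A
  proof -
    define E where "E = emeasure (distr M borel (X (s (Suc n)))) (A - {0})"
    \<comment> \<open>One step doubles the weight and multiplies it by
      \<open>exp (- c / 2 ^ Suc n)\<close>, which is at most \<open>hit_zero (s (Suc n))\<close>;
      the product is then controlled by \<open>double_hit_zero_le\<close>.\<close>
    have w_Suc: "w (Suc n) = w n * 2 * exp (- c / 2 ^ Suc n)"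
    proof -
      have "c / 2 ^ n + - c / 2 ^ Suc n = c / 2 ^ Suc n" by (simp add: field_simps)
      then have "exp (c / 2 ^ n) * exp (- c / 2 ^ Suc n) = exp (c / 2 ^ Suc n)"
        by (simp only: exp_add[symmetric])
      then show ?thesis by (simp add: w_def)
    qed
    have "ennreal (w (Suc n)) * E \<le> ennreal (w n * (2 * hit_zero (s (Suc n)))) * E"
      unfolding w_Suc using w[of n] exp_le[of "Suc n"] by (intro mult_right_mono ennreal_leI) simp_all
    also have "\<dots> = ennreal (w n) * (2 * ennreal (hit_zero (s (Suc n))) * E)"
      using w[of n] by (simp add: ennreal_mult hit_zero_nonneg mult.assoc)
    also have "\<dots> \<le> ennreal (w n) * emeasure (distr M borel (X (2 * s (Suc n)))) (A - {0})"
      unfolding E_def using s(1)[of "Suc n"] by (intro mult_left_mono double_hit_zero_le) simp_all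
    finally show ?thesis
      unfolding s(2) \<kappa>[OF A] E_def .
  qed
  obtain \<nu> where \<nu>: "sets \<nu> = sets (borel :: 'a measure)" "finite_measure \<nu>"
    "\<And>A. A \<in> sets borel \<Longrightarrow> emeasure \<nu> A = (INF n. emeasure (\<kappa> n) A)"
    using decseq_measure_limit[of \<kappa> borel, OF sets_\<kappa> fin dec] by blast
  interpret \<nu>: finite_measure \<nu> by (rule \<nu>)
  define \<eta> where "\<eta> \<xi> = (CLINT z|\<nu>. iexp (\<xi> \<bullet> z) - 1)" for \<xi>
  have "char_fn \<xi> u = exp (of_real u * \<eta> \<xi>)" if u: "0 \<le> u" for \<xi> u
  proof (rule char_fn_eq_exp[OF t u])
    have int: "complex_integrable N (\<lambda>z. iexp (\<xi> \<bullet> z) - 1)" if "finite_measure N" "sets N = sets borel" for N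
    proof -
      interpret finite_measure N by fact
      have [measurable_cong]: "sets N = sets borel" by fact
      show ?thesis
        by (rule integrable_const_bound[where B = 2])
          (auto intro!: AE_I2 order_trans[OF norm_triangle_ineq4])
    qed
    have lim_\<kappa>: "(\<lambda>n. CLINT z|\<kappa> n. iexp (\<xi> \<bullet> z) - 1) \<longlonglongrightarrow> \<eta> \<xi>"
      unfolding tendsto_complex_iff
    proof
      \<comment> \<open>The division by 2 brings \<open>cos - 1\<close> into the range allowed by
        \<open>integral_tendsto_decseq_measure\<close>.\<close>
      have Re: "(\<lambda>n. LINT z|\<kappa> n. (cos (\<xi> \<bullet> z) - 1) / 2) \<longlonglongrightarrow> (LINT z|\<nu>. (cos (\<xi> \<bullet> z) - 1) / 2)"
        by (rule integral_tendsto_decseq_measure[OF sets_\<kappa> fin dec \<nu>])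
          (auto simp: abs_le_iff cos_ge_minus_one cos_le_one intro: order_trans[OF cos_le_one])
      then have "(\<lambda>n. 2 * (LINT z|\<kappa> n. (cos (\<xi> \<bullet> z) - 1) / 2)) \<longlonglongrightarrow> 2 * (LINT z|\<nu>. (cos (\<xi> \<bullet> z) - 1) / 2)"
        by (rule tendsto_mult_left)
      moreover have "Re (CLINT z|N. iexp (\<xi> \<bullet> z) - 1) = 2 * (LINT z|N. (cos (\<xi> \<bullet> z) - 1) / 2)" if "finite_measure N" "sets N = sets borel" for N
        using int[OF that] by (simp add: Re_exp flip: integral_Re)
      ultimately show "(\<lambda>n. Re (CLINT z|\<kappa> n. iexp (\<xi> \<bullet> z) - 1)) \<longlonglongrightarrow> Re (\<eta> \<xi>)"
        unfolding \<eta>_def using fin sets_\<kappa> \<nu>(1,2) by (simp only:)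
      have Im: "(\<lambda>n. LINT z|\<kappa> n. sin (\<xi> \<bullet> z)) \<longlonglongrightarrow> (LINT z|\<nu>. sin (\<xi> \<bullet> z))"
        by (rule integral_tendsto_decseq_measure[OF sets_\<kappa> fin dec \<nu>]) auto
      moreover have "Im (CLINT z|N. iexp (\<xi> \<bullet> z) - 1) = (LINT z|N. sin (\<xi> \<bullet> z))" if "finite_measure N" "sets N = sets borel" for N
        using int[OF that] by (simp add: Im_exp flip: integral_Im)
      ultimately show "(\<lambda>n. Im (CLINT z|\<kappa> n. iexp (\<xi> \<bullet> z) - 1)) \<longlonglongrightarrow> Im (\<eta> \<xi>)"
        unfolding \<eta>_def using fin sets_\<kappa> \<nu>(1,2) by (simp only:)
    qed
    have \<kappa>_int: "(CLINT z|\<kappa> n. iexp (\<xi> \<bullet> z) - 1) = of_real (w n) * (char_fn \<xi> (s n) - 1)" for n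
    proof -
      have "(CLINT z|\<kappa> n. iexp (\<xi> \<bullet> z) - 1) = (CLINT z|distr M borel (X (s n)). (w n * indicator (- {0}) z) *\<^sub>R (iexp (\<xi> \<bullet> z) - 1))"
        unfolding \<kappa>_def using w[of n] by (intro integral_density) auto
      also have "\<dots> = (CLINT z|distr M borel (X (s n)). of_real (w n) * (iexp (\<xi> \<bullet> z) - 1))"
        by (intro Bochner_Integration.integral_cong) (auto simp: indicator_def scaleR_conv_of_real)
      also have "\<dots> = (CLINT \<omega>|M. of_real (w n) * (iexp (\<xi> \<bullet> X (s n) \<omega>) - 1))"
        by (rule integral_distr) simp_all
      also have "\<dots> = of_real (w n) * (char_fn \<xi> (s n) - 1)"
        unfolding char_fn_def by (simp add: prob_space)
      finally show ?thesis .
    qed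
    \<comment> \<open>The correction in \<open>w\<close> is removed again: the factor tends to 1 and
      restores the plain weight \<open>2 ^ n / t\<close>.\<close>
    have "(\<lambda>n. complex_of_real (exp (- c * (1/2) ^ n)) * (CLINT z|\<kappa> n. iexp (\<xi> \<bullet> z) - 1)) \<longlonglongrightarrow> of_real (exp (- c * 0)) * \<eta> \<xi>"
      by (intro tendsto_intros lim_\<kappa> LIMSEQ_realpow_zero) auto
    moreover have "complex_of_real (exp (- c * (1/2) ^ n)) * (CLINT z|\<kappa> n. iexp (\<xi> \<bullet> z) - 1) = of_real (2 ^ n / t) * (char_fn \<xi> (t / 2 ^ n) - 1)" for n
    proof -
      have "exp (- c * (1/2) ^ n) * w n = 2 ^ n / t"
        by (simp add: w_def power_one_over exp_minus field_simps)
      then show ?thesis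
        unfolding \<kappa>_int s_def by (simp only: mult.assoc[symmetric] of_real_mult[symmetric])
    qed
    ultimately show "(\<lambda>n. of_real (2 ^ n / t) * (char_fn \<xi> (t / 2 ^ n) - 1)) \<longlonglongrightarrow> \<eta> \<xi>"
      by simp
  qed
  then have "has_levy_exponent M X (\<lambda>\<xi>. - (CLINT z|\<nu>. iexp (\<xi> \<bullet> z) - 1))"
    unfolding has_levy_exponent_def \<eta>_def char_fn_def by simp
  moreover have "emeasure \<nu> {0} = 0"
    by (simp add: \<nu>(3) \<kappa>)
  ultimately show ?thesis
    unfolding compound_poisson_def using \<nu>(1,2) levy_process_axioms by blast
qed

text \<open>If the integral were positive on some window of integer length,
  \<open>hit_zero_tendsto_1\<close> would make the process compound Poisson; countably many windows
  exhaust the half-line.\<close>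

lemma AE_hit_zero_eq_0:
  assumes "\<not> compound_poisson M X"
  shows "AE u in lborel. 0 \<le> u \<longrightarrow> hit_zero u = 0"
proof -
  have null: "AE u in lborel. ennreal (hit_zero u) * indicator {0..real (Suc n)} u = 0" for n
  proof (rule ccontr)
    assume "\<not> (AE u in lborel. ennreal (hit_zero u) * indicator {0..real (Suc n)} u = 0)"
    then have "(\<integral>\<^sup>+u\<in>{0..real (Suc n)}. ennreal (hit_zero u) \<partial>lborel) \<noteq> 0"
      by (subst nn_integral_0_iff_AE) simp_all
    then have "(\<lambda>n. hit_zero ((1/2) ^ n)) \<longlonglongrightarrow> 1"
      by (intro hit_zero_tendsto_1[of "real (Suc n)"]) (simp_all add: zero_less_iff_neq_zero)
    then show False
      using assms compound_poisson_if_hit_zero by blast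
  qed
  have "AE u in lborel. \<forall>n. ennreal (hit_zero u) * indicator {0..real (Suc n)} u = 0"
    unfolding AE_all_countable using null by blast
  then show ?thesis
  proof eventually_elim
    case (elim u)
    show ?case
    proof
      assume "0 \<le> u"
      obtain n where "u \<le> real n" using real_arch_simple by blast
      then have "ennreal (hit_zero u) = 0"
        using elim[rule_format, of n] \<open>0 \<le> u\<close> by (simp add: indicator_def split: if_splits)
      then show "hit_zero u = 0"
        using hit_zero_nonneg[of u] by (simp add: ennreal_eq_0_iff)
    qed
  qed
qed

text \<open>The bound on \<open>q\<close> removes the dependence on \<open>x\<close> and leaves the
  discounted time \<open>G r\<close> spent near 0. As \<open>r\<close> shrinks, the balls shrink to
  the point 0, so the limit is the discounted integral of \<open>hit_zero\<close>, which vanishes.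
  Monotonicity in \<open>r\<close> passes from the sequence of radii to all small
  \<open>r\<close>.\<close>

lemma bounded_borel_subset_kato_space:
  assumes "\<not> compound_poisson M X"
  shows "bounded_borel \<subseteq> kato_space M X"
proof
  fix q :: "'a \<Rightarrow> real"
  assume "q \<in> bounded_borel"
  then have q: "q \<in> borel_measurable borel" and "bounded (range q)"
    by (auto simp: bounded_borel_def)
  then obtain c where c: "0 < c" "\<And>z. \<bar>q z\<bar> \<le> c"
    by (auto simp: bounded_pos)
  have [measurable]: "ball (0::'a) r \<in> sets borel" for r by simp
  define p where "p r u = (\<integral>\<^sup>+\<omega>. indicator (ball 0 r) (X u \<omega>) \<partial>M)" for r u
  have p_meas [measurable]: "p r \<in> borel_measurable borel" for r
    unfolding p_def by measurable
  define G where "G r = (\<integral>\<^sup>+u\<in>{0..}. ennreal (exp (- u)) * p r u \<partial>lborel)" for r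
  have G_mono: "G r \<le> G r'" if "r \<le> r'" for r r'
    unfolding G_def p_def using that
    by (intro nn_integral_mono mult_right_mono mult_left_mono) (auto simp: indicator_def)
  have p_lim: "(\<lambda>n. p (inverse (real (Suc n))) u) \<longlonglongrightarrow> ennreal (hit_zero u)" for u
    unfolding p_def nn_integral_hit_zero[symmetric]
  proof (rule nn_integral_dominated_convergence[where w = "\<lambda>_. 1"])
    have "decseq (\<lambda>n. ball (0::'a) (inverse (real (Suc n))))"
      by (rule decseq_SucI, rule subset_ball) (simp add: field_simps)
    moreover have "(\<Inter>n. ball (0::'a) (inverse (real (Suc n)))) = {0}"
    proof (intro equalityI subsetI)
      fix z :: 'a assume z: "z \<in> (\<Inter>n. ball 0 (inverse (real (Suc n))))"
      show "z \<in> {0}"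
      proof (rule ccontr)
        assume "z \<notin> {0}"
        then obtain n where "inverse (real (Suc n)) < norm z"
          using reals_Archimedean[of "norm z"] by auto
        moreover have "norm z < inverse (real (Suc n))" using z by auto
        ultimately show False by simp
      qed
    qed auto
    ultimately show "AE \<omega> in M. (\<lambda>n. indicator (ball 0 (inverse (real (Suc n)))) (X u \<omega>)) \<longlonglongrightarrow> (indicator {0} (X u \<omega>) :: ennreal)"
      using LIMSEQ_indicator_decseq[of "\<lambda>n. ball (0::'a) (inverse (real (Suc n)))"] by (intro AE_I2) simp
  qed (auto simp: emeasure_space_1 indicator_def)
  have "(\<lambda>n. G (inverse (real (Suc n)))) \<longlonglongrightarrow> (\<integral>\<^sup>+u. 0 \<partial>(lborel :: real measure))"
    unfolding G_def
  proof (rule nn_integral_dominated_convergence[where w = "\<lambda>u. ennreal (exp (- u)) * indicator {0..} u"])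
    have "(\<integral>\<^sup>+u. ennreal (exp (- u)) * indicator {0..} u \<partial>lborel) = 1"
      using nn_intergal_power_times_exp_Ici[of 0] by simp
    then show "(\<integral>\<^sup>+u. ennreal (exp (- u)) * indicator {0..} u \<partial>lborel) < \<infinity>"
      by simp
    have "p r u \<le> (\<integral>\<^sup>+\<omega>. 1 \<partial>M)" for r u
      unfolding p_def by (intro nn_integral_mono) (simp add: indicator_def)
    then have "p r u \<le> 1" for r u by (simp add: emeasure_space_1)
    then have "ennreal (exp (- u)) * p r u * indicator {0..} u \<le> ennreal (exp (- u)) * 1 * indicator {0..} u" for r u
      by (intro mult_right_mono mult_left_mono) auto
    then show "AE u in lborel. ennreal (exp (- u)) * p (inverse (real (Suc n))) u * indicator {0..} u \<le> ennreal (exp (- u)) * indicator {0..} u" for n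
      by simp
    show "AE u in lborel. (\<lambda>n. ennreal (exp (- u)) * p (inverse (real (Suc n))) u * indicator {0..} u) \<longlonglongrightarrow> 0"
      using AE_hit_zero_eq_0[OF assms]
    proof eventually_elim
      case (elim u)
      show ?case
      proof (cases "0 \<le> u")
        case True
        then have "(\<lambda>n. ennreal (exp (- u)) * p (inverse (real (Suc n))) u) \<longlonglongrightarrow> ennreal (exp (- u)) * 0"
          using p_lim[of u] elim by (intro ennreal_tendsto_cmult) simp_all
        then show ?thesis using True by simp
      qed simp
    qed
  qed measurable
  then have G_lim: "(\<lambda>n. G (inverse (real (Suc n)))) \<longlonglongrightarrow> 0" by simp
  have le: "local_resolvent 1 (\<lambda>z. ennreal \<bar>q z\<bar>) r x \<le> ennreal c * G r" for r x
  proof -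
    have "local_resolvent 1 (\<lambda>z. ennreal \<bar>q z\<bar>) r x \<le> (\<integral>\<^sup>+u. ennreal c * (ennreal (exp (- u)) * p r u * indicator {0..} u) \<partial>lborel)"
      unfolding local_resolvent_def
    proof (rule nn_integral_mono)
      fix u
      have "(\<integral>\<^sup>+\<omega>. indicator (ball 0 r) (X u \<omega>) * ennreal \<bar>q (x + X u \<omega>)\<bar> \<partial>M) \<le> (\<integral>\<^sup>+\<omega>. indicator (ball 0 r) (X u \<omega>) * ennreal c \<partial>M)"
        by (intro nn_integral_mono mult_left_mono ennreal_leI c) simp
      also have "\<dots> = p r u * ennreal c"
        unfolding p_def by (rule nn_integral_multc) measurable
      finally have "ennreal (exp (- u)) * (\<integral>\<^sup>+\<omega>. indicator (ball 0 r) (X u \<omega>) * ennreal \<bar>q (x + X u \<omega>)\<bar> \<partial>M) * indicator {0..} u \<le>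
          ennreal (exp (- u)) * (p r u * ennreal c) * indicator {0..} u"
        by (intro mult_right_mono mult_left_mono) auto
      then show "ennreal (exp (- 1 * u)) * (\<integral>\<^sup>+\<omega>. indicator (ball 0 r) (X u \<omega>) * ennreal \<bar>q (x + X u \<omega>)\<bar> \<partial>M) * indicator {0..} u \<le>
          ennreal c * (ennreal (exp (- u)) * p r u * indicator {0..} u)"
        by (simp add: ac_simps)
    qed
    also have "\<dots> = ennreal c * G r"
      unfolding G_def by (rule nn_integral_cmult) measurable
    finally show ?thesis .
  qed
  have "((\<lambda>r. SUP x. local_resolvent 1 (\<lambda>z. ennreal \<bar>q z\<bar>) r x) \<longlongrightarrow> 0) (at_right 0)"
  proof (rule order_tendstoI)
    fix a :: ennreal assume "0 < a"
    have "(\<lambda>n. ennreal c * G (inverse (real (Suc n)))) \<longlonglongrightarrow> ennreal c * 0"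
      by (intro ennreal_tendsto_cmult G_lim) simp
    then have "\<forall>\<^sub>F n in sequentially. ennreal c * G (inverse (real (Suc n))) < a"
      by (rule order_tendstoD) (use \<open>0 < a\<close> in simp)
    then obtain n where n: "ennreal c * G (inverse (real (Suc n))) < a"
      by (meson eventually_happens' sequentially_bot)
    have "\<forall>\<^sub>F r in at_right 0. r \<in> {0<..<inverse (real (Suc n))}"
      by (rule eventually_at_right_real) simp
    then show "\<forall>\<^sub>F r in at_right 0. (SUP x. local_resolvent 1 (\<lambda>z. ennreal \<bar>q z\<bar>) r x) < a"
    proof eventually_elim
      case (elim r)
      have "(SUP x. local_resolvent 1 (\<lambda>z. ennreal \<bar>q z\<bar>) r x) \<le> ennreal c * G r"
        by (intro SUP_least le)
      also have "\<dots> \<le> ennreal c * G (inverse (real (Suc n)))"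
        using elim by (intro mult_left_mono G_mono) auto
      finally show ?case using n by (rule le_less_trans)
    qed
  qed simp
  then have "\<exists>\<alpha>>0. ((\<lambda>r. SUP x. local_resolvent \<alpha> (\<lambda>z. ennreal \<bar>q z\<bar>) r x) \<longlongrightarrow> 0) (at_right 0)"
    using zero_less_one by blast
  with q show "q \<in> kato_space M X"
    by (simp add: kato_space_eq)
qed

end

subsection \<open>Compound Poisson processes\<close>

text \<open>For \<open>y\<close> other than 1 the geometric sums stay bounded by
  \<open>2 / norm (y - 1)\<close>, so dividing by \<open>n\<close> kills them.\<close>

lemma cesaro_mean_powers_tendsto:
  fixes y :: complex
  assumes "norm y \<le> 1"
  shows "(\<lambda>n. (\<Sum>k<n. y ^ k) / of_nat n) \<longlonglongrightarrow> indicator {1} y"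
proof (cases "y = 1")
  case True
  have "\<forall>\<^sub>F n in sequentially. (\<Sum>k<n. y ^ k) / of_nat n = 1"
    using eventually_gt_at_top[of 0] by eventually_elim (simp add: True)
  then show ?thesis
    using True by (simp add: tendsto_eventually)
next
  case False
  have bound: "norm ((\<Sum>k<n. y ^ k) / of_nat n) \<le> 2 / norm (y - 1) * inverse (real n)" for n
  proof -
    have "norm (y ^ n - 1) \<le> norm (y ^ n) + norm (1::complex)"
      by (rule norm_triangle_ineq4)
    also have "\<dots> \<le> 2"
      using assms by (simp add: norm_power power_le_one)
    finally have "norm ((y ^ n - 1) / (y - 1)) \<le> 2 / norm (y - 1)"
      by (simp add: norm_divide divide_right_mono)
    then have "norm (\<Sum>k<n. y ^ k) * inverse (real n) \<le> 2 / norm (y - 1) * inverse (real n)"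
      unfolding geometric_sum[OF False] by (intro mult_right_mono) auto
    then show ?thesis
      by (simp add: divide_inverse norm_mult norm_inverse)
  qed
  have "(\<lambda>n. 2 / norm (y - 1) * inverse (real n)) \<longlonglongrightarrow> 2 / norm (y - 1) * 0"
    by (intro tendsto_mult_left lim_inverse_n)
  then show ?thesis
    using False by (intro Lim_null_comparison[OF always_eventually[OF allI[OF bound]], THEN tendsto_eq_rhs]) simp_all
qed

text \<open>The exceptional \<open>v\<close> lie on the hyperplanes where the inner product with
  \<open>z\<close> is a multiple of \<open>2 * pi\<close>: countably many null sets.\<close>

lemma AE_iexp_inner_neq_1:
  fixes z :: "'a::euclidean_space"
  assumes "z \<noteq> 0"
  shows "AE v in lborel. iexp (v \<bullet> z) \<noteq> 1"
proof -
  have "AE v in lborel. v \<bullet> z \<noteq> of_int (2 * m) * pi" for m :: int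
  proof -
    have "negligible {v. z \<bullet> v = of_int (2 * m) * pi}"
      by (rule negligible_hyperplane) (use assms in simp)
    moreover have "{v \<in> space lborel. z \<bullet> v = of_int (2 * m) * pi} \<in> sets lborel"
      by measurable
    ultimately have "{v. z \<bullet> v = of_int (2 * m) * pi} \<in> null_sets lborel"
      by (simp add: negligible_iff_null_sets null_sets_completion_iff)
    then have "AE v in lborel. v \<notin> {v. z \<bullet> v = of_int (2 * m) * pi}"
      by (rule AE_not_in)
    then show ?thesis
      by (simp add: inner_commute)
  qed
  then have "AE v in lborel. \<forall>m::int. v \<bullet> z \<noteq> of_int (2 * m) * pi"
    unfolding AE_all_countable by blast
  then show ?thesis
    by eventually_elim (simp add: exp_eq_1)
qed

context rc_levy_process
begin

text \<open>A Wiener-type averaging: means of \<open>char_fn\<close> along the multiples of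
  \<open>v\<close> pick out the event \<open>iexp (v \<bullet> X u \<omega>) = 1\<close>, and the
  lower bound holds for each term, hence for the limit.\<close>

lemma hit_zero_ge_if_char_fn_ge:
  assumes "\<And>\<xi>. a \<le> Re (char_fn \<xi> u)"
  shows "a \<le> hit_zero u"
proof -
  interpret P: pair_sigma_finite "lborel :: 'a measure" M ..
  have [measurable]: "{1::complex} \<in> sets borel" by simp
  have "AE \<omega> in M. AE v in lborel. X u \<omega> \<noteq> 0 \<longrightarrow> iexp (v \<bullet> X u \<omega>) \<noteq> 1"
  proof (rule AE_I2)
    fix \<omega>
    show "AE v in lborel. X u \<omega> \<noteq> 0 \<longrightarrow> iexp (v \<bullet> X u \<omega>) \<noteq> 1"
      using AE_iexp_inner_neq_1[of "X u \<omega>"] by (cases "X u \<omega> = 0") simp_all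
  qed
  \<comment> \<open>Fubini swaps the quantifiers, so one \<open>v\<close> works for almost every
    \<open>\<omega>\<close>; it exists because Lebesgue measure is not zero.\<close>
  then have "AE v in (lborel :: 'a measure). AE \<omega> in M. X u \<omega> \<noteq> 0 \<longrightarrow> iexp (v \<bullet> X u \<omega>) \<noteq> 1"
    by (subst P.AE_commute) measurable
  then obtain v :: 'a where v: "AE \<omega> in M. X u \<omega> \<noteq> 0 \<longrightarrow> iexp (v \<bullet> X u \<omega>) \<noteq> 1"
    using eventually_happens'[of "ae_filter lborel"] by (fastforce simp: ae_filter_eq_bot_iff)
  define y where "y \<omega> = iexp (v \<bullet> X u \<omega>)" for \<omega>
  have [measurable]: "y \<in> borel_measurable M"
    unfolding y_def by measurable
  have norm_y: "norm (y \<omega>) = 1" for \<omega>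
    by (simp add: y_def)
  have mean: "(CLINT \<omega>|M. (\<Sum>k<n. y \<omega> ^ k) / of_nat n) = (\<Sum>k<n. char_fn (real k *\<^sub>R v) u) / of_nat n" for n
  proof -
    have y_pow: "y \<omega> ^ k = iexp ((real k *\<^sub>R v) \<bullet> X u \<omega>)" for \<omega> k
      by (simp add: y_def exp_of_nat_mult[symmetric] algebra_simps)
    have "(CLINT \<omega>|M. (\<Sum>k<n. iexp ((real k *\<^sub>R v) \<bullet> X u \<omega>))) = (\<Sum>k<n. char_fn (real k *\<^sub>R v) u)"
      unfolding char_fn_def by (rule Bochner_Integration.integral_sum) (rule integrable_iexp_process)
    then show ?thesis
      unfolding y_pow by (simp only: integral_divide_zero)
  qed
  have "(\<lambda>n. CLINT \<omega>|M. (\<Sum>k<n. y \<omega> ^ k) / of_nat n) \<longlonglongrightarrow> (CLINT \<omega>|M. indicator {1} (y \<omega>))"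
  proof (rule integral_dominated_convergence[where w = "\<lambda>_. 1"])
    show "AE \<omega> in M. (\<lambda>n. (\<Sum>k<n. y \<omega> ^ k) / of_nat n) \<longlonglongrightarrow> indicator {1} (y \<omega>)"
      by (intro AE_I2 cesaro_mean_powers_tendsto) (simp add: norm_y)
    show "AE \<omega> in M. norm ((\<Sum>k<n. y \<omega> ^ k) / of_nat n) \<le> 1" for n
    proof (intro AE_I2)
      fix \<omega>
      have "norm (\<Sum>k<n. y \<omega> ^ k) \<le> (\<Sum>k<n. norm (y \<omega> ^ k))"
        by (rule norm_sum)
      then show "norm ((\<Sum>k<n. y \<omega> ^ k) / of_nat n) \<le> 1"
        by (cases "n = 0") (simp_all add: norm_power norm_y norm_divide)
    qed
  qed measurable
  then have lim: "(\<lambda>n. Re ((\<Sum>k<n. char_fn (real k *\<^sub>R v) u) / of_nat n)) \<longlonglongrightarrow> Re (CLINT \<omega>|M. indicator {1} (y \<omega>))"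
    unfolding mean by (rule tendsto_Re)
  have "a \<le> Re (CLINT \<omega>|M. indicator {1} (y \<omega>))"
  proof (rule tendsto_lowerbound[OF lim])
    show "\<forall>\<^sub>F n in sequentially. a \<le> Re ((\<Sum>k<n. char_fn (real k *\<^sub>R v) u) / of_nat n)"
      using eventually_gt_at_top[of 0]
    proof eventually_elim
      case (elim n)
      have "(\<Sum>k<n. a) \<le> (\<Sum>k<n. Re (char_fn (real k *\<^sub>R v) u))"
        by (intro sum_mono assms)
      then show ?case
        using elim by (simp add: Re_divide_of_nat field_simps)
    qed
  qed simp
  also have "(CLINT \<omega>|M. indicator {1} (y \<omega>)) = (CLINT \<omega>|M. indicator {\<omega> \<in> space M. X u \<omega> = 0} \<omega>)"
  proof (rule integral_cong_AE)
    show "AE \<omega> in M. (indicator {1} (y \<omega>) :: complex) = indicator {\<omega> \<in> space M. X u \<omega> = 0} \<omega>"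
      using v AE_space by eventually_elim (auto simp: y_def indicator_def)
  qed measurable
  also have "\<dots> = (CLINT \<omega>|M. complex_of_real (indicator {\<omega> \<in> space M. X u \<omega> = 0} \<omega>))"
    by (intro Bochner_Integration.integral_cong) (auto simp: indicator_def)
  also have "\<dots> = complex_of_real (LINT \<omega>|M. indicator {\<omega> \<in> space M. X u \<omega> = 0} \<omega>)"
    by (rule integral_complex_of_real)
  also have "Re \<dots> = hit_zero u"
    by (simp add: hit_zero_def)
  finally show ?thesis .
qed

text \<open>The exponent is bounded by twice the mass of \<open>\<nu>\<close>, uniformly in the
  frequency. So for small \<open>u\<close> the characteristic function is \<open>exp z\<close> with
  \<open>norm z \<le> 1\<close>, whose real part is at least \<open>exp (- 1) * cos 1\<close>,
  positive since 1 is below \<open>pi / 2\<close>.\<close>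

lemma compound_poisson_hit_zero_ge:
  assumes "compound_poisson M X"
  obtains a t where "0 < a" "0 < t" "\<And>u. 0 \<le> u \<Longrightarrow> u \<le> t \<Longrightarrow> a \<le> hit_zero u"
proof -
  obtain \<nu> :: "'a measure" where \<nu>: "finite_measure \<nu>" "sets \<nu> = sets borel"
    and exponent: "has_levy_exponent M X (\<lambda>\<xi>. - (CLINT z|\<nu>. iexp (\<xi> \<bullet> z) - 1))"
    using assms unfolding compound_poisson_def by blast
  interpret \<nu>: finite_measure \<nu> by fact
  have [measurable_cong]: "sets \<nu> = sets borel" by fact
  \<comment> \<open>The summand 1 keeps \<open>c\<close> positive when \<open>\<nu>\<close> is the
    zero measure.\<close>
  define c where "c = 2 * measure \<nu> (space \<nu>) + 1"
  have c: "0 < c" by (simp add: c_def add_nonneg_pos)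
  define \<eta> where "\<eta> \<xi> = (CLINT z|\<nu>. iexp (\<xi> \<bullet> z) - 1)" for \<xi>
  have norm_\<eta>: "norm (\<eta> \<xi>) \<le> c" for \<xi>
  proof -
    have le: "norm (iexp (\<xi> \<bullet> z) - 1) \<le> 2" for z :: 'a
      by (rule order_trans[OF norm_triangle_ineq4]) simp
    have "norm (\<eta> \<xi>) \<le> (LINT z|\<nu>. norm (iexp (\<xi> \<bullet> z) - 1))"
      unfolding \<eta>_def by (rule integral_norm_bound)
    also have "\<dots> \<le> (LINT z|\<nu>. 2)"
      by (intro integral_mono \<nu>.integrable_const_bound[where B = 2] AE_I2) (use le in auto)
    finally show ?thesis by (simp add: c_def)
  qed
  have char: "exp (- 1) * cos 1 \<le> Re (char_fn \<xi> u)" if u: "0 \<le> u" "u \<le> 1 / c" for \<xi> u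
  proof -
    define z where "z = of_real u * \<eta> \<xi>"
    have eq: "char_fn \<xi> u = exp z"
      using exponent u unfolding has_levy_exponent_def char_fn_def z_def \<eta>_def by simp
    have "norm z \<le> 1 / c * c"
      unfolding z_def norm_mult using u c by (intro mult_mono norm_\<eta>) auto
    then have z: "norm z \<le> 1" using c by simp
    have "- 1 \<le> Re z"
      using abs_Re_le_cmod[of z] z by linarith
    moreover have "cos 1 \<le> cos \<bar>Im z\<bar>"
      using abs_Im_le_cmod[of z] z pi_gt3 by (intro cos_monotone_0_pi_le) auto
    moreover have "0 \<le> cos (1::real)"
      using pi_gt3 by (intro cos_ge_zero) auto
    ultimately show ?thesis
      unfolding eq Re_exp by (intro mult_mono) auto
  qed
  have "0 < exp (- 1) * cos (1::real)"
    using pi_gt3 by (intro mult_pos_pos cos_gt_zero) auto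
  then show thesis
    using c char by (intro that[of "exp (- 1) * cos 1" "1 / c"] hit_zero_ge_if_char_fn_ge) auto
qed

text \<open>At each time up to \<open>T\<close> the process sits at its starting point with
  probability at least \<open>a\<close>, so the potential at \<open>x\<close> is at least
  \<open>a * t\<close> times the value of \<open>\<bar>q\<bar>\<close> at \<open>x\<close>. A
  horizon with supremum below 1 then bounds \<open>q\<close> by \<open>1 / (a * t)\<close>.\<close>

lemma kato_time_subset_bounded_borel:
  assumes "compound_poisson M X"
  shows "kato_time M X \<subseteq> bounded_borel"
proof
  fix q :: "'a \<Rightarrow> real"
  assume "q \<in> kato_time M X"
  then have q [measurable]: "q \<in> borel_measurable borel"
    and lim: "((\<lambda>t. SUP x. potential (\<lambda>z. ennreal \<bar>q z\<bar>) t x) \<longlongrightarrow> 0) (at_right 0)"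
    by (auto simp: kato_time_eq)
  obtain a T where a: "0 < a" "0 < T" "\<And>u. 0 \<le> u \<Longrightarrow> u \<le> T \<Longrightarrow> a \<le> hit_zero u"
    using compound_poisson_hit_zero_ge[OF assms] by blast
  have "\<forall>\<^sub>F t in at_right 0. (SUP x. potential (\<lambda>z. ennreal \<bar>q z\<bar>) t x) < 1"
    by (rule order_tendstoD(2)[OF lim]) simp
  moreover have "\<forall>\<^sub>F t in at_right 0. t \<in> {0<..<T}"
    by (rule eventually_at_right_real) (rule a)
  ultimately have "\<forall>\<^sub>F t in at_right 0. (SUP x. potential (\<lambda>z. ennreal \<bar>q z\<bar>) t x) < 1 \<and> t \<in> {0<..<T}"
    by eventually_elim simp
  from eventually_happens'[OF trivial_limit_at_right_real this]
  obtain t where t: "0 < t" "t < T" and pot: "(SUP x. potential (\<lambda>z. ennreal \<bar>q z\<bar>) t x) < 1"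
    by auto
  have "\<bar>q x\<bar> \<le> 1 / (a * t)" for x
  proof -
    have "ennreal (\<bar>q x\<bar> * a * t) = (\<integral>\<^sup>+u\<in>{0..t}. ennreal (\<bar>q x\<bar> * a) \<partial>lborel)"
      using t a by (simp add: nn_integral_cmult_indicator ennreal_mult)
    also have "\<dots> \<le> potential (\<lambda>z. ennreal \<bar>q z\<bar>) t x"
      unfolding potential_def
    proof (rule nn_integral_mono)
      fix u
      have "ennreal (\<bar>q x\<bar> * a) \<le> (\<integral>\<^sup>+\<omega>. ennreal \<bar>q (x + X u \<omega>)\<bar> \<partial>M)" if "u \<in> {0..t}"
      proof -
        have "ennreal (\<bar>q x\<bar> * a) \<le> ennreal \<bar>q x\<bar> * ennreal (hit_zero u)"
          using a(3)[of u] that t a(1) by (simp add: ennreal_mult[symmetric] hit_zero_nonneg ennreal_leI mult_left_mono)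
        also have "\<dots> = (\<integral>\<^sup>+\<omega>. ennreal \<bar>q x\<bar> * indicator {0} (X u \<omega>) \<partial>M)"
          unfolding nn_integral_hit_zero[symmetric] by (rule nn_integral_cmult[symmetric]) measurable
        also have "\<dots> \<le> (\<integral>\<^sup>+\<omega>. ennreal \<bar>q (x + X u \<omega>)\<bar> \<partial>M)"
          by (intro nn_integral_mono) (auto simp: indicator_def)
        finally show ?thesis .
      qed
      then show "ennreal (\<bar>q x\<bar> * a) * indicator {0..t} u \<le> (\<integral>\<^sup>+\<omega>. ennreal \<bar>q (x + X u \<omega>)\<bar> \<partial>M) * indicator {0..t} u"
        by (simp add: indicator_def)
    qed
    also have "\<dots> \<le> (SUP x. potential (\<lambda>z. ennreal \<bar>q z\<bar>) t x)"
      by (rule SUP_upper) simp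
    also have "\<dots> \<le> ennreal 1" using pot by simp
    finally have "\<bar>q x\<bar> * a * t \<le> 1"
      by (subst (asm) ennreal_le_iff) auto
    then show ?thesis
      using a t by (simp add: field_simps)
  qed
  then have "bounded (range q)"
    by (intro boundedI[of _ "1 / (a * t)"]) auto
  with q show "q \<in> bounded_borel"
    by (simp add: bounded_borel_def)
qed

text \<open>Every ball contains its centre, so the time spent exactly at \<open>x\<close>
  contributes a positive multiple of \<open>\<bar>q x\<bar>\<close> that does not shrink with
  \<open>r\<close>; a limit 0 forces \<open>q x = 0\<close>.\<close>

lemma kato_space_compound_poisson:
  assumes "compound_poisson M X"
  shows "kato_space M X = {\<lambda>x. 0}"
proof (intro equalityI subsetI)
  fix q :: "'a \<Rightarrow> real"
  assume "q \<in> kato_space M X"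
  then obtain \<alpha> where q [measurable]: "q \<in> borel_measurable borel" and \<alpha>: "0 < \<alpha>"
    and lim: "((\<lambda>r. SUP x. local_resolvent \<alpha> (\<lambda>z. ennreal \<bar>q z\<bar>) r x) \<longlongrightarrow> 0) (at_right 0)"
    by (auto simp: kato_space_eq)
  obtain a t where a: "0 < a" "0 < t" "\<And>u. 0 \<le> u \<Longrightarrow> u \<le> t \<Longrightarrow> a \<le> hit_zero u"
    using compound_poisson_hit_zero_ge[OF assms] by blast
  have [measurable]: "ball (0::'a) r \<in> sets borel" for r by simp
  have "q x = 0" for x
  proof -
    have le: "ennreal (exp (- \<alpha> * t) * (\<bar>q x\<bar> * a) * t) \<le> (SUP x. local_resolvent \<alpha> (\<lambda>z. ennreal \<bar>q z\<bar>) r x)" if "0 < r" for r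
    proof -
      have "ennreal (exp (- \<alpha> * t) * (\<bar>q x\<bar> * a) * t) = (\<integral>\<^sup>+u\<in>{0..t}. ennreal (exp (- \<alpha> * t) * (\<bar>q x\<bar> * a)) \<partial>lborel)"
        using a by (simp add: nn_integral_cmult_indicator ennreal_mult)
      also have "\<dots> \<le> local_resolvent \<alpha> (\<lambda>z. ennreal \<bar>q z\<bar>) r x"
        unfolding local_resolvent_def
      proof (rule nn_integral_mono)
        fix u
        have "ennreal (exp (- \<alpha> * t) * (\<bar>q x\<bar> * a)) \<le> ennreal (exp (- \<alpha> * u)) *
            (\<integral>\<^sup>+\<omega>. indicator (ball 0 r) (X u \<omega>) * ennreal \<bar>q (x + X u \<omega>)\<bar> \<partial>M)" if u: "u \<in> {0..t}"
        proof -
          have "exp (- \<alpha> * t) * (\<bar>q x\<bar> * a) \<le> exp (- \<alpha> * u) * (\<bar>q x\<bar> * hit_zero u)"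
            using a(3)[of u] u a(1) \<alpha> by (intro mult_mono) auto
          then have "ennreal (exp (- \<alpha> * t) * (\<bar>q x\<bar> * a)) \<le> ennreal (exp (- \<alpha> * u)) * (ennreal \<bar>q x\<bar> * ennreal (hit_zero u))"
            by (simp add: ennreal_mult[symmetric] hit_zero_nonneg ennreal_leI)
          also have "ennreal \<bar>q x\<bar> * ennreal (hit_zero u) = (\<integral>\<^sup>+\<omega>. ennreal \<bar>q x\<bar> * indicator {0} (X u \<omega>) \<partial>M)"
            unfolding nn_integral_hit_zero[symmetric] by (rule nn_integral_cmult[symmetric]) measurable
          also have "\<dots> \<le> (\<integral>\<^sup>+\<omega>. indicator (ball 0 r) (X u \<omega>) * ennreal \<bar>q (x + X u \<omega>)\<bar> \<partial>M)"
            using \<open>0 < r\<close> by (intro nn_integral_mono) (auto simp: indicator_def)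
          finally show ?thesis
            by (simp add: mult_left_mono)
        qed
        then show "ennreal (exp (- \<alpha> * t) * (\<bar>q x\<bar> * a)) * indicator {0..t} u \<le> ennreal (exp (- \<alpha> * u)) *
            (\<integral>\<^sup>+\<omega>. indicator (ball 0 r) (X u \<omega>) * ennreal \<bar>q (x + X u \<omega>)\<bar> \<partial>M) * indicator {0..} u"
          by (cases "u \<in> {0..t}") simp_all
      qed
      also have "\<dots> \<le> (SUP x. local_resolvent \<alpha> (\<lambda>z. ennreal \<bar>q z\<bar>) r x)"
        by (rule SUP_upper) simp
      finally show ?thesis .
    qed
    have "ennreal (exp (- \<alpha> * t) * (\<bar>q x\<bar> * a) * t) \<le> 0"
    proof (rule tendsto_lowerbound[OF lim])
      show "\<forall>\<^sub>F r in at_right 0. ennreal (exp (- \<alpha> * t) * (\<bar>q x\<bar> * a) * t) \<le> (SUP x. local_resolvent \<alpha> (\<lambda>z. ennreal \<bar>q z\<bar>) r x)"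
        using eventually_at_right_less[of "0::real"] by eventually_elim (rule le)
    qed simp
    then have "ennreal (exp (- \<alpha> * t) * (\<bar>q x\<bar> * a) * t) = 0"
      by (rule antisym) (rule zero_le)
    then have "exp (- \<alpha> * t) * (\<bar>q x\<bar> * a) * t \<le> 0"
      by (rule ennreal_eq_0_iff[THEN iffD1])
    then show "q x = 0"
      using a by (simp add: mult_le_0_iff zero_le_mult_iff not_less)
  qed
  then show "q \<in> {\<lambda>x. 0}" by auto
next
  fix q :: "'a \<Rightarrow> real"
  assume "q \<in> {\<lambda>x. 0}"
  then have "q = (\<lambda>x. 0)" by simp
  moreover have "local_resolvent 1 (\<lambda>z. ennreal \<bar>0\<bar>) r x = 0" for r and x :: 'a
    by (simp add: local_resolvent_def)
  ultimately have "((\<lambda>r. SUP x. local_resolvent 1 (\<lambda>z. ennreal \<bar>q z\<bar>) r x) \<longlongrightarrow> 0) (at_right 0)"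
    by simp
  moreover have "q \<in> borel_measurable borel"
    using \<open>q = (\<lambda>x. 0)\<close> by simp
  ultimately show "q \<in> kato_space M X"
    unfolding kato_space_eq using zero_less_one by blast
qed

end

theorem proposition3p8:
  fixes M :: "'w measure" and X :: "real \<Rightarrow> 'w \<Rightarrow> real ^ 'd"
  assumes "levy_process M X"
  shows "(kato_space M X \<subseteq> kato_time M X \<and> kato_time M X \<subseteq> L1_loc_uni) \<and>
         bounded_borel \<subseteq> kato_time M X \<and>
         (\<not> compound_poisson M X \<longrightarrow> bounded_borel \<subseteq> kato_space M X) \<and>
         (compound_poisson M X \<longrightarrow>
            kato_space M X = {\<lambda>x. 0} \<and> kato_time M X = bounded_borel)"
proof -
  \<comment> \<open>The two classes and the compound Poisson property see the paths only at
    nonnegative times and up to a null set, so all may be computed for \<open>Y\<close>.\<close>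
  obtain Y where "rc_levy_process M Y" and eq: "AE \<omega> in M. \<forall>u\<ge>0. X u \<omega> = Y u \<omega>"
    using levy_process.rc_modification[OF assms] .
  then interpret Y: rc_levy_process M Y by simp
  have "kato_time M X = kato_time M Y" "kato_space M X = kato_space M Y"
    and "compound_poisson M X = compound_poisson M Y"
    using eq assms Y.levy_process_axioms
    by (simp_all only: kato_time_cong[OF eq] kato_space_cong[OF eq] compound_poisson_cong[OF assms Y.levy_process_axioms eq])
  then show ?thesis
    using Y.kato_space_subset_kato_time Y.kato_time_subset_L1_loc_uni Y.bounded_borel_subset_kato_time
      Y.bounded_borel_subset_kato_space Y.kato_space_compound_poisson Y.kato_time_subset_bounded_borel
    by (simp add: equalityI)
qed

end
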